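(* (i) Given a simple recursive game with starting position $v_0$, together with the value $\mathrm{Val}(v_0)$ of the starting position, a weak solution to the game can be found in time linear in the size of the game, i.e. in time $O(m)$ where $m$ is the number of arcs. (ii) Given a simple recursive game together with the values $\mathrm{Val}(v)$ of all its positions $v$, a strong solution to the game can be found in linear time $O(m)$.
   Context: A simple recursive game (SRG) is a finite directed graph whose vertices (positions) are partitioned into non-terminals $V_{\mathrm{Min}}$ and $V_{\mathrm{Max}}$, belonging to players Min and Max respectively, and terminals $T$, together with a payoff function $p : T \to \mathbf{R}$. Every non-terminal has at least one outgoing arc. A play from a vertex moves a token: at a non-terminal, its owner chooses the outgoing arc along which the token moves; if a terminal $t$ is reached, the game ends and Min pays Max $p(t)$; infinite play gives payoff $0$. Let $n=|T|$ and let $m$ be the number of arcs. Standing assumptions: $p$ is injective and $m \ge n$ (terminals without incoming arcs are irrelevant). A positional strategy for a player is a selection of one outgoing arc for each of his vertices. Each vertex $v$ has a value $\mathrm{Val}(v)\in\mathbf{R}$: Max has a positional strategy ensuring payoff at least $\mathrm{Val}(v)$ from $v$ against every strategy of Min, and Min has a positional strategy ensuring payoff at most $\mathrm{Val}(v)$ from $v$ against every strategy of Max. A weak solution is $\mathrm{Val}(v_0)$ together with a positional strategy of Max ensuring payoff at least $\mathrm{Val}(v_0)$ from $v_0$ and a positional strategy of Min ensuring payoff at most $\mathrm{Val}(v_0)$ from $v_0$. A strong solution is the list of values of all vertices together with a single positional strategy for Max that ensures payoff at least $\mathrm{Val}(v)$ from every vertex $v$, and a single positional strategy for Min that ensures payoff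 at most $\mathrm{Val}(v)$ from every vertex $v$. Algorithms are comparison-based (they access payoffs and given values only through comparisons of these numbers with one another and with $0$, each taking unit time), and time is measured on a standard random access machine, in the worst case. *)

theory Defs
  imports Complex_Main "HOL-Library.Landau_Symbols"
begin

section \<open>Simple recursive games\<close>

record 'v srg =
  V_min :: "'v set"
  V_max :: "'v set"
  terminals :: "'v set"
  arcs :: "('v \<times> 'v) set"
  payoff :: "'v \<Rightarrow> real"

definition positions :: "'v srg \<Rightarrow> 'v set" where
  "positions G = V_min G \<union> V_max G \<union> terminals G"

text \<open>The last two conjuncts are standing assumptions: distinct terminals have distinct payoffs, and
  there are at least as many arcs as terminals. Arcs leaving a terminal are not forbidden, but no play
  ever uses them.\<close>

definition simple_recursive_game :: "'v srg \<Rightarrow> bool" where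
  "simple_recursive_game G \<longleftrightarrow>
     finite (positions G) \<and>
     V_min G \<inter> V_max G = {} \<and> V_min G \<inter> terminals G = {} \<and> V_max G \<inter> terminals G = {} \<and>
     arcs G \<subseteq> positions G \<times> positions G \<and>
     (\<forall>v \<in> V_min G \<union> V_max G. \<exists>w. (v, w) \<in> arcs G) \<and>
     inj_on (payoff G) (terminals G) \<and>
     card (terminals G) \<le> card (arcs G)"

text \<open>A general strategy \<open>s\<close> selects the move \<open>s h v\<close> at the current vertex \<open>v\<close> depending on the
  list \<open>h\<close> of vertices visited before. In both predicates \<open>A\<close> is the set of vertices of the player.\<close>

definition strategy :: "'v srg \<Rightarrow> 'v set \<Rightarrow> ('v list \<Rightarrow> 'v \<Rightarrow> 'v) \<Rightarrow> bool" where
  "strategy G A s \<longleftrightarrow> (\<forall>h. \<forall>v \<in> A. (v, s h v) \<in> arcs G)"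

definition positional_strategy :: "'v srg \<Rightarrow> 'v set \<Rightarrow> ('v \<Rightarrow> 'v) \<Rightarrow> bool" where
  "positional_strategy G A \<sigma> \<longleftrightarrow> (\<forall>v \<in> A. (v, \<sigma> v) \<in> arcs G)"

text \<open>The play from \<open>v\<close> when Max uses \<open>s\<close> and Min uses \<open>t\<close>: history and current vertex after \<open>k\<close>
  moves. At a terminal the token stays put.\<close>

primrec play ::
  "'v srg \<Rightarrow> ('v list \<Rightarrow> 'v \<Rightarrow> 'v) \<Rightarrow> ('v list \<Rightarrow> 'v \<Rightarrow> 'v) \<Rightarrow> 'v \<Rightarrow> nat \<Rightarrow> 'v list \<times> 'v" where
  "play G s t v 0 = ([], v)"
| "play G s t v (Suc k) =
     (let (h, u) = play G s t v k
      in (h @ [u], if u \<in> V_max G then s h u else if u \<in> V_min G then t h u else u))"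

definition outcome ::
  "'v srg \<Rightarrow> ('v list \<Rightarrow> 'v \<Rightarrow> 'v) \<Rightarrow> ('v list \<Rightarrow> 'v \<Rightarrow> 'v) \<Rightarrow> 'v \<Rightarrow> real" where
  "outcome G s t v =
     (if \<exists>k. snd (play G s t v k) \<in> terminals G
      then payoff G (snd (play G s t v (LEAST k. snd (play G s t v k) \<in> terminals G)))
      else 0)"

definition max_ensures :: "'v srg \<Rightarrow> ('v \<Rightarrow> 'v) \<Rightarrow> 'v \<Rightarrow> real \<Rightarrow> bool" where
  "max_ensures G \<sigma> v x \<longleftrightarrow> (\<forall>t. strategy G (V_min G) t \<longrightarrow> outcome G (\<lambda>h. \<sigma>) t v \<ge> x)"

definition min_ensures :: "'v srg \<Rightarrow> ('v \<Rightarrow> 'v) \<Rightarrow> 'v \<Rightarrow> real \<Rightarrow> bool" where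
  "min_ensures G \<tau> v x \<longleftrightarrow> (\<forall>s. strategy G (V_max G) s \<longrightarrow> outcome G s (\<lambda>h. \<tau>) v \<le> x)"

definition Val :: "'v srg \<Rightarrow> 'v \<Rightarrow> real" where
  "Val G v = (THE x.
     (\<exists>\<sigma>. positional_strategy G (V_max G) \<sigma> \<and> max_ensures G \<sigma> v x) \<and>
     (\<exists>\<tau>. positional_strategy G (V_min G) \<tau> \<and> min_ensures G \<tau> v x))"

definition weak_solution :: "'v srg \<Rightarrow> 'v \<Rightarrow> real \<Rightarrow> ('v \<Rightarrow> 'v) \<Rightarrow> ('v \<Rightarrow> 'v) \<Rightarrow> bool" where
  "weak_solution G v\<^sub>0 x \<sigma> \<tau> \<longleftrightarrow>
     x = Val G v\<^sub>0 \<and>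
     positional_strategy G (V_max G) \<sigma> \<and> max_ensures G \<sigma> v\<^sub>0 (Val G v\<^sub>0) \<and>
     positional_strategy G (V_min G) \<tau> \<and> min_ensures G \<tau> v\<^sub>0 (Val G v\<^sub>0)"

definition strong_solution :: "'v srg \<Rightarrow> ('v \<Rightarrow> real) \<Rightarrow> ('v \<Rightarrow> 'v) \<Rightarrow> ('v \<Rightarrow> 'v) \<Rightarrow> bool" where
  "strong_solution G val \<sigma> \<tau> \<longleftrightarrow>
     (\<forall>v \<in> positions G. val v = Val G v) \<and>
     positional_strategy G (V_max G) \<sigma> \<and> (\<forall>v \<in> positions G. max_ensures G \<sigma> v (Val G v)) \<and>
     positional_strategy G (V_min G) \<tau> \<and> (\<forall>v \<in> positions G. min_ensures G \<tau> v (Val G v))"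


section \<open>Comparison-based random access machines\<close>

text \<open>A unit-cost random access machine with registers and memory holding natural numbers. The real
  numbers of the input lie in a separate read-only store; a program refers to them by their index
  there and has no access to them other than the three comparison jumps \<open>NumLess\<close>, \<open>NumNeg\<close> and
  \<open>NumPos\<close>. All operands are register names, except for the constant of \<open>Const\<close> and jump targets,
  which come last.\<close>

datatype instr =
    Const nat nat
  | Move nat nat
  | Add nat nat nat
  | Sub nat nat nat
  | Load nat nat nat
  | Store nat nat nat
  | Jump nat
  | JumpEq nat nat nat
  | JumpLess nat nat nat
  | NumLess nat nat nat
  | NumNeg nat nat
  | NumPos nat nat

record state =
  pc :: nat
  reg :: "nat \<Rightarrow> nat"
  mem :: "nat \<Rightarrow> nat"

definition set_reg :: "nat \<Rightarrow> nat \<Rightarrow> state \<Rightarrow> state" where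
  "set_reg r x s = s\<lparr>pc := Suc (pc s), reg := (reg s)(r := x)\<rparr>"

definition branch :: "bool \<Rightarrow> nat \<Rightarrow> state \<Rightarrow> state" where
  "branch b l s = s\<lparr>pc := (if b then l else Suc (pc s))\<rparr>"

text \<open>\<open>X\<close> is the store of real numbers. Loads and stores use base register plus index register;
  subtraction is truncated at zero.\<close>

fun exec :: "(nat \<Rightarrow> real) \<Rightarrow> instr \<Rightarrow> state \<Rightarrow> state" where
  "exec X (Const r c) s = set_reg r c s"
| "exec X (Move r a) s = set_reg r (reg s a) s"
| "exec X (Add r a b) s = set_reg r (reg s a + reg s b) s"
| "exec X (Sub r a b) s = set_reg r (reg s a - reg s b) s"
| "exec X (Load r a b) s = set_reg r (mem s (reg s a + reg s b)) s"
| "exec X (Store a b r) s =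
     s\<lparr>pc := Suc (pc s), mem := (mem s)(reg s a + reg s b := reg s r)\<rparr>"
| "exec X (Jump l) s = branch True l s"
| "exec X (JumpEq a b l) s = branch (reg s a = reg s b) l s"
| "exec X (JumpLess a b l) s = branch (reg s a < reg s b) l s"
| "exec X (NumLess a b l) s = branch (X (reg s a) < X (reg s b)) l s"
| "exec X (NumNeg a l) s = branch (X (reg s a) < 0) l s"
| "exec X (NumPos a l) s = branch (X (reg s a) > 0) l s"

definition halted :: "instr list \<Rightarrow> state \<Rightarrow> bool" where
  "halted P s \<longleftrightarrow> length P \<le> pc s"

definition step :: "instr list \<Rightarrow> (nat \<Rightarrow> real) \<Rightarrow> state \<Rightarrow> state" where
  "step P X s = (if halted P s then s else exec X (P ! pc s) s)"

definition bounded_state :: "nat \<Rightarrow> state \<Rightarrow> bool" where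
  "bounded_state w s \<longleftrightarrow> (\<forall>i. reg s i \<le> w \<and> mem s i \<le> w)"

text \<open>Started in \<open>s\<close>, the program halts in \<open>s'\<close> after at most \<open>t\<close> steps, and no integer greater
  than \<open>w\<close> ever occurs. The second condition excludes exploiting unit-cost arithmetic on huge
  integers.\<close>

definition runs ::
  "instr list \<Rightarrow> (nat \<Rightarrow> real) \<Rightarrow> nat \<Rightarrow> nat \<Rightarrow> state \<Rightarrow> state \<Rightarrow> bool" where
  "runs P X t w s s' \<longleftrightarrow>
     (\<exists>k \<le> t. s' = (step P X ^^ k) s \<and> halted P s' \<and>
        (\<forall>j \<le> k. bounded_state w ((step P X ^^ j) s)))"


section \<open>Representation of games\<close>

text \<open>Positions of an input game are numbered \<open>0, \<dots>, N - 1\<close>, where \<open>N = card (positions G)\<close>. The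
  game is given by adjacency lists in arbitrary order, stored one after another. The memory holds,
  from address 0 on: \<open>N\<close>; the number of arcs; the owners of the positions (0 for Min, 1 for Max,
  2 for a terminal); for each \<open>v \<le> N\<close> the total length of the adjacency lists of the positions
  below \<open>v\<close>; and the heads of all arcs.\<close>

definition adjacency_lists :: "nat srg \<Rightarrow> (nat \<Rightarrow> nat list) \<Rightarrow> bool" where
  "adjacency_lists G adj \<longleftrightarrow>
     (\<forall>v \<in> positions G. distinct (adj v) \<and> set (adj v) = {w. (v, w) \<in> arcs G})"

definition input_game :: "nat srg \<Rightarrow> (nat \<Rightarrow> nat list) \<Rightarrow> bool" where
  "input_game G adj \<longleftrightarrow>
     simple_recursive_game G \<and> positions G = {..<card (positions G)} \<and> adjacency_lists G adj"

definition graph_code :: "nat srg \<Rightarrow> (nat \<Rightarrow> nat list) \<Rightarrow> nat list" where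
  "graph_code G adj = (let N = card (positions G) in
     [N, card (arcs G)]
     @ map (\<lambda>v. if v \<in> V_min G then 0 else if v \<in> V_max G then 1 else 2) [0..<N]
     @ map (\<lambda>v. \<Sum>u<v. length (adj u)) [0..<Suc N]
     @ concat (map adj [0..<N]))"

definition cells :: "'a::zero list \<Rightarrow> nat \<Rightarrow> 'a" where
  "cells xs i = (if i < length xs then xs ! i else 0)"

definition initial_state :: "nat list \<Rightarrow> state" where
  "initial_state xs = \<lparr>pc = 0, reg = (\<lambda>_. 0), mem = cells xs\<rparr>"

text \<open>Number store: the payoff of a terminal \<open>t\<close> has index \<open>t\<close>, and the given values follow from
  index \<open>N\<close> on. Indices of non-terminals hold a dummy 0.\<close>

definition payoff_list :: "nat srg \<Rightarrow> real list" where
  "payoff_list G =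
     map (\<lambda>v. if v \<in> terminals G then payoff G v else 0) [0..<card (positions G)]"

definition weak_numbers :: "nat srg \<Rightarrow> nat \<Rightarrow> nat \<Rightarrow> real" where
  "weak_numbers G v\<^sub>0 = cells (payoff_list G @ [Val G v\<^sub>0])"

definition strong_numbers :: "nat srg \<Rightarrow> nat \<Rightarrow> real" where
  "strong_numbers G = cells (payoff_list G @ map (Val G) [0..<card (positions G)])"

definition weak_start :: "nat srg \<Rightarrow> (nat \<Rightarrow> nat list) \<Rightarrow> nat \<Rightarrow> state" where
  "weak_start G adj v\<^sub>0 = initial_state (graph_code G adj @ [v\<^sub>0])"

definition strong_start :: "nat srg \<Rightarrow> (nat \<Rightarrow> nat list) \<Rightarrow> state" where
  "strong_start G adj = initial_state (graph_code G adj)"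

text \<open>Upon halting, registers 0 and 1 hold the addresses of arrays containing the strategies of Max
  and Min. Real numbers are returned as indices into the number store: of \<open>Val G v\<^sub>0\<close> in register 2
  for a weak solution, of all values in an array whose address is in register 2 for a strong one.\<close>

definition array_at :: "state \<Rightarrow> nat \<Rightarrow> nat \<Rightarrow> nat" where
  "array_at s r i = mem s (reg s r + i)"

definition outputs_weak_solution :: "nat srg \<Rightarrow> nat \<Rightarrow> state \<Rightarrow> bool" where
  "outputs_weak_solution G v\<^sub>0 s \<longleftrightarrow>
     weak_solution G v\<^sub>0 (weak_numbers G v\<^sub>0 (reg s 2)) (array_at s 0) (array_at s 1)"

definition outputs_strong_solution :: "nat srg \<Rightarrow> state \<Rightarrow> bool" where
  "outputs_strong_solution G s \<longleftrightarrow>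
     strong_solution G (\<lambda>v. strong_numbers G (array_at s 2 v)) (array_at s 0) (array_at s 1)"

text \<open>Bounds in terms of the number of arcs: linear running time, and integers of polynomial
  magnitude, that is, machine words of logarithmic length.\<close>

definition resource_bounds :: "(nat \<Rightarrow> nat) \<Rightarrow> (nat \<Rightarrow> nat) \<Rightarrow> bool" where
  "resource_bounds T W \<longleftrightarrow>
     (\<lambda>m. real (T m)) \<in> O(\<lambda>m. real m) \<and> (\<exists>d. (\<lambda>m. real (W m)) \<in> O(\<lambda>m. real m ^ d))"

end

theory Submission
  imports Defs
begin

text \<open>For \<open>x > 0\<close>, Max can ensure \<open>x\<close> exactly from the positions from which he can force the play into the
  terminals paying at least \<open>x\<close>; for \<open>x \<le> 0\<close>, exactly from those from which Min cannot force it into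
  the terminals paying less than \<open>x\<close>. Hence values exist, and a weak solution consists of the
  strategies read off from two attractors, one for each player. A strong solution comes from a single
  attractor to all terminals in the graph of the arcs between positions of equal value. Following any
  such arc keeps the value, so the play can go wrong only by never ending; this hurts Max only at
  positive values and Min only at negative values, and there the attractor makes progress.

  An attractor is computed in linear time by peeling: each position carries a counter, initially 1 if the
  attracting player moves there and its number of arcs otherwise, which is decremented along the
  incoming arcs of every position that enters the attractor.

  The algorithms are written in a small structured language with named arrays, for which a weakest
  precondition calculus with a clock is available, and are compiled to the random access machine.\<close>

section \<open>A structured language for random access machines\<close>

text \<open>The payoff 0 of endless play causes all case distinctions: choosing arcs that keep the
  value is not enough, since at a positive value Max could circle forever and be left with 0. In the
  weak problem a single value is known, so arcs between positions of equal value cannot be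
  recognised; the attractors there run in the full graph, and payoffs are compared with that one
  number only. Payoffs are never sorted, which comparisons could not do in linear time. The machine
  model asks, besides the time bound, that every integer stay polynomially bounded at every step.
  The source language therefore has a cost and a bound \<open>w\<close>, and its semantics offers no
  derivation for an addition that exceeds \<open>w\<close> or an access outside an array. Costs come
  out in terms of N + m, with N positions and m arcs. They are linear in m because every
  non-terminal has an outgoing arc and there are at most m terminals. Optimal play of Min is reduced
  to that of Max by exchanging the players and negating the payoffs.\<close>

datatype arr = Mem | Own | Off | Heads
  | Src bool | Nxt bool | Hd bool | Cnt bool | Str bool | Lab bool | Que bool

datatype test = Equal nat nat | Less nat nat | NLess nat nat | NNeg nat | NPos nat

datatype com =
    Nop
  | Set nat nat
  | Copy nat nat
  | Plus nat nat nat
  | Minus nat nat nat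
  | Get nat arr nat
  | Put arr nat nat
  | Seq com com (infixr ";;" 60)
  | Cond test com com
  | While test com

type_synonym regs = "nat \<Rightarrow> nat"
type_synonym arrs = "arr \<Rightarrow> nat \<Rightarrow> nat"

fun holds :: "(nat \<Rightarrow> real) \<Rightarrow> test \<Rightarrow> regs \<Rightarrow> bool" where
  "holds X (Equal a b) \<rho> \<longleftrightarrow> \<rho> a = \<rho> b"
| "holds X (Less a b) \<rho> \<longleftrightarrow> \<rho> a < \<rho> b"
| "holds X (NLess a b) \<rho> \<longleftrightarrow> X (\<rho> a) < X (\<rho> b)"
| "holds X (NNeg a) \<rho> \<longleftrightarrow> X (\<rho> a) < 0"
| "holds X (NPos a) \<rho> \<longleftrightarrow> X (\<rho> a) > 0"

text \<open>Only \<open>Set\<close> and \<open>Plus\<close> can create an integer larger than those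
  already present, so only they are bounded by \<open>w\<close>. The cost 2 of a test pays for the
  conditional jump and one unconditional jump of the compiled code; where the latter is skipped, it
  is an upper bound.\<close>

inductive big :: "(nat \<Rightarrow> real) \<Rightarrow> nat \<Rightarrow> (arr \<Rightarrow> nat) \<Rightarrow>
    com \<Rightarrow> regs \<Rightarrow> arrs \<Rightarrow> nat \<Rightarrow> regs \<Rightarrow> arrs \<Rightarrow> bool" for X w sz where
  "big X w sz Nop \<rho> \<alpha> 0 \<rho> \<alpha>"
| "c \<le> w \<Longrightarrow> big X w sz (Set r c) \<rho> \<alpha> 1 (\<rho>(r := c)) \<alpha>"
| "big X w sz (Copy r a) \<rho> \<alpha> 1 (\<rho>(r := \<rho> a)) \<alpha>"
| "\<rho> a + \<rho> b \<le> w \<Longrightarrow> big X w sz (Plus r a b) \<rho> \<alpha> 1 (\<rho>(r := \<rho> a + \<rho> b)) \<alpha>"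
| "big X w sz (Minus r a b) \<rho> \<alpha> 1 (\<rho>(r := \<rho> a - \<rho> b)) \<alpha>"
| "\<rho> a < sz A \<Longrightarrow> big X w sz (Get r A a) \<rho> \<alpha> 1 (\<rho>(r := \<alpha> A (\<rho> a))) \<alpha>"
| "\<rho> a < sz A \<Longrightarrow> big X w sz (Put A a r) \<rho> \<alpha> 1 \<rho> (\<alpha>(A := (\<alpha> A)(\<rho> a := \<rho> r)))"
| "big X w sz c \<rho> \<alpha> t \<rho>' \<alpha>' \<Longrightarrow> big X w sz d \<rho>' \<alpha>' t' \<rho>'' \<alpha>'' \<Longrightarrow>
     big X w sz (c ;; d) \<rho> \<alpha> (t + t') \<rho>'' \<alpha>''"
| "holds X b \<rho> \<Longrightarrow> big X w sz c \<rho> \<alpha> t \<rho>' \<alpha>' \<Longrightarrow> big X w sz (Cond b c d) \<rho> \<alpha> (2 + t) \<rho>' \<alpha>'"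
| "\<not> holds X b \<rho> \<Longrightarrow> big X w sz d \<rho> \<alpha> t \<rho>' \<alpha>' \<Longrightarrow> big X w sz (Cond b c d) \<rho> \<alpha> (2 + t) \<rho>' \<alpha>'"
| "\<not> holds X b \<rho> \<Longrightarrow> big X w sz (While b c) \<rho> \<alpha> 2 \<rho> \<alpha>"
| "holds X b \<rho> \<Longrightarrow> big X w sz c \<rho> \<alpha> t \<rho>' \<alpha>' \<Longrightarrow> big X w sz (While b c) \<rho>' \<alpha>' t' \<rho>'' \<alpha>'' \<Longrightarrow>
     big X w sz (While b c) \<rho> \<alpha> (2 + t + t') \<rho>'' \<alpha>''"

inductive_cases big_NopE: "big X w sz Nop \<rho> \<alpha> t \<rho>' \<alpha>'"
inductive_cases big_SetE: "big X w sz (Set r c) \<rho> \<alpha> t \<rho>' \<alpha>'"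
inductive_cases big_CopyE: "big X w sz (Copy r a) \<rho> \<alpha> t \<rho>' \<alpha>'"
inductive_cases big_PlusE: "big X w sz (Plus r a b) \<rho> \<alpha> t \<rho>' \<alpha>'"
inductive_cases big_MinusE: "big X w sz (Minus r a b) \<rho> \<alpha> t \<rho>' \<alpha>'"
inductive_cases big_GetE: "big X w sz (Get r A a) \<rho> \<alpha> t \<rho>' \<alpha>'"
inductive_cases big_PutE: "big X w sz (Put A a r) \<rho> \<alpha> t \<rho>' \<alpha>'"
inductive_cases big_SeqE: "big X w sz (c ;; d) \<rho> \<alpha> t \<rho>' \<alpha>'"
inductive_cases big_CondE: "big X w sz (Cond b c d) \<rho> \<alpha> t \<rho>' \<alpha>'"

text \<open>The clock \<open>k\<close> counts upwards from the start of the whole program.\<close>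

definition wp :: "(nat \<Rightarrow> real) \<Rightarrow> nat \<Rightarrow> (arr \<Rightarrow> nat) \<Rightarrow> com \<Rightarrow>
    (regs \<Rightarrow> arrs \<Rightarrow> nat \<Rightarrow> bool) \<Rightarrow> regs \<Rightarrow> arrs \<Rightarrow> nat \<Rightarrow> bool" where
  "wp X w sz c Q \<rho> \<alpha> k \<longleftrightarrow> (\<exists>t \<rho>' \<alpha>'. big X w sz c \<rho> \<alpha> t \<rho>' \<alpha>' \<and> Q \<rho>' \<alpha>' (k + t))"

lemma wp_simps:
  "wp X w sz Nop Q \<rho> \<alpha> k \<longleftrightarrow> Q \<rho> \<alpha> k"
  "wp X w sz (Set r x) Q \<rho> \<alpha> k \<longleftrightarrow> x \<le> w \<and> Q (\<rho>(r := x)) \<alpha> (k + 1)"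
  "wp X w sz (Copy r a) Q \<rho> \<alpha> k \<longleftrightarrow> Q (\<rho>(r := \<rho> a)) \<alpha> (k + 1)"
  "wp X w sz (Plus r a b) Q \<rho> \<alpha> k \<longleftrightarrow> \<rho> a + \<rho> b \<le> w \<and> Q (\<rho>(r := \<rho> a + \<rho> b)) \<alpha> (k + 1)"
  "wp X w sz (Minus r a b) Q \<rho> \<alpha> k \<longleftrightarrow> Q (\<rho>(r := \<rho> a - \<rho> b)) \<alpha> (k + 1)"
  "wp X w sz (Get r A a) Q \<rho> \<alpha> k \<longleftrightarrow> \<rho> a < sz A \<and> Q (\<rho>(r := \<alpha> A (\<rho> a))) \<alpha> (k + 1)"
  "wp X w sz (Put A a r) Q \<rho> \<alpha> k \<longleftrightarrow>
     \<rho> a < sz A \<and> Q \<rho> (\<alpha>(A := (\<alpha> A)(\<rho> a := \<rho> r))) (k + 1)"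
  unfolding wp_def
  by (fastforce intro: big.intros
      elim: big_NopE big_SetE big_CopyE big_PlusE big_MinusE big_GetE big_PutE
      simp: add.assoc)+

lemma wp_Cond:
  "wp X w sz (Cond b c d) Q \<rho> \<alpha> k \<longleftrightarrow>
     (if holds X b \<rho> then wp X w sz c Q \<rho> \<alpha> (k + 2) else wp X w sz d Q \<rho> \<alpha> (k + 2))"
proof -
  have "big X w sz (Cond b c d) \<rho> \<alpha> t \<rho>' \<alpha>' \<longleftrightarrow>
      (\<exists>t'. t = 2 + t' \<and> big X w sz (if holds X b \<rho> then c else d) \<rho> \<alpha> t' \<rho>' \<alpha>')" for t \<rho>' \<alpha>'
    using big.intros(9,10)[of X _ \<rho> w sz] by (auto elim!: big_CondE)
  then show ?thesis
    unfolding wp_def by (cases "holds X b \<rho>") (force simp: add.assoc)+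
qed

lemma wp_Seq: "wp X w sz (c ;; d) Q \<rho> \<alpha> k \<longleftrightarrow> wp X w sz c (wp X w sz d Q) \<rho> \<alpha> k"
  unfolding wp_def by (fastforce intro: big.intros elim: big_SeqE simp: add.assoc)

text \<open>No variant is needed: every iteration advances the clock, which the invariant bounds by \<open>K\<close>.\<close>

lemma wp_While:
  assumes "I \<rho> \<alpha> k"
    and body: "\<And>\<rho> \<alpha> k. I \<rho> \<alpha> k \<Longrightarrow> holds X b \<rho> \<Longrightarrow> k \<le> K \<and> wp X w sz c I \<rho> \<alpha> (k + 2)"
    and exit: "\<And>\<rho> \<alpha> k. I \<rho> \<alpha> k \<Longrightarrow> \<not> holds X b \<rho> \<Longrightarrow> Q \<rho> \<alpha> (k + 2)"
  shows "wp X w sz (While b c) Q \<rho> \<alpha> k"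
  using assms(1)
proof (induction "Suc K - k" arbitrary: \<rho> \<alpha> k rule: less_induct)
  case less
  show ?case
  proof (cases "holds X b \<rho>")
    case True
    with body[OF less.prems] obtain t \<rho>' \<alpha>' where
      *: "k \<le> K" "big X w sz c \<rho> \<alpha> t \<rho>' \<alpha>'" "I \<rho>' \<alpha>' (k + 2 + t)"
      by (auto simp: wp_def)
    then have "wp X w sz (While b c) Q \<rho>' \<alpha>' (k + 2 + t)"
      by (intro less.hyps) auto
    with True * show ?thesis
      unfolding wp_def by (fastforce intro: big.intros simp: add.assoc)
  next
    case False
    with exit[OF less.prems] show ?thesis
      unfolding wp_def by (blast intro: big.intros)
  qed
qed

section \<open>Compilation to machine code and its correctness\<close>

fun jump_if :: "test \<Rightarrow> nat \<Rightarrow> instr" where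
  "jump_if (Equal a b) l = JumpEq a b l"
| "jump_if (Less a b) l = JumpLess a b l"
| "jump_if (NLess a b) l = NumLess a b l"
| "jump_if (NNeg a) l = NumNeg a l"
| "jump_if (NPos a) l = NumPos a l"

text \<open>\<open>f A\<close> is the register that holds the base address of the array \<open>A\<close>.\<close>

fun compile :: "(arr \<Rightarrow> nat) \<Rightarrow> nat \<Rightarrow> com \<Rightarrow> instr list" where
  "compile f l Nop = []"
| "compile f l (Set r c) = [Const r c]"
| "compile f l (Copy r a) = [Move r a]"
| "compile f l (Plus r a b) = [Add r a b]"
| "compile f l (Minus r a b) = [Sub r a b]"
| "compile f l (Get r A a) = [Load r (f A) a]"
| "compile f l (Put A a r) = [Store (f A) a r]"
| "compile f l (c ;; d) = (let C = compile f l c in C @ compile f (l + length C) d)"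
| "compile f l (Cond b c d) =
     (let D = compile f (l + 1) d; C = compile f (l + length D + 2) c
      in jump_if b (l + length D + 2) # D @ Jump (l + length D + 2 + length C) # C)"
| "compile f l (While b c) =
     (let C = compile f (l + 2) c
      in [jump_if b (l + 2), Jump (l + length C + 3)] @ C @ [Jump l])"

definition code_at :: "instr list \<Rightarrow> nat \<Rightarrow> instr list \<Rightarrow> bool" where
  "code_at P l C \<longleftrightarrow> (\<exists>A B. P = A @ C @ B \<and> length A = l)"

lemma code_at_Cons: "code_at P l (i # C) \<Longrightarrow> l < length P \<and> P ! l = i \<and> code_at P (Suc l) C"
  unfolding code_at_def by (metis (no_types, opaque_lifting) append.assoc append_Cons append_Nil
      length_append_singleton length_append less_add_same_cancel1 list.size(3) nth_append_length
      add_less_cancel_left length_greater_0_conv list.discI)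

lemma code_at_append: "code_at P l (C @ D) \<longleftrightarrow> code_at P l C \<and> code_at P (l + length C) D"
  unfolding code_at_def
proof safe
  fix A B assume "P = A @ (C @ D) @ B" "l = length A"
  then show "\<exists>A' B'. A @ (C @ D) @ B = A' @ C @ B' \<and> length A' = length A"
    "\<exists>A' B'. A @ (C @ D) @ B = A' @ D @ B' \<and> length A' = length A + length C"
    by (metis append.assoc) (metis append.assoc length_append)
next
  fix A B A' B' assume *: "A @ C @ B = A' @ D @ B'" "length A' = length A + length C"
  then have "A' = A @ C"
    by (metis (no_types, lifting) append.assoc append_eq_append_conv length_append)
  with * show "\<exists>A'' B''. A @ C @ B = A'' @ (C @ D) @ B'' \<and> length A'' = length A"
    by (metis append.assoc)
qed

text \<open>This is \<open>runs\<close> without the demand to halt, so that executions of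
  consecutive pieces of code can be chained.\<close>

definition reach :: "instr list \<Rightarrow> (nat \<Rightarrow> real) \<Rightarrow> nat \<Rightarrow> nat \<Rightarrow> state \<Rightarrow> state \<Rightarrow> bool" where
  "reach P X w t s s' \<longleftrightarrow>
     (\<exists>k \<le> t. s' = (step P X ^^ k) s \<and> (\<forall>j \<le> k. bounded_state w ((step P X ^^ j) s)))"

lemma reach_refl: "bounded_state w s \<Longrightarrow> reach P X w 0 s s"
  by (auto simp: reach_def)

lemma reach_step: "bounded_state w s \<Longrightarrow> bounded_state w (step P X s) \<Longrightarrow> reach P X w 1 s (step P X s)"
  unfolding reach_def by (rule exI[of _ 1]) (auto simp: le_Suc_eq)

lemma reach_trans:
  assumes "reach P X w t s s'" "reach P X w t' s' s''"
  shows "reach P X w (t + t') s s''"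
proof -
  obtain k k' where k: "k \<le> t" "s' = (step P X ^^ k) s" "\<forall>j \<le> k. bounded_state w ((step P X ^^ j) s)"
    and k': "k' \<le> t'" "s'' = (step P X ^^ k') s'" "\<forall>j \<le> k'. bounded_state w ((step P X ^^ j) s')"
    using assms by (auto simp: reach_def)
  have "bounded_state w ((step P X ^^ j) s)" if "j \<le> k + k'" for j
  proof (cases "j \<le> k")
    case False
    define i where "i = j - k"
    have "j = i + k" "i \<le> k'" using that False by (auto simp: i_def)
    then show ?thesis using k k' by (simp add: funpow_add)
  qed (use k in auto)
  then show ?thesis
    unfolding reach_def using k k' by (intro exI[of _ "k' + k"]) (auto simp: funpow_add)
qed

lemma reach_mono: "reach P X w t s s' \<Longrightarrow> t \<le> t' \<Longrightarrow> reach P X w t' s s'"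
  unfolding reach_def by (elim exE conjE, rule exI, rule conjI[OF le_trans], auto)

fun test_regs :: "test \<Rightarrow> nat set" where
  "test_regs (Equal a b) = {a, b}"
| "test_regs (Less a b) = {a, b}"
| "test_regs (NLess a b) = {a, b}"
| "test_regs (NNeg a) = {a}"
| "test_regs (NPos a) = {a}"

fun com_regs :: "com \<Rightarrow> nat set" where
  "com_regs Nop = {}"
| "com_regs (Set r c) = {r}"
| "com_regs (Copy r a) = {r, a}"
| "com_regs (Plus r a b) = {r, a, b}"
| "com_regs (Minus r a b) = {r, a, b}"
| "com_regs (Get r A a) = {r, a}"
| "com_regs (Put A a r) = {r, a}"
| "com_regs (c ;; d) = com_regs c \<union> com_regs d"
| "com_regs (Cond b c d) = test_regs b \<union> com_regs c \<union> com_regs d"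
| "com_regs (While b c) = test_regs b \<union> com_regs c"

lemma step_jump_if:
  "l < length P \<Longrightarrow> P ! l = jump_if b l' \<Longrightarrow> pc s = l \<Longrightarrow>
     step P X s = s\<lparr>pc := if holds X b (reg s) then l' else Suc l\<rparr>"
  by (cases b) (auto simp: step_def halted_def branch_def)

lemma holds_cong: "(\<And>r. r \<in> test_regs b \<Longrightarrow> \<rho> r = \<rho>' r) \<Longrightarrow> holds X b \<rho> = holds X b \<rho>'"
  by (cases b) auto

text \<open>Registers below \<open>q\<close> are the variables of the source program. Base addresses
  are kept from \<open>q\<close> on, where compiled commands never write. The map \<open>f\<close>
  need not be injective: when one array covers the whole memory, a single base register
  suffices.\<close>

locale layout =
  fixes f :: "arr \<Rightarrow> nat" and base sz :: "arr \<Rightarrow> nat" and q w :: nat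
  assumes base_reg: "q \<le> f A"
    and disjoint: "A \<noteq> B \<Longrightarrow> i < sz A \<Longrightarrow> j < sz B \<Longrightarrow> base A + i \<noteq> base B + j"
begin

text \<open>Cells beyond \<open>sz A\<close> stay unconstrained, since they may belong to another
  array. The bound on the state is part of the relation, so the integer bound of
  \<open>reach\<close> comes along with the simulation.\<close>

definition rep :: "nat \<Rightarrow> regs \<Rightarrow> arrs \<Rightarrow> state \<Rightarrow> bool" where
  "rep l \<rho> \<alpha> s \<longleftrightarrow> pc s = l \<and> (\<forall>r < q. reg s r = \<rho> r) \<and> (\<forall>A. reg s (f A) = base A) \<and>
     (\<forall>A. \<forall>i < sz A. mem s (base A + i) = \<alpha> A i) \<and> bounded_state w s"

lemma rep_reg:
  assumes "rep l \<rho> \<alpha> s" "r < q" "x \<le> w"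
  shows "rep (Suc l) (\<rho>(r := x)) \<alpha> (set_reg r x s)"
  using assms base_reg unfolding rep_def set_reg_def bounded_state_def
  by (auto simp: not_less[symmetric])

lemma rep_mem:
  assumes "rep l \<rho> \<alpha> s" "i < sz A" "x \<le> w"
  shows "rep (Suc l) \<rho> (\<alpha>(A := (\<alpha> A)(i := x)))
           (s\<lparr>pc := Suc (pc s), mem := (mem s)(base A + i := x)\<rparr>)"
  using assms disjoint unfolding rep_def bounded_state_def by auto

lemma rep_pc: "rep l \<rho> \<alpha> s \<Longrightarrow> rep l' \<rho> \<alpha> (s\<lparr>pc := l'\<rparr>)"
  by (auto simp: rep_def bounded_state_def)

lemma rep_bounded: "rep l \<rho> \<alpha> s \<Longrightarrow> bounded_state w s"
  by (simp add: rep_def)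

lemma rep_le: "rep l \<rho> \<alpha> s \<Longrightarrow> a < q \<Longrightarrow> \<rho> a \<le> w"
  by (metis rep_def bounded_state_def)

lemma one_step:
  assumes "rep l \<rho> \<alpha> s" "rep l' \<rho>' \<alpha>' (step P X s)"
  shows "\<exists>s'. reach P X w 1 s s' \<and> rep l' \<rho>' \<alpha>' s'"
  using assms reach_step rep_bounded by blast

lemma step_code_at: "rep l \<rho> \<alpha> s \<Longrightarrow> code_at P l [i] \<Longrightarrow> step P X s = exec X i s"
  by (auto simp: rep_def step_def halted_def dest!: code_at_Cons)

lemma rep_jump: "rep l \<rho> \<alpha> s \<Longrightarrow> code_at P l (Jump l' # C) \<Longrightarrow> rep l' \<rho> \<alpha> (step P X s)"
  by (drule code_at_Cons) (auto simp: rep_def step_def halted_def branch_def bounded_state_def)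

lemma rep_jump_if:
  assumes "rep l \<rho> \<alpha> s" "code_at P l (jump_if b l' # C)" "test_regs b \<subseteq> {..<q}"
  shows "rep (if holds X b \<rho> then l' else Suc l) \<rho> \<alpha> (step P X s)"
proof -
  have "holds X b (reg s) = holds X b \<rho>"
    using assms by (intro holds_cong) (auto simp: rep_def)
  then have "step P X s = s\<lparr>pc := if holds X b \<rho> then l' else Suc l\<rparr>"
    using step_jump_if[of l P b l' s X] code_at_Cons[OF assms(2)] assms(1) by (simp add: rep_def)
  then show ?thesis using rep_pc[OF assms(1)] by simp
qed

lemma exec_reg:
  assumes "rep l \<rho> \<alpha> s" "code_at P l [i]" "r < q" "x \<le> w" "exec X i s = set_reg r x s"
  shows "\<exists>s'. reach P X w 1 s s' \<and> rep (l + length [i]) (\<rho>(r := x)) \<alpha> s'"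
  using assms rep_reg step_code_at by (intro one_step) auto

text \<open>Induction on the derivation; code address and state are generalised because subcommands
  are compiled at shifted addresses and loops return to their start. The cost \<open>t\<close>
  bounds the number of machine steps from above.\<close>

theorem compile_correct:
  assumes "big X w sz c \<rho> \<alpha> t \<rho>' \<alpha>'" "com_regs c \<subseteq> {..<q}" "code_at P l (compile f l c)"
    "rep l \<rho> \<alpha> s"
  shows "\<exists>s'. reach P X w t s s' \<and> rep (l + length (compile f l c)) \<rho>' \<alpha>' s'"
  using assms
proof (induction arbitrary: l s rule: big.induct)
  case (1 \<rho> \<alpha>)
  then show ?case using reach_refl rep_bounded by force
next
  case (2 c r \<rho> \<alpha>)
  then show ?case unfolding compile.simps by (intro exec_reg) auto
next
  case (3 r a \<rho> \<alpha>)
  then show ?case unfolding compile.simps by (intro exec_reg) (auto simp: rep_le, auto simp: rep_def)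
next
  case (4 \<rho> a b r \<alpha>)
  then show ?case unfolding compile.simps by (intro exec_reg) (auto simp: rep_def)
next
  case (5 r a b \<rho> \<alpha>)
  then have "\<rho> a - \<rho> b \<le> w"
    using rep_le le_trans[OF diff_le_self] by auto
  with 5 show ?case unfolding compile.simps by (intro exec_reg) (auto simp: rep_def)
next
  case (6 \<rho> a A r \<alpha>)
  have "\<alpha> A (\<rho> a) \<le> w"
    using 6(1,4) unfolding rep_def bounded_state_def by metis
  with 6 show ?case unfolding compile.simps by (intro exec_reg) (auto simp: rep_def)
next
  case (7 \<rho> a A r \<alpha>)
  have "\<rho> r \<le> w"
    using 7(2) rep_le[OF 7(4)] by auto
  moreover have "exec X (Store (f A) a r) s =
      s\<lparr>pc := Suc (pc s), mem := (mem s)(base A + \<rho> a := \<rho> r)\<rparr>"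
    using 7 by (auto simp: rep_def)
  ultimately show ?case
    using 7 rep_mem[OF 7(4) 7(1), of "\<rho> r"] step_code_at[OF 7(4), of P "Store (f A) a r" X]
    by (intro one_step[OF 7(4)]) (simp del: exec.simps fun_upd_apply)
next
  case (8 c \<rho> \<alpha> t \<rho>' \<alpha>' d t' \<rho>'' \<alpha>'')
  let ?C = "compile f l c"
  have c: "code_at P l ?C" "code_at P (l + length ?C) (compile f (l + length ?C) d)"
      "com_regs c \<subseteq> {..<q}" "com_regs d \<subseteq> {..<q}"
    using 8(5,6) by (auto simp: Let_def code_at_append)
  obtain s' where s': "reach P X w t s s'" "rep (l + length ?C) \<rho>' \<alpha>' s'"
    using 8(3)[OF c(3,1) 8(7)] by blast
  obtain s'' where "reach P X w t' s' s''"
      "rep (l + length ?C + length (compile f (l + length ?C) d)) \<rho>'' \<alpha>'' s''"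
    using 8(4)[OF c(4,2) s'(2)] by blast
  then show ?case using s' by (auto simp: Let_def add.assoc intro: reach_trans)
next
  case (9 b \<rho> c \<alpha> t \<rho>' \<alpha>' d)
  let ?D = "compile f (l + 1) d"
  let ?l = "l + length ?D + 2"
  let ?C = "compile f ?l c"
  have c: "code_at P l (jump_if b ?l # ?D @ Jump (?l + length ?C) # ?C)"
    using 9(5) by (simp add: Let_def)
  have "rep ?l \<rho> \<alpha> (step P X s)"
    using rep_jump_if[OF 9(6) c, of X] 9(1,4) by simp
  then obtain s' where s': "reach P X w 1 s s'" "rep ?l \<rho> \<alpha> s'"
    using one_step 9(6) by blast
  have "code_at P (Suc l + length ?D) (Jump (?l + length ?C) # ?C)"
    using code_at_Cons[OF c] by (simp add: code_at_append)
  then have "code_at P ?l ?C"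
    using code_at_Cons by fastforce
  moreover have "com_regs c \<subseteq> {..<q}" using 9(4) by simp
  ultimately obtain s'' where s'': "reach P X w t s' s''" "rep (?l + length ?C) \<rho>' \<alpha>' s''"
    using 9(3) s'(2) by blast
  moreover have "reach P X w (2 + t) s s''"
    by (rule reach_mono[OF reach_trans[OF s'(1) s''(1)]]) simp
  moreover have "l + length (compile f l (Cond b c d)) = ?l + length ?C"
    by (simp add: Let_def)
  ultimately show ?case by metis
next
  case (10 b \<rho> d \<alpha> t \<rho>' \<alpha>' c)
  let ?D = "compile f (l + 1) d"
  let ?l = "l + length ?D + 2"
  let ?C = "compile f ?l c"
  have c: "code_at P l (jump_if b ?l # ?D @ Jump (?l + length ?C) # ?C)"
    using 10(5) by (simp add: Let_def)
  have "rep (l + 1) \<rho> \<alpha> (step P X s)"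
    using rep_jump_if[OF 10(6) c, of X] 10(1,4) by simp
  then obtain s' where s': "reach P X w 1 s s'" "rep (l + 1) \<rho> \<alpha> s'"
    using one_step 10(6) by blast
  have c': "code_at P (l + 1) ?D" "code_at P (l + 1 + length ?D) (Jump (?l + length ?C) # ?C)"
    using code_at_Cons[OF c] by (simp_all add: code_at_append)
  have "com_regs d \<subseteq> {..<q}" using 10(4) by simp
  then obtain s'' where s'': "reach P X w t s' s''" "rep (l + 1 + length ?D) \<rho>' \<alpha>' s''"
    using 10(3) c'(1) s'(2) by blast
  then have "rep (?l + length ?C) \<rho>' \<alpha>' (step P X s'')"
    using rep_jump[OF s''(2) c'(2)] by simp
  then obtain s3 where s3: "reach P X w 1 s'' s3" "rep (?l + length ?C) \<rho>' \<alpha>' s3"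
    using one_step s''(2) by blast
  moreover have "reach P X w (2 + t) s s3"
    by (rule reach_mono[OF reach_trans[OF reach_trans[OF s'(1) s''(1)] s3(1)]]) simp
  moreover have "l + length (compile f l (Cond b c d)) = ?l + length ?C"
    by (simp add: Let_def)
  ultimately show ?case by metis
next
  case (11 b \<rho> c \<alpha>)
  let ?C = "compile f (l + 2) c"
  have c: "code_at P l (jump_if b (l + 2) # Jump (l + length ?C + 3) # ?C @ [Jump l])"
    using 11(3) by (simp add: Let_def)
  have "rep (Suc l) \<rho> \<alpha> (step P X s)"
    using rep_jump_if[OF 11(4) c, of X] 11(1,2) by simp
  then obtain s' where s': "reach P X w 1 s s'" "rep (Suc l) \<rho> \<alpha> s'"
    using one_step 11(4) by blast
  then have "rep (l + length ?C + 3) \<rho> \<alpha> (step P X s')"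
    using rep_jump[OF s'(2)] code_at_Cons[OF c] by blast
  then obtain s'' where s'': "reach P X w 1 s' s''" "rep (l + length ?C + 3) \<rho> \<alpha> s''"
    using one_step s'(2) by blast
  moreover have "reach P X w 2 s s''"
    by (rule reach_mono[OF reach_trans[OF s'(1) s''(1)]]) simp
  moreover have "l + length (compile f l (While b c)) = l + length ?C + 3"
    by (simp add: Let_def)
  ultimately show ?case by metis
next
  case (12 b \<rho> c \<alpha> t \<rho>' \<alpha>' t' \<rho>'' \<alpha>'')
  let ?C = "compile f (l + 2) c"
  have c: "code_at P l (jump_if b (l + 2) # Jump (l + length ?C + 3) # ?C @ [Jump l])"
    using 12(7) by (simp add: Let_def)
  have "rep (l + 2) \<rho> \<alpha> (step P X s)"
    using rep_jump_if[OF 12(8) c, of X] 12(1,6) by simp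
  then obtain s' where s': "reach P X w 1 s s'" "rep (l + 2) \<rho> \<alpha> s'"
    using one_step 12(8) by blast
  have c': "code_at P (l + 2) ?C" "code_at P (l + 2 + length ?C) [Jump l]"
    using code_at_Cons[OF conjunct2[OF conjunct2[OF code_at_Cons[OF c]]]]
    by (simp_all add: code_at_append)
  have "com_regs c \<subseteq> {..<q}" using 12(6) by simp
  then obtain s'' where s'': "reach P X w t s' s''" "rep (l + 2 + length ?C) \<rho>' \<alpha>' s''"
    using 12(4) c'(1) s'(2) by blast
  then have "rep l \<rho>' \<alpha>' (step P X s'')"
    using rep_jump[OF s''(2) c'(2)] by simp
  then obtain s3 where s3: "reach P X w 1 s'' s3" "rep l \<rho>' \<alpha>' s3"
    using one_step s''(2) by blast
  obtain s4 where "reach P X w t' s3 s4" "rep (l + length (compile f l (While b c))) \<rho>'' \<alpha>'' s4"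
    using 12(5)[OF 12(6,7) s3(2)] by blast
  moreover have "2 + t + t' = 1 + t + 1 + t'" by simp
  ultimately show ?case
    using reach_trans[OF reach_trans[OF reach_trans[OF s'(1) s''(1)] s3(1)]] by metis
qed

end

section \<open>Attractors and values\<close>

text \<open>Exchanging the players and negating the payoffs turns guarantees of Min into guarantees
  of Max, so that only one player has to be treated.\<close>

definition dual :: "'v srg \<Rightarrow> 'v srg" where
  "dual G = G\<lparr>V_min := V_max G, V_max := V_min G, payoff := \<lambda>v. - payoff G v\<rparr>"

lemma dual_simps [simp]:
  "V_min (dual G) = V_max G" "V_max (dual G) = V_min G" "terminals (dual G) = terminals G"
  "arcs (dual G) = arcs G" "payoff (dual G) v = - payoff G v" "positions (dual G) = positions G"
  "strategy (dual G) A s = strategy G A s" "positional_strategy (dual G) A \<sigma> = positional_strategy G A \<sigma>"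
  "dual (dual G) = (G :: 'v srg)"
  by (auto simp: dual_def positions_def strategy_def positional_strategy_def)

lemma srg_dual: "simple_recursive_game G \<Longrightarrow> simple_recursive_game (dual G)"
  unfolding simple_recursive_game_def by (auto simp: inj_on_def)

text \<open>Disjointness matters because \<open>play\<close> asks first whether Max owns the
  position; a shared position would be resolved differently in the two games.\<close>

lemma play_dual: "V_min G \<inter> V_max G = {} \<Longrightarrow> play (dual G) t s v k = play G s t v k"
  by (induction k) (auto split: prod.splits)

lemma outcome_dual: "V_min G \<inter> V_max G = {} \<Longrightarrow> outcome (dual G) t s v = - outcome G s t v"
  by (simp add: outcome_def play_dual)

lemma max_ensures_dual:
  "V_min G \<inter> V_max G = {} \<Longrightarrow> max_ensures (dual G) \<tau> v x \<longleftrightarrow> min_ensures G \<tau> v (- x)"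
  by (auto simp: max_ensures_def min_ensures_def outcome_dual)

lemma positional_imp_strategy: "positional_strategy G A \<sigma> \<Longrightarrow> strategy G A (\<lambda>h. \<sigma>)"
  by (simp add: positional_strategy_def strategy_def)

section \<open>Plays under invariants and decreasing ranks\<close>

lemma outcome_cases:
  obtains "outcome G s t v = 0" "\<And>k. snd (play G s t v k) \<notin> terminals G"
  | k where "snd (play G s t v k) \<in> terminals G" "outcome G s t v = payoff G (snd (play G s t v k))"
proof (cases "\<exists>k. snd (play G s t v k) \<in> terminals G")
  case True
  then have "snd (play G s t v (LEAST k. snd (play G s t v k) \<in> terminals G)) \<in> terminals G"
    by (metis (mono_tags, lifting) LeastI)
  with True that(2) show ?thesis by (simp add: outcome_def)
qed (use that(1) in \<open>simp add: outcome_def\<close>)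

lemma play_inv:
  assumes "v \<in> C" "strategy G (V_min G) t"
    and "\<And>u. u \<in> C \<Longrightarrow> u \<in> V_max G \<Longrightarrow> \<sigma> u \<in> C"
    and "\<And>u w. u \<in> C \<Longrightarrow> u \<in> V_min G \<Longrightarrow> (u, w) \<in> arcs G \<Longrightarrow> w \<in> C"
  shows "snd (play G (\<lambda>h. \<sigma>) t v k) \<in> C"
  using assms by (induction k) (auto split: prod.splits simp: strategy_def)

lemma outcome_safe:
  assumes "v \<in> C" "strategy G (V_min G) t"
    and "\<And>u. u \<in> C \<Longrightarrow> u \<in> V_max G \<Longrightarrow> \<sigma> u \<in> C"
    and "\<And>u w. u \<in> C \<Longrightarrow> u \<in> V_min G \<Longrightarrow> (u, w) \<in> arcs G \<Longrightarrow> w \<in> C"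
  shows "outcome G (\<lambda>h. \<sigma>) t v \<in> insert 0 (payoff G ` (C \<inter> terminals G))"
  using play_inv[OF assms] by (cases rule: outcome_cases[of G "\<lambda>h. \<sigma>" t v]) auto

text \<open>The rank drops with every move, so a terminal must be met within \<open>rk v\<close>
  moves. The inclusion of \<open>C\<close> in the positions ensures that every non-terminal in
  \<open>C\<close> has an owner who moves; elsewhere \<open>play\<close> lets the token
  rest.\<close>

lemma outcome_reach:
  fixes rk :: "'v \<Rightarrow> nat"
  assumes v: "v \<in> C" and t: "strategy G (V_min G) t" and C: "C \<subseteq> positions G"
    and max: "\<And>u. u \<in> C \<Longrightarrow> u \<in> V_max G \<Longrightarrow> \<sigma> u \<in> C \<and> rk (\<sigma> u) < rk u"
    and min: "\<And>u w. u \<in> C \<Longrightarrow> u \<in> V_min G \<Longrightarrow> (u, w) \<in> arcs G \<Longrightarrow> w \<in> C \<and> rk w < rk u"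
  shows "outcome G (\<lambda>h. \<sigma>) t v \<in> payoff G ` (C \<inter> terminals G)"
proof -
  let ?u = "\<lambda>k. snd (play G (\<lambda>h. \<sigma>) t v k)"
  have inv: "?u k \<in> C" for k using play_inv[OF v t, of \<sigma>] max min by blast
  show ?thesis
  proof (cases rule: outcome_cases[of G "\<lambda>h. \<sigma>" t v])
    case 1
    have "rk (?u k) + k \<le> rk v" for k
    proof (induction k)
      case (Suc k)
      have "rk (?u (Suc k)) < rk (?u k)"
        using inv[of k] 1(2)[of k] C max[OF inv[of k]] min[OF inv[of k]] t
        by (fastforce split: prod.splits simp: strategy_def positions_def)
      with Suc show ?case by simp
    qed simp
    from this[of "Suc (rk v)"] show ?thesis by simp
  next
    case (2 k)
    with inv[of k] show ?thesis by auto
  qed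
qed

text \<open>\<open>L\<close> is the set of positions from which the owner of \<open>A\<close> can force the play into \<open>S\<close>. The map
  \<open>\<sigma>\<close> combines his way of doing so with a way for the owner of \<open>B\<close> to stay outside \<open>L\<close>.\<close>

definition attracts ::
  "'v srg \<Rightarrow> 'v set \<Rightarrow> 'v set \<Rightarrow> 'v set \<Rightarrow> 'v set \<Rightarrow> ('v \<Rightarrow> nat) \<Rightarrow> ('v \<Rightarrow> 'v) \<Rightarrow> bool" where
  "attracts G A B S L rk \<sigma> \<longleftrightarrow>
     S \<subseteq> L \<and> L \<subseteq> S \<union> A \<union> B \<and>
     (\<forall>v \<in> A \<union> B. (v, \<sigma> v) \<in> arcs G) \<and>
     (\<forall>v \<in> A \<inter> L. \<sigma> v \<in> L \<and> rk (\<sigma> v) < rk v) \<and>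
     (\<forall>v \<in> B \<inter> L. \<forall>w. (v, w) \<in> arcs G \<longrightarrow> w \<in> L \<and> rk w < rk v) \<and>
     (\<forall>v \<in> A - L. \<forall>w. (v, w) \<in> arcs G \<longrightarrow> w \<notin> L) \<and>
     (\<forall>v \<in> B - L. \<sigma> v \<notin> L)"

lemma attractsD:
  assumes "attracts G A B S L rk \<sigma>"
  shows "S \<subseteq> L" "L \<subseteq> S \<union> A \<union> B"
    "\<And>v. v \<in> A \<Longrightarrow> (v, \<sigma> v) \<in> arcs G" "\<And>v. v \<in> B \<Longrightarrow> (v, \<sigma> v) \<in> arcs G"
    "\<And>v. v \<in> L \<Longrightarrow> v \<in> A \<Longrightarrow> \<sigma> v \<in> L \<and> rk (\<sigma> v) < rk v"
    "\<And>v w. v \<in> L \<Longrightarrow> v \<in> B \<Longrightarrow> (v, w) \<in> arcs G \<Longrightarrow> w \<in> L \<and> rk w < rk v"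
    "\<And>v w. v \<notin> L \<Longrightarrow> v \<in> A \<Longrightarrow> (v, w) \<in> arcs G \<Longrightarrow> w \<notin> L"
    "\<And>v. v \<notin> L \<Longrightarrow> v \<in> B \<Longrightarrow> \<sigma> v \<notin> L"
  using assms unfolding attracts_def by (blast+)

lemma attracts_dual [simp]: "attracts (dual G) A B S L rk \<sigma> = attracts G A B S L rk \<sigma>"
  by (simp add: attracts_def)

text \<open>\<open>cpre\<close> collects the positions from which the owner of \<open>A\<close>
  enters \<open>Z\<close> in one move; \<open>L\<close> is the union of its iterates on
  \<open>S\<close>, and \<open>rk\<close> is the stage of entry. Stages indexed by natural numbers
  suffice because the finitely many successors of a position of \<open>B\<close> have a largest
  stage.\<close>

lemma attracts_exists:
  fixes G :: "'v srg"
  assumes fin: "finite (arcs G)" and ex: "\<And>v. v \<in> A \<union> B \<Longrightarrow> \<exists>w. (v, w) \<in> arcs G"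
    and disj: "A \<inter> B = {}" "S \<inter> (A \<union> B) = {}"
  shows "\<exists>L rk \<sigma>. attracts G A B S L rk \<sigma>"
proof -
  define cpre where "cpre Z = {v \<in> A. \<exists>w. (v, w) \<in> arcs G \<and> w \<in> Z} \<union>
    {v \<in> B. \<forall>w. (v, w) \<in> arcs G \<longrightarrow> w \<in> Z}" for Z
  define F where "F n = ((\<lambda>Z. Z \<union> cpre Z) ^^ n) S" for n
  have F0: "F 0 = S" and FS: "F (Suc n) = F n \<union> cpre (F n)" for n
    by (simp_all add: F_def)
  have mono: "F i \<subseteq> F j" if "i \<le> j" for i j
    using that by (rule lift_Suc_mono_le[of F, rotated]) (auto simp: FS)
  define L where "L = (\<Union>n. F n)"
  define rk where "rk v = (LEAST n. v \<in> F n)" for v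
  have rk: "v \<in> F (rk v)" if "v \<in> L" for v
    using that unfolding L_def rk_def by (auto intro: LeastI)
  have rk_le: "rk v \<le> n" if "v \<in> F n" for v n
    using that unfolding rk_def by (rule Least_le)
  have pre: "v \<in> cpre (F (rk v - 1)) \<and> 0 < rk v" if "v \<in> L" "v \<notin> S" for v
  proof (cases "rk v")
    case 0
    with rk[OF that(1)] that(2) F0 show ?thesis by simp
  next
    case (Suc n)
    then have "v \<notin> F n" using rk_le[of v n] by auto
    with rk[OF that(1)] Suc FS show ?thesis by auto
  qed
  have below: "w \<in> L \<and> rk w < rk v" if "w \<in> F (rk v - 1)" "0 < rk v" for v w
    using that rk_le[OF that(1)] by (auto simp: L_def)
  have LA: "\<exists>w. (v, w) \<in> arcs G \<and> w \<in> L \<and> rk w < rk v" if "v \<in> A" "v \<in> L" for v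
    using pre[of v] that disj below[of _ v] unfolding cpre_def by blast
  have LB: "w \<in> L \<and> rk w < rk v" if "v \<in> B" "v \<in> L" "(v, w) \<in> arcs G" for v w
    using pre[of v] that disj below[of _ v] unfolding cpre_def by blast
  have nA: "w \<notin> L" if "v \<in> A" "v \<notin> L" "(v, w) \<in> arcs G" for v w
  proof
    assume "w \<in> L"
    then have "v \<in> F (Suc (rk w))" using that rk by (auto simp: FS cpre_def)
    with that show False by (auto simp: L_def)
  qed
  have nB: "\<exists>w. (v, w) \<in> arcs G \<and> w \<notin> L" if "v \<in> B" "v \<notin> L" for v
  proof (rule ccontr)
    assume no: "\<nexists>w. (v, w) \<in> arcs G \<and> w \<notin> L"
    let ?W = "{w. (v, w) \<in> arcs G}"
    have "finite ?W" using finite_imageI[OF fin, of snd] by (rule finite_subset[rotated]) force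
    then have "rk w \<le> Max (rk ` ?W)" if "w \<in> ?W" for w using that by simp
    then have "?W \<subseteq> F (Max (rk ` ?W))" using no rk mono by blast
    then have "v \<in> F (Suc (Max (rk ` ?W)))" using that by (auto simp: FS cpre_def)
    with that show False by (auto simp: L_def)
  qed
  define \<sigma> where "\<sigma> v = (SOME w. (v, w) \<in> arcs G \<and>
     (v \<in> A \<inter> L \<longrightarrow> w \<in> L \<and> rk w < rk v) \<and> (v \<in> B - L \<longrightarrow> w \<notin> L))" for v
  have "(v, \<sigma> v) \<in> arcs G \<and> (v \<in> A \<inter> L \<longrightarrow> \<sigma> v \<in> L \<and> rk (\<sigma> v) < rk v) \<and> (v \<in> B - L \<longrightarrow> \<sigma> v \<notin> L)"
    if "v \<in> A \<union> B" for v
    unfolding \<sigma>_def by (rule someI_ex) (use that LA[of v] nB[of v] ex[of v] disj in blast)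
  moreover have "S \<subseteq> L" unfolding L_def using F0 by blast
  moreover have "L \<subseteq> S \<union> A \<union> B" using pre unfolding cpre_def by blast
  ultimately have "attracts G A B S L rk \<sigma>"
    unfolding attracts_def using LB nA by blast
  then show ?thesis by blast
qed

section \<open>Determinacy, values and optimality equations\<close>

context
  fixes G :: "'v srg"
  assumes G: "simple_recursive_game G"
begin

lemma game_facts:
  "finite (positions G)" "finite (terminals G)" "finite (arcs G)"
  "V_min G \<inter> V_max G = {}" "V_max G \<inter> V_min G = {}"
  "V_min G \<inter> terminals G = {}" "V_max G \<inter> terminals G = {}"
  "\<And>v. v \<in> V_min G \<union> V_max G \<Longrightarrow> \<exists>w. (v, w) \<in> arcs G"
  "\<And>v w. (v, w) \<in> arcs G \<Longrightarrow> v \<in> positions G \<and> w \<in> positions G"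
  using G finite_subset[of "arcs G" "positions G \<times> positions G"]
  unfolding simple_recursive_game_def by (auto simp: positions_def)

lemma max_attract:
  assumes "attracts G (V_max G) (V_min G) S L rk \<sigma>" "S \<subseteq> terminals G" "v \<in> L"
    "strategy G (V_min G) t"
  shows "outcome G (\<lambda>h. \<sigma>) t v \<in> payoff G ` S"
proof -
  have "outcome G (\<lambda>h. \<sigma>) t v \<in> payoff G ` (L \<inter> terminals G)"
  proof (rule outcome_reach[OF assms(3,4), of \<sigma> rk])
    show "L \<subseteq> positions G" using attractsD(2)[OF assms(1)] assms(2) by (auto simp: positions_def)
  qed (use attractsD(5,6)[OF assms(1)] in blast)+
  moreover have "L \<inter> terminals G \<subseteq> S"
    using attractsD(2)[OF assms(1)] game_facts(6,7) by blast
  ultimately show ?thesis by blast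
qed

lemma max_avoid:
  assumes "attracts G (V_min G) (V_max G) S L rk \<sigma>" "v \<notin> L" "strategy G (V_min G) t"
  shows "outcome G (\<lambda>h. \<sigma>) t v \<in> insert 0 (payoff G ` (terminals G - S))"
proof -
  have "outcome G (\<lambda>h. \<sigma>) t v \<in> insert 0 (payoff G ` (- L \<inter> terminals G))"
    by (rule outcome_safe[where C = "- L" and \<sigma> = \<sigma>, OF _ assms(3)]) (use attractsD(7,8)[OF assms(1)] assms(2) in blast)+
  moreover have "- L \<inter> terminals G \<subseteq> terminals G - S"
    using assms(1) unfolding attracts_def by blast
  ultimately show ?thesis by blast
qed

end

lemma min_attract:
  assumes "simple_recursive_game G" "attracts G (V_min G) (V_max G) S L rk \<tau>" "S \<subseteq> terminals G"
    "v \<in> L" "strategy G (V_max G) s"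
  shows "outcome G s (\<lambda>h. \<tau>) v \<in> payoff G ` S"
  using max_attract[OF srg_dual[OF assms(1)], of S L rk \<tau> v s] assms game_facts(4)[OF assms(1)]
  by (auto simp: outcome_dual)

lemma min_avoid:
  assumes "simple_recursive_game G" "attracts G (V_max G) (V_min G) S L rk \<tau>" "v \<notin> L"
    "strategy G (V_max G) s"
  shows "outcome G s (\<lambda>h. \<tau>) v \<in> insert 0 (payoff G ` (terminals G - S))"
  using max_avoid[OF srg_dual[OF assms(1)], of S L rk \<tau> v s] assms game_facts(4)[OF assms(1)]
  by (auto simp: outcome_dual)

context
  fixes G :: "'v srg"
  assumes G: "simple_recursive_game G"
begin

text \<open>For \<open>x > 0\<close> Max has to force the play into a terminal; for \<open>x \<le> 0\<close> it suffices to avoid some.\<close>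

lemma threshold:
  obtains C \<sigma> \<tau> where
    "positional_strategy G (V_max G) \<sigma>" "positional_strategy G (V_min G) \<tau>"
    "\<And>v. v \<in> C \<Longrightarrow> max_ensures G \<sigma> v x"
    "\<And>v s. v \<notin> C \<Longrightarrow> strategy G (V_max G) s \<Longrightarrow> outcome G s (\<lambda>h. \<tau>) v < x"
    "\<And>v. v \<in> V_max G \<Longrightarrow> v \<in> C \<longleftrightarrow> (\<exists>w. (v, w) \<in> arcs G \<and> w \<in> C)"
    "\<And>v. v \<in> V_min G \<Longrightarrow> v \<in> C \<longleftrightarrow> (\<forall>w. (v, w) \<in> arcs G \<longrightarrow> w \<in> C)"
    "\<And>v. v \<in> terminals G \<Longrightarrow> v \<in> C \<longleftrightarrow> x \<le> payoff G v"
proof (cases "x > 0")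
  case True
  define S where "S = {t \<in> terminals G. x \<le> payoff G t}"
  have "\<exists>L rk \<sigma>. attracts G (V_max G) (V_min G) S L rk \<sigma>"
    by (rule attracts_exists) (use game_facts[OF G] in \<open>auto simp: S_def\<close>)
  then obtain L rk \<sigma> where att: "attracts G (V_max G) (V_min G) S L rk \<sigma>" by blast
  have S: "S \<subseteq> terminals G" by (auto simp: S_def)
  show ?thesis
  \<comment> \<open>One map serves both players, since \<open>attracts\<close> constrains it at the
    positions of both. Outside \<open>L\<close> Min obtains 0 or a payoff below \<open>x\<close>,
    and 0 is below \<open>x\<close> as well because \<open>x\<close> is positive.\<close>
  proof (rule that[of \<sigma> \<sigma> L])
    show "positional_strategy G (V_max G) \<sigma>" "positional_strategy G (V_min G) \<sigma>"
      using attractsD(3,4)[OF att] by (auto simp: positional_strategy_def)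
    show "max_ensures G \<sigma> v x" if "v \<in> L" for v
      unfolding max_ensures_def
      by (intro allI impI, drule max_attract[OF G att S that]) (auto simp: S_def)
    show "outcome G s (\<lambda>h. \<sigma>) v < x" if "v \<notin> L" "strategy G (V_max G) s" for v s
      using min_avoid[OF G att that] True by (elim insertE imageE) (auto simp: S_def)
    show "v \<in> L \<longleftrightarrow> (\<exists>w. (v, w) \<in> arcs G \<and> w \<in> L)" if "v \<in> V_max G" for v
      using attractsD(3-8)[OF att] that by blast
    show "v \<in> L \<longleftrightarrow> (\<forall>w. (v, w) \<in> arcs G \<longrightarrow> w \<in> L)" if "v \<in> V_min G" for v
      using attractsD(3-8)[OF att] that by blast
    show "v \<in> L \<longleftrightarrow> x \<le> payoff G v" if "v \<in> terminals G" for v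
      using attractsD(1,2)[OF att] that game_facts(6,7)[OF G] by (auto simp: S_def)
  qed
next
  case False
  define S where "S = {t \<in> terminals G. payoff G t < x}"
  have "\<exists>L rk \<sigma>. attracts G (V_min G) (V_max G) S L rk \<sigma>"
    by (rule attracts_exists) (use game_facts[OF G] in \<open>auto simp: S_def\<close>)
  then obtain L rk \<sigma> where att: "attracts G (V_min G) (V_max G) S L rk \<sigma>" by blast
  have S: "S \<subseteq> terminals G" by (auto simp: S_def)
  show ?thesis
  \<comment> \<open>With the roles reversed, Max obtains 0 or a payoff of at least \<open>x\<close>
    outside \<open>L\<close>, and 0 is enough because \<open>x\<close> is not positive.\<close>
  proof (rule that[of \<sigma> \<sigma> "- L"])
    show "positional_strategy G (V_max G) \<sigma>" "positional_strategy G (V_min G) \<sigma>"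
      using attractsD(3,4)[OF att] by (auto simp: positional_strategy_def)
    show "max_ensures G \<sigma> v x" if "v \<in> - L" for v
      unfolding max_ensures_def
      by (intro allI impI, drule max_avoid[OF G att that[unfolded Compl_iff]])
        (use False in \<open>auto simp: S_def\<close>)
    show "outcome G s (\<lambda>h. \<sigma>) v < x" if "v \<notin> - L" "strategy G (V_max G) s" for v s
    proof -
      have "outcome G s (\<lambda>h. \<sigma>) v \<in> payoff G ` S"
        using min_attract[OF G att S _ that(2)] that(1) by blast
      then show ?thesis by (auto simp: S_def)
    qed
    show "v \<in> - L \<longleftrightarrow> (\<exists>w. (v, w) \<in> arcs G \<and> w \<in> - L)" if "v \<in> V_max G" for v
      using attractsD(3-8)[OF att] that by blast
    show "v \<in> - L \<longleftrightarrow> (\<forall>w. (v, w) \<in> arcs G \<longrightarrow> w \<in> - L)" if "v \<in> V_min G" for v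
      using attractsD(3-8)[OF att] that by blast
    show "v \<in> - L \<longleftrightarrow> x \<le> payoff G v" if "v \<in> terminals G" for v
      using attractsD(1,2)[OF att] that game_facts(6,7)[OF G] by (auto simp: S_def)
  qed
qed

lemma outcome_range: "outcome G s t v \<in> insert 0 (payoff G ` terminals G)"
  by (cases rule: outcome_cases[of G s t v]) auto

lemma ensures_le:
  assumes "positional_strategy G (V_max G) \<sigma>" "max_ensures G \<sigma> v x"
    "positional_strategy G (V_min G) \<tau>" "\<And>s. strategy G (V_max G) s \<Longrightarrow> outcome G s (\<lambda>h. \<tau>) v \<le> y"
  shows "x \<le> y"
  using assms positional_imp_strategy by (force simp: max_ensures_def)

text \<open>There are only finitely many possible outcomes. Let \<open>x\<close> be the largest that
  Max can ensure from \<open>v\<close>. He cannot ensure the next larger one \<open>y\<close>, so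
  \<open>threshold\<close> at \<open>y\<close> leaves \<open>v\<close> outside \<open>C\<close>, and
  Min keeps all outcomes below \<open>y\<close>, hence at most \<open>x\<close>.\<close>

lemma Val_exists:
  "\<exists>x. (\<exists>\<sigma>. positional_strategy G (V_max G) \<sigma> \<and> max_ensures G \<sigma> v x) \<and>
       (\<exists>\<tau>. positional_strategy G (V_min G) \<tau> \<and> min_ensures G \<tau> v x)"
proof -
  define Z where "Z = insert 0 (payoff G ` terminals G)"
  have finZ: "finite Z" "Z \<noteq> {}" using game_facts(2)[OF G] by (auto simp: Z_def)
  define E where "E = {x \<in> Z. \<exists>\<sigma>. positional_strategy G (V_max G) \<sigma> \<and> max_ensures G \<sigma> v x}"
  obtain \<sigma> where \<sigma>: "positional_strategy G (V_max G) \<sigma>" using threshold by metis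
  obtain \<tau>0 where \<tau>0: "positional_strategy G (V_min G) \<tau>0" using threshold by metis
  have ge: "Min Z \<le> outcome G s t v" and le: "outcome G s t v \<le> Max Z" for s t
    using outcome_range[of s t v] finZ by (auto simp: Z_def[symmetric])
  \<comment> \<open>Every strategy ensures the least possible outcome, so \<open>E\<close> is not
    empty.\<close>
  have "Min Z \<in> E"
    unfolding E_def mem_Collect_eq
    by (intro conjI exI[of _ \<sigma>]) (use \<sigma> finZ ge in \<open>simp_all add: max_ensures_def\<close>)
  moreover have "finite E" using finZ by (simp add: E_def)
  ultimately have E: "finite E" "E \<noteq> {}" by blast+
  define x where "x = Max E"
  have xE: "x \<in> E" using E by (simp add: x_def)
  have "\<exists>\<tau>. positional_strategy G (V_min G) \<tau> \<and> min_ensures G \<tau> v x"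
  proof (cases "{z \<in> Z. z > x} = {}")
    case True
    then have "Max Z \<le> x" using finZ by (metis (mono_tags, lifting) Max_in empty_Collect_eq linorder_not_less)
    then show ?thesis using \<tau>0 le by (meson min_ensures_def order_trans)
  next
    case False
    define y where "y = Min {z \<in> Z. z > x}"
    have y: "y \<in> Z" "x < y" using Min_in[of "{z \<in> Z. z > x}"] False finZ by (auto simp: y_def)
    have gap: "z \<le> x" if "z \<in> Z" "z < y" for z
      using that finZ Min_le[of "{z \<in> Z. z > x}" z] unfolding y_def by fastforce
    obtain C \<sigma>' \<tau>' where C: "positional_strategy G (V_max G) \<sigma>'" "positional_strategy G (V_min G) \<tau>'"
      "\<And>v. v \<in> C \<Longrightarrow> max_ensures G \<sigma>' v y"
      "\<And>v s. v \<notin> C \<Longrightarrow> strategy G (V_max G) s \<Longrightarrow> outcome G s (\<lambda>h. \<tau>') v < y"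
      using threshold[of y] by metis
    have "v \<notin> C"
    proof
      assume "v \<in> C"
      then have "y \<in> E" using C y by (auto simp: E_def)
      then show False using y E by (auto simp: x_def)
    qed
    then show ?thesis
      using C(2,4) gap outcome_range by (auto simp: min_ensures_def Z_def[symmetric])
  qed
  with xE show ?thesis by (auto simp: E_def)
qed

lemma Val_spec:
  "(\<exists>\<sigma>. positional_strategy G (V_max G) \<sigma> \<and> max_ensures G \<sigma> v (Val G v)) \<and>
   (\<exists>\<tau>. positional_strategy G (V_min G) \<tau> \<and> min_ensures G \<tau> v (Val G v))"
proof -
  have "\<exists>!x. (\<exists>\<sigma>. positional_strategy G (V_max G) \<sigma> \<and> max_ensures G \<sigma> v x) \<and>
       (\<exists>\<tau>. positional_strategy G (V_min G) \<tau> \<and> min_ensures G \<tau> v x)"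
    using Val_exists by (rule ex_ex1I) (metis ensures_le min_ensures_def order_antisym)
  from theI'[OF this] show ?thesis by (simp add: Val_def)
qed

lemma le_Val: "positional_strategy G (V_max G) \<sigma> \<Longrightarrow> max_ensures G \<sigma> v x \<Longrightarrow> x \<le> Val G v"
  using Val_spec[of v] ensures_le unfolding min_ensures_def by blast

text \<open>The value is attained by a strategy of Max, so the inequality stays strict: this
  strategy against \<open>\<tau>\<close> gives an outcome that is at least the value and below
  \<open>x\<close>.\<close>

lemma Val_less:
  assumes "positional_strategy G (V_min G) \<tau>"
    "\<And>s. strategy G (V_max G) s \<Longrightarrow> outcome G s (\<lambda>h. \<tau>) v < x"
  shows "Val G v < x"
proof -
  obtain \<sigma> where "positional_strategy G (V_max G) \<sigma>" "max_ensures G \<sigma> v (Val G v)"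
    using Val_spec by blast
  then have "Val G v \<le> outcome G (\<lambda>h. \<sigma>) (\<lambda>h. \<tau>) v" "strategy G (V_max G) (\<lambda>h. \<sigma>)"
    using assms(1) positional_imp_strategy by (auto simp: max_ensures_def)
  with assms(2) show ?thesis by fastforce
qed

text \<open>These are the optimality equations in threshold form, which avoids maxima and minima
  over successors. The set \<open>C\<close> of \<open>threshold\<close> satisfies them, and it
  consists exactly of the positions of value at least \<open>x\<close>.\<close>

lemma Val_ge:
  "v \<in> V_max G \<Longrightarrow> x \<le> Val G v \<longleftrightarrow> (\<exists>w. (v, w) \<in> arcs G \<and> x \<le> Val G w)"
  "v \<in> V_min G \<Longrightarrow> x \<le> Val G v \<longleftrightarrow> (\<forall>w. (v, w) \<in> arcs G \<longrightarrow> x \<le> Val G w)"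
  "v \<in> terminals G \<Longrightarrow> x \<le> Val G v \<longleftrightarrow> x \<le> payoff G v"
proof -
  obtain C \<sigma> \<tau> where C: "positional_strategy G (V_max G) \<sigma>" "positional_strategy G (V_min G) \<tau>"
    "\<And>v. v \<in> C \<Longrightarrow> max_ensures G \<sigma> v x"
    "\<And>v s. v \<notin> C \<Longrightarrow> strategy G (V_max G) s \<Longrightarrow> outcome G s (\<lambda>h. \<tau>) v < x"
    "\<And>v. v \<in> V_max G \<Longrightarrow> v \<in> C \<longleftrightarrow> (\<exists>w. (v, w) \<in> arcs G \<and> w \<in> C)"
    "\<And>v. v \<in> V_min G \<Longrightarrow> v \<in> C \<longleftrightarrow> (\<forall>w. (v, w) \<in> arcs G \<longrightarrow> w \<in> C)"
    "\<And>v. v \<in> terminals G \<Longrightarrow> v \<in> C \<longleftrightarrow> x \<le> payoff G v"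
    by (rule threshold[of x]) (rule that, assumption+)
  have "v \<in> C \<longleftrightarrow> x \<le> Val G v" for v
    using le_Val[OF C(1) C(3)] Val_less[OF C(2) C(4)] by (meson linorder_not_less)
  with C(5-7) show
    "v \<in> V_max G \<Longrightarrow> x \<le> Val G v \<longleftrightarrow> (\<exists>w. (v, w) \<in> arcs G \<and> x \<le> Val G w)"
    "v \<in> V_min G \<Longrightarrow> x \<le> Val G v \<longleftrightarrow> (\<forall>w. (v, w) \<in> arcs G \<longrightarrow> x \<le> Val G w)"
    "v \<in> terminals G \<Longrightarrow> x \<le> Val G v \<longleftrightarrow> x \<le> payoff G v"
    by blast+
qed

lemma Val_terminal: "v \<in> terminals G \<Longrightarrow> Val G v = payoff G v"
  using Val_ge(3)[of v "Val G v"] Val_ge(3)[of v "payoff G v"] by simp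

lemma Val_max:
  assumes "v \<in> V_max G"
  shows "(v, w) \<in> arcs G \<Longrightarrow> Val G w \<le> Val G v" "\<exists>w. (v, w) \<in> arcs G \<and> Val G w = Val G v"
  using Val_ge(1)[OF assms] by (blast, metis order_antisym order_refl)

lemma Val_min_le: "v \<in> V_min G \<Longrightarrow> (v, w) \<in> arcs G \<Longrightarrow> Val G v \<le> Val G w"
  using Val_ge(2)[of v "Val G v"] by blast

end

lemma Val_dual:
  assumes G: "simple_recursive_game G"
  shows "Val (dual G) v = - Val G v"
proof (rule antisym)
  note d = srg_dual[OF G] game_facts(4)[OF G]
  have le: "- Val G v \<le> Val (dual G) v" if "simple_recursive_game G" for G :: "'v srg" and v
    using Val_spec[OF that, of v] le_Val[OF srg_dual[OF that], of _ v "- Val G v"]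
    by (auto simp: max_ensures_dual[OF game_facts(4)[OF that]])
  show "- Val G v \<le> Val (dual G) v" by (rule le[OF G])
  \<comment> \<open>Applying \<open>le\<close> to the dual game would give the same inequality once
    more. The converse compares a strategy that is optimal for Max in \<open>G\<close> with one that
    is optimal for Max in the dual, that is, for Min in \<open>G\<close>.\<close>
  obtain \<sigma> \<tau> where "positional_strategy G (V_max G) \<sigma>" "max_ensures G \<sigma> v (Val G v)"
    "positional_strategy G (V_min G) \<tau>" "max_ensures (dual G) \<tau> v (Val (dual G) v)"
    using Val_spec[OF G, of v] Val_spec[OF d(1), of v] by auto
  then have "Val G v \<le> - Val (dual G) v"
    using ensures_le[OF G, of \<sigma> v "Val G v" \<tau> "- Val (dual G) v"]
    by (simp add: max_ensures_dual[OF d(2)] min_ensures_def)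
  then show "Val (dual G) v \<le> - Val G v" by simp
qed

lemma Val_min_eq:
  assumes "simple_recursive_game G" "v \<in> V_min G"
  shows "\<exists>w. (v, w) \<in> arcs G \<and> Val G w = Val G v"
  using Val_max(2)[OF srg_dual[OF assms(1)], of v] assms by (simp add: Val_dual)

section \<open>Optimal strategies from attractors\<close>

text \<open>If \<open>v\<close> were on the wrong side of the attractor, the moves of Min contained
  in the same \<open>\<sigma>\<close> would keep all outcomes below the value of \<open>v\<close>,
  and \<open>Val_less\<close> would put the value below itself. The negated comparison in the target
  set is the form in which the machine tests it.\<close>

lemma weak_max:
  assumes G: "simple_recursive_game G"
    and att: "if Val G v > 0
       then attracts G (V_max G) (V_min G) {t \<in> terminals G. \<not> payoff G t < Val G v} L rk \<sigma>
       else attracts G (V_min G) (V_max G) {t \<in> terminals G. payoff G t < Val G v} L rk \<sigma>"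
  shows "positional_strategy G (V_max G) \<sigma>" "max_ensures G \<sigma> v (Val G v)"
proof -
  show ps: "positional_strategy G (V_max G) \<sigma>"
    using att by (auto simp: attracts_def positional_strategy_def split: if_splits)
  have ps': "positional_strategy G (V_min G) \<sigma>"
    using att by (auto simp: attracts_def positional_strategy_def split: if_splits)
  show "max_ensures G \<sigma> v (Val G v)"
  proof (cases "Val G v > 0")
    case True
    then have att: "attracts G (V_max G) (V_min G) {t \<in> terminals G. \<not> payoff G t < Val G v} L rk \<sigma>"
      using att by simp
    have "v \<in> L"
    proof (rule ccontr)
      assume "v \<notin> L"
      then have "Val G v < Val G v"
        using min_avoid[OF G att] True by (intro Val_less[OF G ps']) fastforce
      then show False by simp
    qed
    from max_attract[OF G att _ this] show ?thesis by (fastforce simp: max_ensures_def)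
  next
    case False
    then have att: "attracts G (V_min G) (V_max G) {t \<in> terminals G. payoff G t < Val G v} L rk \<sigma>"
      using att by simp
    have "v \<notin> L"
    proof
      assume "v \<in> L"
      then have "Val G v < Val G v"
        using min_attract[OF G att] by (intro Val_less[OF G ps']) fastforce
      then show False by simp
    qed
    from max_avoid[OF G att this] False show ?thesis by (fastforce simp: max_ensures_def)
  qed
qed

lemma weak_min:
  assumes G: "simple_recursive_game G"
    and att: "if Val G v < 0
       then attracts G (V_min G) (V_max G) {t \<in> terminals G. \<not> Val G v < payoff G t} L rk \<tau>
       else attracts G (V_max G) (V_min G) {t \<in> terminals G. Val G v < payoff G t} L rk \<tau>"
  shows "positional_strategy G (V_min G) \<tau>" "min_ensures G \<tau> v (Val G v)"
  using weak_max[OF srg_dual[OF G], of v L rk \<tau>] att game_facts(4)[OF G]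
  by (simp_all add: Val_dual[OF G] max_ensures_dual)

text \<open>This describes the result of attracting to the terminals along arcs between positions of equal
  value only. The positions of positive value outside \<open>L\<close> would form traps for Max, so there are none.\<close>

definition level_attracts :: "'v srg \<Rightarrow> 'v set \<Rightarrow> ('v \<Rightarrow> nat) \<Rightarrow> ('v \<Rightarrow> 'v) \<Rightarrow> bool" where
  "level_attracts G L rk \<sigma> \<longleftrightarrow>
     terminals G \<subseteq> L \<and>
     (\<forall>v \<in> V_min G \<union> V_max G. (v, \<sigma> v) \<in> arcs G \<and> Val G (\<sigma> v) = Val G v) \<and>
     (\<forall>v \<in> V_max G. Val G v > 0 \<longrightarrow>
        (v \<in> L \<longrightarrow> rk (\<sigma> v) < rk v) \<and>
        (v \<notin> L \<longrightarrow> (\<forall>w. (v, w) \<in> arcs G \<and> Val G w = Val G v \<longrightarrow> w \<notin> L))) \<and>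
     (\<forall>v \<in> V_min G. Val G v > 0 \<longrightarrow>
        (v \<in> L \<longrightarrow> (\<forall>w. (v, w) \<in> arcs G \<and> Val G w = Val G v \<longrightarrow> rk w < rk v)) \<and>
        (v \<notin> L \<longrightarrow> (\<exists>w. (v, w) \<in> arcs G \<and> Val G w = Val G v \<and> w \<notin> L)))"

lemma level_attractsD:
  assumes "level_attracts G L rk \<sigma>"
  shows "terminals G \<subseteq> L"
    "\<And>v. v \<in> V_min G \<union> V_max G \<Longrightarrow> (v, \<sigma> v) \<in> arcs G"
    "\<And>v. v \<in> V_min G \<union> V_max G \<Longrightarrow> Val G (\<sigma> v) = Val G v"
    "\<And>v. v \<in> V_max G \<Longrightarrow> Val G v > 0 \<Longrightarrow> v \<in> L \<Longrightarrow> rk (\<sigma> v) < rk v"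
    "\<And>v w. v \<in> V_max G \<Longrightarrow> Val G v > 0 \<Longrightarrow> v \<notin> L \<Longrightarrow> (v, w) \<in> arcs G \<Longrightarrow>
        Val G w = Val G v \<Longrightarrow> w \<notin> L"
    "\<And>v w. v \<in> V_min G \<Longrightarrow> Val G v > 0 \<Longrightarrow> v \<in> L \<Longrightarrow> (v, w) \<in> arcs G \<Longrightarrow>
        Val G w = Val G v \<Longrightarrow> rk w < rk v"
    "\<And>v. v \<in> V_min G \<Longrightarrow> Val G v > 0 \<Longrightarrow> v \<notin> L \<Longrightarrow>
        \<exists>w. (v, w) \<in> arcs G \<and> Val G w = Val G v \<and> w \<notin> L"
  using assms unfolding level_attracts_def by blast+

text \<open>Neither \<open>\<sigma>\<close> nor any arc of Min lowers the value, so every terminal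
  reached pays at least \<open>Val G v\<close>. Only endless play can fail, and only if this value
  is positive. It is excluded by showing that all positions of positive value lie in
  \<open>L\<close> and by a rank that also takes account of moves of Min that raise the
  value.\<close>

lemma strong_max:
  assumes G: "simple_recursive_game G" and att: "level_attracts G L rk \<sigma>" and v: "v \<in> positions G"
  shows "max_ensures G \<sigma> v (Val G v)"
proof -
  note g = game_facts[OF G]
  note att' = level_attractsD[OF att]
  have \<sigma>: "(u, \<sigma> u) \<in> arcs G" "Val G (\<sigma> u) = Val G u" if "u \<in> V_min G \<union> V_max G" for u
    using att'(2,3)[OF that] by auto
  define C where "C = {u \<in> positions G. Val G v \<le> Val G u}"
  have vC: "v \<in> C" using v by (simp add: C_def)
  have Cmax: "\<sigma> u \<in> C" if "u \<in> C" "u \<in> V_max G" for u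
    using that \<sigma>[of u] g(9) by (auto simp: C_def)
  have Cmin: "w \<in> C" if "u \<in> C" "u \<in> V_min G" "(u, w) \<in> arcs G" for u w
    using that Val_min_le[OF G, of u w] g(9) by (auto simp: C_def)
  show ?thesis
  proof (cases "Val G v > 0")
    case False
    show ?thesis
      unfolding max_ensures_def
    proof (intro allI impI)
      fix t assume "strategy G (V_min G) t"
      from outcome_safe[OF vC this, of \<sigma>] Cmax Cmin
      have "outcome G (\<lambda>h. \<sigma>) t v \<in> insert 0 (payoff G ` (C \<inter> terminals G))" by blast
      with False show "Val G v \<le> outcome G (\<lambda>h. \<sigma>) t v"
        by (auto simp: C_def Val_terminal[OF G])
    qed
  next
    case True
    have L: "u \<in> L" if u: "u \<in> positions G" "Val G u > 0" for u
    proof (rule ccontr)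
      assume "u \<notin> L"
      define x where "x = Val G u"
      \<comment> \<open>\<open>D\<close> is a trap for Max: his arcs never raise the value, and at
        value \<open>x\<close> no arc of equal value leads him from outside \<open>L\<close> into
        \<open>L\<close>, while Min is able to stay. All terminals lie in \<open>L\<close>, so those
        in \<open>D\<close> pay less than \<open>x\<close>; endless play pays 0, which is less than
        \<open>x\<close> too.\<close>
      define D where "D = {u. Val G u < x \<or> (Val G u = x \<and> u \<in> positions G - L)}"
      define \<tau> where "\<tau> u = (if u \<in> L \<or> Val G u \<noteq> x then \<sigma> u
         else SOME w. (u, w) \<in> arcs G \<and> Val G u = Val G w \<and> w \<notin> L)" for u
      have \<tau>: "(w, \<tau> w) \<in> arcs G \<and> (w \<in> D \<longrightarrow> \<tau> w \<in> D)" if w: "w \<in> V_min G" for w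
      proof (cases "w \<in> L \<or> Val G w \<noteq> x")
        case True
        then show ?thesis using \<sigma>[of w] w by (auto simp: \<tau>_def D_def)
      next
        case False
        then have "w \<notin> V_max G" "Val G w > 0" "w \<notin> L" using w u g(4) by (auto simp: x_def)
        then have "\<exists>z. (w, z) \<in> arcs G \<and> Val G w = Val G z \<and> z \<notin> L"
          using att'(7)[OF w] by metis
        from someI_ex[OF this] show ?thesis using False g(9) by (auto simp: \<tau>_def D_def)
      qed
      have max: "z \<in> D" if w: "w \<in> D" "w \<in> V_max G" "(w, z) \<in> arcs G" for w z
      proof (cases "Val G z = x")
        case True
        with w Val_max(1)[OF G, of w z] have "Val G w = x" "w \<notin> L" by (auto simp: D_def)
        moreover have "Val G w > 0" using \<open>Val G w = x\<close> u(2) by (simp add: x_def)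
        ultimately have "z \<notin> L" using att'(5)[of w z] w True by simp
        with True show ?thesis using g(9)[of w z] w by (auto simp: D_def)
      next
        case False
        with w Val_max(1)[OF G, of w z] show ?thesis by (auto simp: D_def)
      qed
      have "Val G u < x"
      proof (rule Val_less[OF G])
        show "positional_strategy G (V_min G) \<tau>" using \<tau> by (auto simp: positional_strategy_def)
        fix s assume s: "strategy G (V_max G) s"
        have "u \<in> D" using \<open>u \<notin> L\<close> u by (auto simp: D_def x_def)
        then have "outcome (dual G) (\<lambda>h. \<tau>) s u \<in> insert 0 (payoff (dual G) ` (D \<inter> terminals (dual G)))"
          by (rule outcome_safe) (use s \<tau> max in auto)
        then have "outcome G s (\<lambda>h. \<tau>) u \<in> insert 0 (payoff G ` (D \<inter> terminals G))"
          using outcome_dual[OF g(4), of "\<lambda>h. \<tau>" s u] by auto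
        moreover have "terminals G \<subseteq> L" by (rule att'(1))
        ultimately show "outcome G s (\<lambda>h. \<tau>) u < x"
          using u(2) by (auto simp: D_def x_def Val_terminal[OF G])
      qed
      then show False by (simp add: x_def)
    qed
    \<comment> \<open>The rank is lexicographic: the number of positions of larger value, which
      drops whenever Min raises the value, comes before \<open>rk\<close>. The factor
      \<open>M\<close> exceeds \<open>rk\<close> at every position.\<close>
    define M where "M = Suc (Max (rk ` positions G))"
    define above where "above u = card {z \<in> positions G. Val G z > Val G u}" for u
    define rk' where "rk' u = M * above u + rk u" for u
    have rkM: "rk u < M" if "u \<in> positions G" for u
      using that g(1) by (simp add: M_def less_Suc_eq_le)
    have down: "rk' w < rk' u" if "u \<in> positions G" "w \<in> positions G"
      "Val G u < Val G w \<or> (Val G u = Val G w \<and> rk w < rk u)" for u w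
    proof (cases "Val G u < Val G w")
      case True
      then have "{z \<in> positions G. Val G z > Val G w} \<subset> {z \<in> positions G. Val G z > Val G u}"
        using that by auto
      then have "Suc (above w) \<le> above u"
        unfolding above_def Suc_le_eq using g(1) by (intro psubset_card_mono) auto
      then have "M * Suc (above w) \<le> M * above u" by (rule mult_le_mono2)
      with rkM[OF that(2)] show ?thesis by (simp add: rk'_def)
    next
      case False
      with that show ?thesis by (auto simp: rk'_def above_def)
    qed
    show ?thesis
      unfolding max_ensures_def
    proof (intro allI impI)
      fix t assume t: "strategy G (V_min G) t"
      have "outcome G (\<lambda>h. \<sigma>) t v \<in> payoff G ` (C \<inter> terminals G)"
      proof (rule outcome_reach[OF vC t, of \<sigma> rk'])
        show "C \<subseteq> positions G" by (auto simp: C_def)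
        fix u assume u: "u \<in> C"
        then have pos: "u \<in> positions G" "Val G u > 0" "u \<in> L" using True L by (auto simp: C_def)
        show "\<sigma> u \<in> C \<and> rk' (\<sigma> u) < rk' u" if "u \<in> V_max G"
          using Cmax[OF u that] \<sigma>[of u] that pos att'(4)[of u] down[of u "\<sigma> u"] by (auto simp: C_def)
        fix w assume w: "u \<in> V_min G" "(u, w) \<in> arcs G"
        have "Val G u = Val G w \<Longrightarrow> rk w < rk u" using att'(6)[OF w(1) pos(2,3) w(2)] by simp
        with Cmin[OF u w] Val_min_le[OF G w] down[of u w] pos
        show "w \<in> C \<and> rk' w < rk' u" by (cases "Val G u = Val G w") (auto simp: C_def)
      qed
      then show "Val G v \<le> outcome G (\<lambda>h. \<sigma>) t v"
        by (auto simp: C_def Val_terminal[OF G])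
    qed
  qed
qed

lemma strong_min:
  assumes G: "simple_recursive_game G" and "level_attracts (dual G) L rk \<sigma>" "v \<in> positions G"
  shows "min_ensures G \<sigma> v (Val G v)"
  using strong_max[OF srg_dual[OF G] assms(2), of v] assms(3)
  by (simp add: Val_dual[OF G] max_ensures_dual[OF game_facts(4)[OF G]])

section \<open>Independence of strategies from entries outside the positions\<close>

lemma play_cong:
  assumes "\<And>h u. u \<in> V_max G \<Longrightarrow> s h u = s' h u" "\<And>h u. u \<in> V_min G \<Longrightarrow> t h u = t' h u"
  shows "play G s t v k = play G s' t' v k"
  using assms by (induction k) (auto split: prod.splits)

lemma max_ensures_cong:
  assumes "\<And>u. u \<in> V_max G \<Longrightarrow> \<sigma> u = \<sigma>' u"
  shows "max_ensures G \<sigma> v x = max_ensures G \<sigma>' v x"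
  using play_cong[of G "\<lambda>h. \<sigma>" "\<lambda>h. \<sigma>'" t t for t] assms
  by (simp add: max_ensures_def outcome_def)

lemma min_ensures_cong:
  assumes "\<And>u. u \<in> V_min G \<Longrightarrow> \<tau> u = \<tau>' u"
  shows "min_ensures G \<tau> v x = min_ensures G \<tau>' v x"
  using play_cong[of G s s "\<lambda>h. \<tau>" "\<lambda>h. \<tau>'" for s] assms
  by (simp add: min_ensures_def outcome_def)

lemma positional_cong:
  "(\<And>u. u \<in> A \<Longrightarrow> \<sigma> u = \<sigma>' u) \<Longrightarrow> positional_strategy G A \<sigma> = positional_strategy G A \<sigma>'"
  by (simp add: positional_strategy_def)

text \<open>The output arrays in memory are known to agree with the computed strategies at positions
  only; cells read beyond them may contain anything.\<close>

lemma weak_solution_cong: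
  assumes "weak_solution G v\<^sub>0 x \<sigma> \<tau>"
    and "\<And>u. u \<in> positions G \<Longrightarrow> \<sigma>' u = \<sigma> u" "\<And>u. u \<in> positions G \<Longrightarrow> \<tau>' u = \<tau> u"
  shows "weak_solution G v\<^sub>0 x \<sigma>' \<tau>'"
  using assms max_ensures_cong[of G \<sigma> \<sigma>'] min_ensures_cong[of G \<tau> \<tau>']
    positional_cong[of "V_max G" \<sigma> \<sigma>' G] positional_cong[of "V_min G" \<tau> \<tau>' G]
  by (simp add: weak_solution_def positions_def)

lemma strong_solution_cong:
  assumes "strong_solution G val \<sigma> \<tau>" "\<And>u. u \<in> positions G \<Longrightarrow> val' u = val u"
    and "\<And>u. u \<in> positions G \<Longrightarrow> \<sigma>' u = \<sigma> u" "\<And>u. u \<in> positions G \<Longrightarrow> \<tau>' u = \<tau> u"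
  shows "strong_solution G val' \<sigma>' \<tau>'"
  using assms max_ensures_cong[of G \<sigma> \<sigma>'] min_ensures_cong[of G \<tau> \<tau>']
    positional_cong[of "V_max G" \<sigma> \<sigma>' G] positional_cong[of "V_min G" \<tau> \<tau>' G]
  by (simp add: strong_solution_def positions_def)

section \<open>Computing attractors\<close>

text \<open>Registers 2 to 6 hold \<open>N\<close>, \<open>m\<close>, 0, 1 and 2. Register 7 holds the current position, 8 the current
  arc, 10 the head of an arc, 13 the end of the queue, 14 the start of its unprocessed part, 15 an
  owner; the others are scratch. The arcs into \<open>u\<close> form a linked list that starts at \<open>Hd\<close>, where 0 is the
  end of the list and \<open>e + 1\<close> stands for the arc \<open>e\<close>. \<open>Cnt\<close> is the number of arcs into the attractor
  that a position still needs in order to enter it. The flag distinguishes two independent sets of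
  work arrays.\<close>

definition push :: "bool \<Rightarrow> com" where
  "push b = Put (Lab b) 7 5 ;; Put (Que b) 13 7 ;; Plus 13 13 5"

text \<open>Besides entering the list of its head at the front, each relevant arc is stored as a
  provisional choice in \<open>Str\<close>, so that positions never reached by the attractor have a
  move as well.\<close>

definition link :: "bool \<Rightarrow> com" where
  "link b = Put (Str b) 7 10 ;; Get 11 (Cnt b) 7 ;; Plus 11 11 5 ;; Put (Cnt b) 7 11 ;;
     Get 12 (Hd b) 10 ;; Put (Nxt b) 8 12 ;; Plus 9 8 5 ;; Put (Hd b) 10 9"

text \<open>Positions and arcs are scanned in a single loop whose iterations pass either an arc or a
  position, which makes the bound linear in their sum. The parameters wrap a command in a test:
  whether an arc is relevant, whether a terminal is a target, and whether the position belongs to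
  the attracting side.\<close>

definition build :: "(com \<Rightarrow> com) \<Rightarrow> (com \<Rightarrow> com) \<Rightarrow> (com \<Rightarrow> com) \<Rightarrow> bool \<Rightarrow> com" where
  "build relt seedt onet b =
     Set 13 0 ;; Set 7 0 ;; Set 8 0 ;;
     While (Less 7 2)
       (Plus 9 7 5 ;; Get 9 Off 9 ;;
        Cond (Less 8 9)
          (Get 10 Heads 8 ;; Put (Src b) 8 7 ;; relt (link b) ;; Plus 8 8 5)
          (Get 15 Own 7 ;;
           Cond (Equal 15 6) (Put (Cnt b) 7 4 ;; seedt (push b)) (onet (Put (Cnt b) 7 5)) ;;
           Plus 7 7 5))"

text \<open>Among the sources met here, a counter of 0 marks terminals and positions already queued,
  which must not be entered again. The move stored when a counter reaches 0 leads to the position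
  being processed, which is earlier in the queue.\<close>

definition peel :: "bool \<Rightarrow> com" where
  "peel b =
     Set 14 0 ;;
     While (Less 14 13)
       (Get 10 (Que b) 14 ;; Plus 14 14 5 ;; Get 8 (Hd b) 10 ;;
        While (Less 4 8)
          (Minus 8 8 5 ;; Get 7 (Src b) 8 ;; Get 11 (Cnt b) 7 ;;
           Cond (Less 4 11)
             (Minus 11 11 5 ;; Put (Cnt b) 7 11 ;;
              Cond (Equal 11 4) (Put (Str b) 7 10 ;; push b) Nop)
             Nop ;;
           Get 8 (Nxt b) 8))"

text \<open>Outside the attractor, \<open>peel\<close> leaves the provisional arc in place, which
  may lead into the attractor. It is replaced here by an arc that stays outside, if there is
  one.\<close>

definition escape :: "bool \<Rightarrow> com" where
  "escape b =
     Set 8 0 ;;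
     While (Less 8 3)
       (Get 7 (Src b) 8 ;; Get 10 Heads 8 ;; Get 11 (Lab b) 7 ;;
        Cond (Equal 11 4)
          (Get 11 (Lab b) 10 ;; Cond (Equal 11 4) (Put (Str b) 7 10) Nop)
          Nop ;;
        Plus 8 8 5)"

section \<open>Lists of incoming arcs and initial counters\<close>

lemma wp_Set_0: "wp X w sz (Set r 0) Q \<rho> \<alpha> k \<longleftrightarrow> Q (\<rho>(r := 0)) \<alpha> (k + 1)"
  by (simp add: wp_simps)

lemma queue_push:
  assumes "inj_on q {..<t}" "v \<notin> q ` {..<t::nat}"
  shows "inj_on (q(t := v)) {..<Suc t}" "(q(t := v)) ` {..<Suc t} = insert v (q ` {..<t})"
  using assms by (auto simp: lessThan_Suc inj_on_fun_updI)

text \<open>Arcs are numbered by source, those of \<open>v\<close> from \<open>off v\<close> up to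
  but excluding \<open>off (Suc v)\<close>. All work arrays get the same capacity, whether they are
  indexed by positions or by arcs, which keeps the layout uniform. The bound on \<open>w\<close>
  leaves room for arc links and for the indices \<open>N + v\<close> of given values.\<close>

locale arena =
  fixes X :: "nat \<Rightarrow> real" and w :: nat and sz :: "arr \<Rightarrow> nat"
    and N m :: nat and off sr ds own :: "nat \<Rightarrow> nat"
  assumes off_0: "off 0 = 0" and off_N: "off N = m"
    and off_mono: "v < N \<Longrightarrow> off v \<le> off (Suc v)"
    and sr_eq: "v < N \<Longrightarrow> off v \<le> e \<Longrightarrow> e < off (Suc v) \<Longrightarrow> sr e = v"
    and sr_less: "e < m \<Longrightarrow> sr e < N" and ds_less: "e < m \<Longrightarrow> ds e < N"
    and w_ge: "2 * N + m + 2 \<le> w"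
    and sz_in: "N \<le> sz Own" "N < sz Off" "m \<le> sz Heads"
    and sz_work: "N + m < sz (Src b)" "N + m < sz (Nxt b)" "N + m < sz (Hd b)" "N + m < sz (Cnt b)"
      "N + m < sz (Str b)" "N + m < sz (Lab b)" "N + m < sz (Que b)"
begin

lemma off_le: "u \<le> v \<Longrightarrow> v \<le> N \<Longrightarrow> off u \<le> off v"
  by (induction rule: dec_induct) (use off_mono in \<open>auto intro: le_trans\<close>)

lemma off_le_m: "v \<le> N \<Longrightarrow> off v \<le> m"
  using off_le[of v N] off_N by simp

definition regs_ok :: "regs \<Rightarrow> bool" where
  "regs_ok \<rho> \<longleftrightarrow> \<rho> 2 = N \<and> \<rho> 3 = m \<and> \<rho> 4 = 0 \<and> \<rho> 5 = 1 \<and> \<rho> 6 = 2"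

definition input_ok :: "arrs \<Rightarrow> bool" where
  "input_ok \<alpha> \<longleftrightarrow> (\<forall>v<N. \<alpha> Own v = own v) \<and> (\<forall>v\<le>N. \<alpha> Off v = off v) \<and> (\<forall>e<m. \<alpha> Heads e = ds e)"

text \<open>The test that \<open>t\<close> puts in front of a command costs at most 12 and overwrites only registers from
  16 on.\<close>

definition guards :: "(regs \<Rightarrow> bool) \<Rightarrow> (regs \<Rightarrow> bool) \<Rightarrow> (com \<Rightarrow> com) \<Rightarrow> bool" where
  "guards pre P t \<longleftrightarrow> (\<forall>c Q \<rho> \<alpha> k. regs_ok \<rho> \<longrightarrow> pre \<rho> \<longrightarrow>
     (\<forall>\<rho>' k'. k' \<le> k + 12 \<longrightarrow> (\<forall>r<16. \<rho>' r = \<rho> r) \<longrightarrow>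
        (if P \<rho> then wp X w sz c Q \<rho>' \<alpha> k' else Q \<rho>' \<alpha> k')) \<longrightarrow>
     wp X w sz (t c) Q \<rho> \<alpha> k)"

end

locale peeling = arena +
  fixes R :: "nat \<Rightarrow> nat \<Rightarrow> bool" and sd on :: "nat \<Rightarrow> bool" and b :: bool
begin

definition rl :: "nat \<Rightarrow> bool" where "rl e \<longleftrightarrow> R (sr e) (ds e)"
definition dg :: "nat \<Rightarrow> nat \<Rightarrow> nat" where "dg v e = card {i. i < e \<and> rl i \<and> sr i = v}"
text \<open>Terminals may have outgoing arcs; the counter 0 prevents these from pulling a terminal
  into the attractor.\<close>

definition c0 :: "nat \<Rightarrow> nat" where
  "c0 v = (if own v = 2 then 0 else if on v then 1 else dg v m)"
definition seeds :: "nat set" where "seeds = {v. v < N \<and> own v = 2 \<and> sd v}"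

text \<open>\<open>pv u e\<close> is one more than the last relevant arc into \<open>u\<close> before \<open>e\<close>, or 0 if there is none:
  the links of the list of the arcs into \<open>u\<close>.\<close>

primrec pv :: "nat \<Rightarrow> nat \<Rightarrow> nat" where
  "pv u 0 = 0"
| "pv u (Suc e) = (if rl e \<and> ds e = u then Suc e else pv u e)"

lemma pv_le: "pv u e \<le> e"
  by (induction e) auto

lemma pv_set: "i < e \<Longrightarrow> rl i \<Longrightarrow> ds i = u \<Longrightarrow> i < pv u e"
  by (induction e) (auto simp: less_Suc_eq)

lemma pv_Suc: "pv u e = Suc i \<Longrightarrow> rl i \<and> ds i = u"
  by (induction e) (auto split: if_splits)

lemma dg_Suc: "dg v (Suc e) = dg v e + (if rl e \<and> sr e = v then 1 else 0)"
proof -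
  have "{i. i < Suc e \<and> rl i \<and> sr i = v} =
      (if rl e \<and> sr e = v then insert e {i. i < e \<and> rl i \<and> sr i = v} else {i. i < e \<and> rl i \<and> sr i = v})"
    by (auto simp: less_Suc_eq)
  then show ?thesis by (simp add: dg_def)
qed

lemma dg_0: "dg v 0 = 0"
  by (simp add: dg_def)

text \<open>Arcs are sorted by source, so the count collected for \<open>v\<close> is complete as
  soon as the scan reaches \<open>off (Suc v)\<close>.\<close>

lemma dg_all:
  assumes "v < N" "off (Suc v) \<le> e" "e \<le> m"
  shows "dg v e = dg v m"
proof -
  have "i < off (Suc v)" if "i < m" "sr i = v" for i
  proof (rule ccontr)
    assume "\<not> i < off (Suc v)"
    have "\<exists>u. u < N \<and> off u \<le> i \<and> i < off (Suc u) \<and> v < u"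
    proof -
      \<comment> \<open>This is the position whose segment of the arc list contains
        \<open>i\<close>. It lies beyond \<open>v\<close>, although the source of \<open>i\<close>
        is \<open>v\<close>.\<close>
      define u where "u = (LEAST u. i < off (Suc u))"
      have ex: "i < off (Suc (N - 1))" using that off_N assms by simp
      have u: "i < off (Suc u)" unfolding u_def by (rule LeastI, rule ex)
      have uN: "u < N" using Least_le[of "\<lambda>u. i < off (Suc u)", OF ex] assms by (simp add: u_def)
      have "off u \<le> i"
      proof (cases u)
        case (Suc u')
        then show ?thesis using not_less_Least[of u' "\<lambda>u. i < off (Suc u)"] by (simp add: u_def)
      qed (simp add: off_0)
      moreover have "v < u"
      proof (rule ccontr)
        assume "\<not> v < u"
        then have "off (Suc u) \<le> off (Suc v)" using assms by (intro off_le) auto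
        with u \<open>\<not> i < off (Suc v)\<close> show False by simp
      qed
      ultimately show ?thesis using u uN by blast
    qed
    with sr_eq that show False by blast
  qed
  then have "{i. i < e \<and> rl i \<and> sr i = v} = {i. i < m \<and> rl i \<and> sr i = v}"
    using assms by auto (metis order_less_le_trans)
  then show ?thesis by (simp add: dg_def)
qed

text \<open>The scan stands at position \<open>v\<close> and arc \<open>e\<close>, with
  \<open>tp\<close> positions queued. Counters below \<open>v\<close> are final, the others still
  count the relevant arcs seen so far. Of \<open>Str\<close> it is only known that it holds the head
  of some relevant arc already seen, if there is one.\<close>

definition binv :: "nat \<Rightarrow> nat \<Rightarrow> nat \<Rightarrow> arrs \<Rightarrow> bool" where
  "binv v e tp \<alpha> \<longleftrightarrow> input_ok \<alpha> \<and> v \<le> N \<and> off v \<le> e \<and> (v < N \<longrightarrow> e \<le> off (Suc v)) \<and> e \<le> m \<and>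
     (\<forall>i<e. \<alpha> (Src b) i = sr i) \<and>
     (\<forall>i<e. rl i \<longrightarrow> \<alpha> (Nxt b) i = pv (ds i) i) \<and>
     (\<forall>u<N. \<alpha> (Hd b) u = pv u e) \<and>
     (\<forall>u<N. \<alpha> (Cnt b) u = (if u < v then c0 u else dg u e)) \<and>
     (\<forall>u<N. 0 < dg u e \<longrightarrow> (\<exists>i<e. rl i \<and> sr i = u \<and> ds i = \<alpha> (Str b) u)) \<and>
     (\<forall>u<N. \<alpha> (Lab b) u = (if u < v \<and> u \<in> seeds then 1 else 0)) \<and>
     inj_on (\<alpha> (Que b)) {..<tp} \<and> \<alpha> (Que b) ` {..<tp} = {u \<in> seeds. u < v} \<and> tp \<le> v"

text \<open>The updates are listed in the order in which the code performs them, so that symbolic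
  execution ends in this very term.\<close>

lemma binv_link:
  assumes "binv v e tp \<alpha>" "v < N" "e < off (Suc v)" "rl e" "u = ds e"
  shows "binv v (Suc e) tp (\<alpha>(Src b := (\<alpha> (Src b))(e := v), Str b := (\<alpha> (Str b))(v := u),
     Cnt b := (\<alpha> (Cnt b))(v := Suc (\<alpha> (Cnt b) v)), Nxt b := (\<alpha> (Nxt b))(e := \<alpha> (Hd b) u),
     Hd b := (\<alpha> (Hd b))(u := Suc e)))"
proof -
  have e: "sr e = v" "e < m"
    using assms sr_eq[of v e] off_le_m[of "Suc v"] by (auto simp: binv_def)
  then show ?thesis
    using assms ds_less[OF e(2)] unfolding binv_def input_ok_def
    by (auto simp: dg_Suc less_Suc_eq)
qed

lemma binv_skip:
  assumes "binv v e tp \<alpha>" "v < N" "e < off (Suc v)" "\<not> rl e"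
  shows "binv v (Suc e) tp (\<alpha>(Src b := (\<alpha> (Src b))(e := v)))"
proof -
  have e: "sr e = v" "e < m"
    using assms sr_eq[of v e] off_le_m[of "Suc v"] by (auto simp: binv_def)
  then show ?thesis
    using assms unfolding binv_def input_ok_def by (auto simp: dg_Suc less_Suc_eq)
qed

lemma binv_next:
  assumes B: "binv v e tp \<alpha>" and v: "v < N" "\<not> e < off (Suc v)"
  shows "own v \<noteq> 2 \<Longrightarrow> \<not> on v \<Longrightarrow> binv (Suc v) e tp \<alpha>"
    "own v \<noteq> 2 \<Longrightarrow> on v \<Longrightarrow> binv (Suc v) e tp (\<alpha>(Cnt b := (\<alpha> (Cnt b))(v := 1)))"
    "own v = 2 \<Longrightarrow> \<not> sd v \<Longrightarrow> binv (Suc v) e tp (\<alpha>(Cnt b := (\<alpha> (Cnt b))(v := 0)))"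
    "own v = 2 \<Longrightarrow> sd v \<Longrightarrow> binv (Suc v) e (Suc tp) (\<alpha>(Cnt b := (\<alpha> (Cnt b))(v := 0),
       Lab b := (\<alpha> (Lab b))(v := 1), Que b := (\<alpha> (Que b))(tp := v)))"
proof -
  have dg: "dg v e = dg v m" using dg_all[of v e] B v by (auto simp: binv_def)
  have off: "Suc v < N \<Longrightarrow> e \<le> off (Suc (Suc v))" "off (Suc v) \<le> e"
    using B v off_mono[of "Suc v"] by (auto simp: binv_def)
  have notin: "v \<notin> \<alpha> (Que b) ` {..<tp}" using B by (auto simp: binv_def)
  have inj: "inj_on (\<alpha> (Que b)) {..<tp}" using B by (simp add: binv_def)
  have seeds: "{u \<in> seeds. u < Suc v} = (if v \<in> seeds then insert v {u \<in> seeds. u < v} else {u \<in> seeds. u < v})"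
    by (auto simp: less_Suc_eq)
  have vs: "v \<in> seeds \<longleftrightarrow> own v = 2 \<and> sd v" using v by (simp add: seeds_def)
  note s = binv_def input_ok_def
  show "own v \<noteq> 2 \<Longrightarrow> \<not> on v \<Longrightarrow> binv (Suc v) e tp \<alpha>"
    using B v off dg unfolding s seeds by (auto simp: less_Suc_eq c0_def vs)
  show "own v \<noteq> 2 \<Longrightarrow> on v \<Longrightarrow> binv (Suc v) e tp (\<alpha>(Cnt b := (\<alpha> (Cnt b))(v := 1)))"
    using B v off dg unfolding s seeds by (auto simp: less_Suc_eq c0_def vs)
  show "own v = 2 \<Longrightarrow> \<not> sd v \<Longrightarrow> binv (Suc v) e tp (\<alpha>(Cnt b := (\<alpha> (Cnt b))(v := 0)))"
    using B v off dg unfolding s seeds by (auto simp: less_Suc_eq c0_def vs)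
  show "own v = 2 \<Longrightarrow> sd v \<Longrightarrow> binv (Suc v) e (Suc tp) (\<alpha>(Cnt b := (\<alpha> (Cnt b))(v := 0),
       Lab b := (\<alpha> (Lab b))(v := 1), Que b := (\<alpha> (Que b))(tp := v)))"
    using B v off dg queue_push[OF inj notin] unfolding s seeds by (auto simp: less_Suc_eq c0_def vs)
qed

lemma build_correct:
  assumes relt: "guards (\<lambda>\<rho>. \<rho> 7 < N \<and> \<rho> 10 < N) (\<lambda>\<rho>. R (\<rho> 7) (\<rho> 10)) relt"
    and seedt: "guards (\<lambda>\<rho>. \<rho> 7 < N \<and> own (\<rho> 7) = 2) (\<lambda>\<rho>. sd (\<rho> 7)) seedt"
    and onet: "guards (\<lambda>\<rho>. \<rho> 7 < N \<and> \<rho> 15 = own (\<rho> 7) \<and> \<rho> 15 \<noteq> 2) (\<lambda>\<rho>. on (\<rho> 7)) onet"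
    and "regs_ok \<rho>" "input_ok \<alpha>"
    and zero: "\<forall>u<N. \<alpha> (Hd b) u = 0 \<and> \<alpha> (Cnt b) u = 0 \<and> \<alpha> (Lab b) u = 0"
    and Q: "\<And>\<rho> \<alpha> k'. regs_ok \<rho> \<Longrightarrow> binv N m (\<rho> 13) \<alpha> \<Longrightarrow> k' \<le> k + 5 + 40 * (N + m) \<Longrightarrow> Q \<rho> \<alpha> k'"
  shows "wp X w sz (build relt seedt onet b) Q \<rho> \<alpha> k"
proof -
  \<comment> \<open>Each iteration increases \<open>\<rho> 7 + \<rho> 8\<close> by one and costs at
    most 40.\<close>
  let ?I = "\<lambda>\<rho> \<alpha> k'. regs_ok \<rho> \<and> binv (\<rho> 7) (\<rho> 8) (\<rho> 13) \<alpha> \<and> k' \<le> k + 3 + 40 * (\<rho> 7 + \<rho> 8)"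
  show ?thesis
    unfolding build_def wp_Seq wp_Set_0
  proof (rule wp_While[where I = ?I and K = "k + 3 + 40 * (N + m)"])
    show "?I (\<rho>(13 := 0, 7 := 0, 8 := 0)) \<alpha> (k + 1 + 1 + 1)"
      using assms(4,5) zero by (auto simp: regs_ok_def binv_def off_0 dg_0)
  next
    fix \<rho> \<alpha> k' assume I: "?I \<rho> \<alpha> k'" and "\<not> holds X (Less 7 2) \<rho>"
    then have "\<rho> 7 = N" "\<rho> 8 = m" using off_N by (auto simp: binv_def regs_ok_def)
    with I show "Q \<rho> \<alpha> (k' + 2)" by (intro Q) auto
  next
    fix \<rho> \<alpha> k' assume I: "?I \<rho> \<alpha> k'" and "holds X (Less 7 2) \<rho>"
    then have v: "\<rho> 7 < N" by (simp add: regs_ok_def)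
    have r: "\<rho> 2 = N" "\<rho> 3 = m" "\<rho> 4 = 0" "\<rho> 5 = 1" "\<rho> 6 = 2" and B: "binv (\<rho> 7) (\<rho> 8) (\<rho> 13) \<alpha>"
      and k: "k' \<le> k + 3 + 40 * (\<rho> 7 + \<rho> 8)"
      using I by (auto simp: regs_ok_def)
    have e: "\<rho> 8 \<le> m" "\<rho> 13 \<le> N" using B by (auto simp: binv_def)
    have K: "k' \<le> k + 3 + 40 * (N + m)" using k v e by auto
    have in1: "\<alpha> Off (Suc (\<rho> 7)) = off (Suc (\<rho> 7))" "\<alpha> Own (\<rho> 7) = own (\<rho> 7)"
      using B v by (auto simp: binv_def input_ok_def)
    note ws = w_ge sz_in sz_work[of b] v e
    show "k' \<le> k + 3 + 40 * (N + m) \<and> wp X w sz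
       (Plus 9 7 5 ;; Get 9 Off 9 ;;
        Cond (Less 8 9)
          (Get 10 Heads 8 ;; Put (Src b) 8 7 ;; relt (link b) ;; Plus 8 8 5)
          (Get 15 Own 7 ;;
           Cond (Equal 15 6) (Put (Cnt b) 7 4 ;; seedt (push b)) (onet (Put (Cnt b) 7 5)) ;;
           Plus 7 7 5)) ?I \<rho> \<alpha> (k' + 2)"
    proof (cases "\<rho> 8 < off (Suc (\<rho> 7))")
      case True
      then have em: "\<rho> 8 < m" using off_le_m[of "Suc (\<rho> 7)"] v by auto
      have in2: "\<alpha> Heads (\<rho> 8) = ds (\<rho> 8)" using B em by (auto simp: binv_def input_ok_def)
      have sr: "sr (\<rho> 8) = \<rho> 7" using sr_eq[of "\<rho> 7" "\<rho> 8"] True v B by (auto simp: binv_def)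
      have cnt: "\<alpha> (Cnt b) (\<rho> 7) \<le> \<rho> 8"
      proof -
        have "card {i. i < \<rho> 8 \<and> rl i \<and> sr i = \<rho> 7} \<le> card {..<\<rho> 8}" by (intro card_mono) auto
        then show ?thesis using B v by (simp add: binv_def dg_def)
      qed
      show ?thesis
        using True K ws em ds_less[OF em]
        apply (simp add: wp_Seq wp_Cond wp_simps r in1 in2)
        apply (rule relt[unfolded guards_def, rule_format])
          apply (simp add: regs_ok_def r)
         apply simp
        apply (simp split: if_splits)
        apply (intro conjI impI)
        subgoal for \<rho>' k''
          using binv_link[OF B v True, of "ds (\<rho> 8)"] k cnt
          by (simp add: link_def wp_Seq wp_simps regs_ok_def r rl_def sr)
        subgoal for \<rho>' k''
          using binv_skip[OF B v True] k
          by (simp add: link_def wp_Seq wp_simps regs_ok_def r rl_def sr)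
        done
    next
      case False
      show ?thesis
      proof (cases "own (\<rho> 7) = 2")
        case True
        show ?thesis
          using False True K ws
          apply (simp add: wp_Seq wp_Cond wp_simps r in1)
          apply (rule seedt[unfolded guards_def, rule_format])
            apply (simp add: regs_ok_def r)
           apply simp
          apply (simp split: if_splits)
          apply (intro conjI impI)
          subgoal for \<rho>' k''
            using binv_next(4)[OF B v False True] k
            by (simp add: push_def wp_Seq wp_simps regs_ok_def r)
          subgoal for \<rho>' k''
            using binv_next(3)[OF B v False True] k
            by (simp add: push_def wp_Seq wp_simps regs_ok_def r)
          done
      next
        case nt: False
        show ?thesis
          using False nt K ws
          apply (simp add: wp_Seq wp_Cond wp_simps r in1)
          apply (rule onet[unfolded guards_def, rule_format])
            apply (simp add: regs_ok_def r)
           apply simp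
          apply (simp split: if_splits)
          apply (intro conjI impI)
          subgoal for \<rho>' k''
            using binv_next(2)[OF B v False nt] k
            by (simp add: push_def wp_Seq wp_simps regs_ok_def r)
          subgoal for \<rho>' k''
            using binv_next(1)[OF B v False nt] k
            by (simp add: push_def wp_Seq wp_simps regs_ok_def r)
          done
      qed
    qed
  qed
qed

end

section \<open>Peeling: correctness and amortised cost\<close>

context peeling begin

definition lists_ok :: "arrs \<Rightarrow> bool" where
  "lists_ok \<alpha> \<longleftrightarrow> (\<forall>i<m. \<alpha> (Src b) i = sr i) \<and>
     (\<forall>i<m. rl i \<longrightarrow> \<alpha> (Nxt b) i = pv (ds i) i) \<and> (\<forall>u<N. \<alpha> (Hd b) u = pv u m)"

text \<open>Queue indices serve as attractor ranks: a position is queued only when enough of its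
  arcs lead to positions queued before it.\<close>

definition rank :: "(nat \<Rightarrow> nat) \<Rightarrow> nat \<Rightarrow> nat" where
  "rank q u = (LEAST p. q p = u)"

text \<open>\<open>D\<close> is the set of the arcs processed so far.\<close>

definition pinv :: "(nat \<Rightarrow> nat) \<Rightarrow> nat \<Rightarrow> nat \<Rightarrow> nat set \<Rightarrow> arrs \<Rightarrow> bool" where
  "pinv st0 hp tp D \<alpha> \<longleftrightarrow> (let q = \<alpha> (Que b); L = q ` {..<tp} in
     input_ok \<alpha> \<and> lists_ok \<alpha> \<and> inj_on q {..<tp} \<and> seeds \<subseteq> L \<and> L \<subseteq> {..<N} \<and> hp \<le> tp \<and> tp \<le> N \<and>
     D \<subseteq> {i. i < m \<and> rl i \<and> ds i \<in> q ` {..<hp}} \<and>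
     (\<forall>u<N. \<alpha> (Cnt b) u = c0 u - card {i \<in> D. sr i = u}) \<and>
     (\<forall>u<N. \<alpha> (Lab b) u = (if u \<in> L then 1 else 0)) \<and>
     (\<forall>u<N. u \<in> L \<longleftrightarrow> u \<in> seeds \<or> 0 < c0 u \<and> c0 u \<le> card {i \<in> D. sr i = u}) \<and>
     (\<forall>p<tp. q p \<notin> seeds \<longrightarrow> (\<exists>i<m. rl i \<and> sr i = q p \<and> ds i = \<alpha> (Str b) (q p) \<and> ds i \<in> q ` {..<p})) \<and>
     (\<forall>p<tp. c0 (q p) \<le> card {i. i < m \<and> rl i \<and> sr i = q p \<and> ds i \<in> q ` {..<p}}) \<and>
     (\<forall>u<N. u \<notin> L \<or> u \<in> seeds \<longrightarrow> \<alpha> (Str b) u = st0 u))"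

lemma seeds_c0: "u \<in> seeds \<Longrightarrow> c0 u = 0"
  by (simp add: seeds_def c0_def)

lemma pinv_init:
  assumes "binv N m tp \<alpha>"
  shows "pinv (\<alpha> (Str b)) 0 tp {} \<alpha>"
proof -
  have *: "\<alpha> (Que b) ` {..<tp} = seeds" using assms by (auto simp: binv_def seeds_def)
  have "\<alpha> (Que b) p \<in> seeds" if "p < tp" for p using * that by blast
  then show ?thesis
    using assms * unfolding pinv_def Let_def binv_def lists_ok_def
    by (auto simp: seeds_c0 seeds_def)
qed

lemma pinv_hp: "pinv st0 hp tp D \<alpha> \<Longrightarrow> hp < tp \<Longrightarrow> pinv st0 (Suc hp) tp D \<alpha>"
proof -
  assume P: "pinv st0 hp tp D \<alpha>" and hp: "hp < tp"
  have "D \<subseteq> {i. i < m \<and> rl i \<and> ds i \<in> \<alpha> (Que b) ` {..<hp}}"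
    using P by (simp add: pinv_def Let_def)
  moreover have "\<alpha> (Que b) ` {..<hp} \<subseteq> \<alpha> (Que b) ` {..<Suc hp}" by auto
  ultimately have "D \<subseteq> {i. i < m \<and> rl i \<and> ds i \<in> \<alpha> (Que b) ` {..<Suc hp}}" by blast
  with P hp show ?thesis by (simp add: pinv_def Let_def)
qed

context
  fixes st0 hp tp D \<alpha> i v c
  assumes P: "pinv st0 hp tp D \<alpha>"
    and i: "i < m" "rl i" "i \<notin> D" "ds i \<in> \<alpha> (Que b) ` {..<hp}"
    and v: "v = sr i" and c: "c = \<alpha> (Cnt b) v"
begin

private lemma finD: "finite D"
  using P by (auto simp: pinv_def Let_def intro: finite_subset)

private lemma vN: "v < N"
  using i sr_less v by simp

private lemma card_insert_D:
  "card {j \<in> insert i D. sr j = u} = card {j \<in> D. sr j = u} + (if u = v then 1 else 0)"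
proof -
  have "{j \<in> insert i D. sr j = u} = (if u = v then insert i {j \<in> D. sr j = u} else {j \<in> D. sr j = u})"
    using v by auto
  then show ?thesis using i(3) finD by simp
qed

lemma pinv_skip:
  assumes "c = 0"
  shows "pinv st0 hp tp (insert i D) \<alpha>"
  using P i assms c vN unfolding pinv_def Let_def card_insert_D by auto

lemma pinv_dec:
  assumes "1 < c"
  shows "pinv st0 hp tp (insert i D) (\<alpha>(Cnt b := (\<alpha> (Cnt b))(v := c - 1)))"
  using P i assms c vN unfolding pinv_def Let_def card_insert_D input_ok_def lists_ok_def by auto

text \<open>A counter of 1 means that exactly \<open>c0 v - 1\<close> arcs of \<open>v\<close> lie
  in \<open>D\<close>. Hence \<open>v\<close> is not queued yet, and \<open>i\<close> completes the
  count. The heads of all counted arcs occur in the queue before index \<open>tp\<close>, the place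
  that \<open>v\<close> receives.\<close>

lemma pinv_label:
  assumes "c = 1"
  shows "tp < N" "pinv st0 hp (Suc tp) (insert i D) (\<alpha>(Cnt b := (\<alpha> (Cnt b))(v := 0),
    Str b := (\<alpha> (Str b))(v := ds i), Lab b := (\<alpha> (Lab b))(v := 1), Que b := (\<alpha> (Que b))(tp := v)))"
proof -
  let ?q = "\<alpha> (Que b)"
  define q' where "q' = ?q(tp := v)"
  have P': "input_ok \<alpha>" "lists_ok \<alpha>" "inj_on ?q {..<tp}" "seeds \<subseteq> ?q ` {..<tp}"
    "?q ` {..<tp} \<subseteq> {..<N}" "hp \<le> tp" "tp \<le> N"
    "D \<subseteq> {i. i < m \<and> rl i \<and> ds i \<in> ?q ` {..<hp}}"
    "\<forall>u<N. \<alpha> (Cnt b) u = c0 u - card {i \<in> D. sr i = u}"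
    "\<forall>u<N. \<alpha> (Lab b) u = (if u \<in> ?q ` {..<tp} then 1 else 0)"
    "\<forall>u<N. u \<in> ?q ` {..<tp} \<longleftrightarrow> u \<in> seeds \<or> 0 < c0 u \<and> c0 u \<le> card {i \<in> D. sr i = u}"
    "\<forall>p<tp. ?q p \<notin> seeds \<longrightarrow> (\<exists>i<m. rl i \<and> sr i = ?q p \<and> ds i = \<alpha> (Str b) (?q p) \<and> ds i \<in> ?q ` {..<p})"
    "\<forall>p<tp. c0 (?q p) \<le> card {i. i < m \<and> rl i \<and> sr i = ?q p \<and> ds i \<in> ?q ` {..<p}}"
    "\<forall>u<N. u \<notin> ?q ` {..<tp} \<or> u \<in> seeds \<longrightarrow> \<alpha> (Str b) u = st0 u"
    using P unfolding pinv_def Let_def by blast+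
  have cnt: "c0 v = Suc (card {i \<in> D. sr i = v})"
    using P'(9) vN c assms by auto
  then have vL: "v \<notin> ?q ` {..<tp}" "v \<notin> seeds"
    using P'(11) vN seeds_c0 by auto
  \<comment> \<open>The queue holds distinct positions other than \<open>v\<close>, so there is room
    for one more.\<close>
  have "card (insert v (?q ` {..<tp})) \<le> card {..<N}"
    using P'(5) vN by (intro card_mono) auto
  then show tpN: "tp < N"
    using vL P'(3) by (simp add: card_image)
  have q': "inj_on q' {..<Suc tp}" "q' ` {..<Suc tp} = insert v (?q ` {..<tp})"
    "q' tp = v" "\<And>p. p < tp \<Longrightarrow> q' p = ?q p"
    using queue_push[OF P'(3) vL(1)] by (simp_all add: q'_def del: fun_upd_apply) (simp_all add: q'_def)
  have img: "q' ` {..<p} = ?q ` {..<p}" if "p \<le> tp" for p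
    using that q'(4) by (intro image_cong) auto
  have sub: "insert i D \<subseteq> {i. i < m \<and> rl i \<and> ds i \<in> ?q ` {..<hp}}"
    using P'(8) i by auto
  have hp: "?q ` {..<hp} \<subseteq> ?q ` {..<tp}" using P'(6) by auto
  have "{j \<in> insert i D. sr j = v} \<subseteq> {j. j < m \<and> rl j \<and> sr j = v \<and> ds j \<in> ?q ` {..<tp}}"
    using sub hp by auto
  then have "card {j \<in> insert i D. sr j = v} \<le> card {j. j < m \<and> rl j \<and> sr j = v \<and> ds j \<in> ?q ` {..<tp}}"
    by (intro card_mono) auto
  then have c0v: "c0 v \<le> card {j. j < m \<and> rl j \<and> sr j = v \<and> ds j \<in> ?q ` {..<tp}}"
    using card_insert_D[of v] cnt by simp
  have neq: "?q p \<noteq> v" if "p < tp" for p using vL that by auto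
  have A: "\<forall>p<Suc tp. c0 (q' p) \<le> card {i. i < m \<and> rl i \<and> sr i = q' p \<and> ds i \<in> q' ` {..<p}}"
    using P'(13) c0v q'(3,4) by (auto simp: less_Suc_eq img)
  have B: "\<forall>p<Suc tp. q' p \<notin> seeds \<longrightarrow> (\<exists>j<m. rl j \<and> sr j = q' p \<and>
      ds j = ((\<alpha> (Str b))(v := ds i)) (q' p) \<and> ds j \<in> q' ` {..<p})"
  proof (intro allI impI)
    fix p assume p: "p < Suc tp" "q' p \<notin> seeds"
    show "\<exists>j<m. rl j \<and> sr j = q' p \<and> ds j = ((\<alpha> (Str b))(v := ds i)) (q' p) \<and> ds j \<in> q' ` {..<p}"
    proof (cases "p = tp")
      case True
      then show ?thesis using i v hp q'(3) by (intro exI[of _ i]) (auto simp: img)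
    next
      case False
      then show ?thesis using p P'(12) neq q'(4) by (simp add: img)
    qed
  qed
  define \<beta> where "\<beta> = \<alpha>(Cnt b := (\<alpha> (Cnt b))(v := 0),
    Str b := (\<alpha> (Str b))(v := ds i), Lab b := (\<alpha> (Lab b))(v := 1), Que b := q')"
  have \<beta>: "\<beta> (Cnt b) = (\<alpha> (Cnt b))(v := 0)" "\<beta> (Str b) = (\<alpha> (Str b))(v := ds i)"
    "\<beta> (Lab b) = (\<alpha> (Lab b))(v := 1)" "\<beta> (Que b) = q'"
    "input_ok \<beta>" "lists_ok \<beta>"
    using P'(1,2) by (simp_all add: \<beta>_def input_ok_def lists_ok_def)
  have "pinv st0 hp (Suc tp) (insert i D) \<beta>"
    unfolding pinv_def Let_def \<beta>(1-4)
  proof (intro conjI)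
    show "seeds \<subseteq> q' ` {..<Suc tp}" "q' ` {..<Suc tp} \<subseteq> {..<N}" "hp \<le> Suc tp" "Suc tp \<le> N"
      using P'(4,5,6) vN tpN q'(2) by auto
    show "insert i D \<subseteq> {i. i < m \<and> rl i \<and> ds i \<in> q' ` {..<hp}}"
      using sub P'(6) by (simp add: img)
    show "\<forall>u<N. ((\<alpha> (Cnt b))(v := 0)) u = c0 u - card {j \<in> insert i D. sr j = u}"
      using P'(9) cnt unfolding card_insert_D by simp
    show "\<forall>u<N. ((\<alpha> (Lab b))(v := 1)) u = (if u \<in> q' ` {..<Suc tp} then 1 else 0)"
      using P'(10) unfolding q'(2) by simp
    show "\<forall>u<N. u \<in> q' ` {..<Suc tp} \<longleftrightarrow>
        u \<in> seeds \<or> 0 < c0 u \<and> c0 u \<le> card {j \<in> insert i D. sr j = u}"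
      using P'(11) cnt unfolding card_insert_D q'(2) by simp
    show "\<forall>u<N. u \<notin> q' ` {..<Suc tp} \<or> u \<in> seeds \<longrightarrow> ((\<alpha> (Str b))(v := ds i)) u = st0 u"
      using P'(14) vL(2) unfolding q'(2) by simp
  qed (fact \<beta>(5,6) q'(1) A B)+
  then show "pinv st0 hp (Suc tp) (insert i D) (\<alpha>(Cnt b := (\<alpha> (Cnt b))(v := 0),
    Str b := (\<alpha> (Str b))(v := ds i), Lab b := (\<alpha> (Lab b))(v := 1), Que b := (\<alpha> (Que b))(tp := v)))"
    by (simp only: \<beta>_def q'_def)
qed

end

lemma pinv_facts:
  assumes "pinv st0 hp tp D \<alpha>"
  shows "hp \<le> tp" "tp \<le> N" "\<And>p. p < tp \<Longrightarrow> \<alpha> (Que b) p < N" "inj_on (\<alpha> (Que b)) {..<tp}"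
    "\<And>i. i < m \<Longrightarrow> \<alpha> (Src b) i = sr i" "\<And>i. i < m \<Longrightarrow> rl i \<Longrightarrow> \<alpha> (Nxt b) i = pv (ds i) i"
    "\<And>u. u < N \<Longrightarrow> \<alpha> (Hd b) u = pv u m" "D \<subseteq> {..<m}" "finite D" "card D \<le> m"
proof -
  have l: "lists_ok \<alpha>" using assms unfolding pinv_def Let_def by (elim conjE)
  show "\<And>i. i < m \<Longrightarrow> \<alpha> (Src b) i = sr i" "\<And>i. i < m \<Longrightarrow> rl i \<Longrightarrow> \<alpha> (Nxt b) i = pv (ds i) i"
    "\<And>u. u < N \<Longrightarrow> \<alpha> (Hd b) u = pv u m"
    using l unfolding lists_ok_def by blast+
  show "hp \<le> tp" "tp \<le> N" "inj_on (\<alpha> (Que b)) {..<tp}"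
    using assms by (simp_all add: pinv_def Let_def)
  have "D \<subseteq> {i. i < m \<and> rl i \<and> ds i \<in> \<alpha> (Que b) ` {..<hp}}"
    using assms unfolding pinv_def Let_def by (elim conjE)
  then show D: "D \<subseteq> {..<m}" by blast
  show "\<alpha> (Que b) p < N" if "p < tp" for p
    using assms that unfolding pinv_def Let_def by blast
  show "finite D" "card D \<le> m"
    using finite_subset[OF D] card_mono[OF _ D] by simp_all
qed

text \<open>Counting lets one statement cover both kinds of positions: if \<open>c0 u\<close> is 1,
  some arc into \<open>L\<close> suffices for membership; if it is the number of relevant arcs, all
  of them are required.\<close>

definition peeled :: "nat set \<Rightarrow> (nat \<Rightarrow> nat) \<Rightarrow> arrs \<Rightarrow> bool" where
  "peeled L rk \<alpha> \<longleftrightarrow> input_ok \<alpha> \<and> lists_ok \<alpha> \<and> seeds \<subseteq> L \<and> L \<subseteq> {..<N} \<and>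
     (\<forall>u<N. \<alpha> (Lab b) u = (if u \<in> L then 1 else 0)) \<and>
     (\<forall>u \<in> L - seeds. 0 < c0 u \<and> \<alpha> (Str b) u \<in> L \<and> rk (\<alpha> (Str b) u) < rk u) \<and>
     (\<forall>u \<in> L. c0 u \<le> card {i. i < m \<and> rl i \<and> sr i = u \<and> ds i \<in> L \<and> rk (ds i) < rk u}) \<and>
     (\<forall>u<N. u \<notin> L \<and> 0 < c0 u \<longrightarrow> card {i. i < m \<and> rl i \<and> sr i = u \<and> ds i \<in> L} < c0 u) \<and>
     (\<forall>u<N. 0 < dg u m \<longrightarrow> (\<exists>i<m. rl i \<and> sr i = u \<and> ds i = \<alpha> (Str b) u))"

text \<open>When the queue is exhausted, the processed arcs are all relevant arcs into the queued
  set, so the counter conditions turn into statements about that set. Positions whose choice was not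
  overwritten fall back on the arc recorded in \<open>st0\<close>.\<close>

lemma pinv_final:
  assumes P: "pinv st0 tp tp {i. i < m \<and> rl i \<and> ds i \<in> \<alpha> (Que b) ` {..<tp}} \<alpha>"
    and st0: "\<forall>u<N. 0 < dg u m \<longrightarrow> (\<exists>i<m. rl i \<and> sr i = u \<and> ds i = st0 u)"
  shows "peeled (\<alpha> (Que b) ` {..<tp}) (rank (\<alpha> (Que b))) \<alpha>"
proof -
  let ?q = "\<alpha> (Que b)"
  let ?L = "?q ` {..<tp}"
  have P': "input_ok \<alpha>" "lists_ok \<alpha>" "inj_on ?q {..<tp}" "seeds \<subseteq> ?L" "?L \<subseteq> {..<N}"
    "\<forall>u<N. \<alpha> (Lab b) u = (if u \<in> ?L then 1 else 0)"
    "\<forall>u<N. u \<in> ?L \<longleftrightarrow> u \<in> seeds \<or> 0 < c0 u \<and>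
       c0 u \<le> card {i \<in> {i. i < m \<and> rl i \<and> ds i \<in> ?L}. sr i = u}"
    "\<forall>p<tp. ?q p \<notin> seeds \<longrightarrow> (\<exists>i<m. rl i \<and> sr i = ?q p \<and> ds i = \<alpha> (Str b) (?q p) \<and> ds i \<in> ?q ` {..<p})"
    "\<forall>p<tp. c0 (?q p) \<le> card {i. i < m \<and> rl i \<and> sr i = ?q p \<and> ds i \<in> ?q ` {..<p}}"
    "\<forall>u<N. u \<notin> ?L \<or> u \<in> seeds \<longrightarrow> \<alpha> (Str b) u = st0 u"
    using P unfolding pinv_def Let_def by blast+
  have rank: "rank ?q (?q p) = p" if "p < tp" for p
    unfolding rank_def
  proof (rule Least_equality)
    fix p' assume "?q p' = ?q p"
    then show "p \<le> p'"
      using P'(3) that by (metis inj_onD lessThan_iff linorder_le_less_linear order_less_trans order_refl)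
  qed simp
  have below: "u \<in> ?L \<and> rank ?q u < rank ?q (?q p)" if "u \<in> ?q ` {..<p}" "p < tp" for u p
    using that rank by auto
  have c: "c0 u \<le> card {i. i < m \<and> rl i \<and> sr i = u \<and> ds i \<in> ?L \<and> rank ?q (ds i) < rank ?q u}"
    if uL: "u \<in> ?L" for u
  proof -
    obtain p where p: "p < tp" "u = ?q p" using uL by auto
    have "card {i. i < m \<and> rl i \<and> sr i = ?q p \<and> ds i \<in> ?q ` {..<p}} \<le>
        card {i. i < m \<and> rl i \<and> sr i = u \<and> ds i \<in> ?L \<and> rank ?q (ds i) < rank ?q u}"
      unfolding p(2) by (intro card_mono) (use below[OF _ p(1)] in auto)
    then show ?thesis using P'(9) p by (meson le_trans)
  qed
  have s: "\<exists>i<m. rl i \<and> sr i = u \<and> ds i = \<alpha> (Str b) u \<and> ds i \<in> ?L \<and> rank ?q (ds i) < rank ?q u"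
    if u: "u \<in> ?L" "u \<notin> seeds" for u
  proof -
    obtain p where p: "p < tp" "u = ?q p" using u(1) by auto
    with P'(8) u(2) obtain i where "i < m" "rl i" "sr i = u" "ds i = \<alpha> (Str b) u" "ds i \<in> ?q ` {..<p}"
      by blast
    with below[of "ds i" p] p show ?thesis by blast
  qed
  show ?thesis
    unfolding peeled_def
  proof (intro conjI)
    show "\<forall>u \<in> ?L - seeds. 0 < c0 u \<and> \<alpha> (Str b) u \<in> ?L \<and> rank ?q (\<alpha> (Str b) u) < rank ?q u"
    proof
      fix u assume u: "u \<in> ?L - seeds"
      then have "u < N" using P'(5) by blast
      then have "0 < c0 u" using u P'(7) by blast
      then show "0 < c0 u \<and> \<alpha> (Str b) u \<in> ?L \<and> rank ?q (\<alpha> (Str b) u) < rank ?q u"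
        using s[of u] u by (metis DiffD1 DiffD2)
    qed
    show "\<forall>u<N. u \<notin> ?L \<and> 0 < c0 u \<longrightarrow> card {i. i < m \<and> rl i \<and> sr i = u \<and> ds i \<in> ?L} < c0 u"
    proof (intro allI impI)
      fix u assume u: "u < N" "u \<notin> ?L \<and> 0 < c0 u"
      have "{i \<in> {i. i < m \<and> rl i \<and> ds i \<in> ?L}. sr i = u} = {i. i < m \<and> rl i \<and> sr i = u \<and> ds i \<in> ?L}"
        by auto
      moreover have "\<not> c0 u \<le> card {i \<in> {i. i < m \<and> rl i \<and> ds i \<in> ?L}. sr i = u}"
        using P'(7) u by blast
      ultimately show "card {i. i < m \<and> rl i \<and> sr i = u \<and> ds i \<in> ?L} < c0 u" by simp
    qed
    show "\<forall>u<N. 0 < dg u m \<longrightarrow> (\<exists>i<m. rl i \<and> sr i = u \<and> ds i = \<alpha> (Str b) u)"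
    proof (intro allI impI)
      fix u assume u: "u < N" "0 < dg u m"
      show "\<exists>i<m. rl i \<and> sr i = u \<and> ds i = \<alpha> (Str b) u"
      proof (cases "u \<in> ?L \<and> u \<notin> seeds")
        case True
        then show ?thesis using s[of u] by blast
      next
        case False
        then have "\<alpha> (Str b) u = st0 u" using P'(10) u(1) by blast
        then show ?thesis using st0 u by simp
      qed
    qed
    show "\<forall>u \<in> ?L. c0 u \<le> card {i. i < m \<and> rl i \<and> sr i = u \<and> ds i \<in> ?L \<and>
        rank ?q (ds i) < rank ?q u}"
      by (intro ballI c)
  qed (fact P'(1,2,4,5,6))+
qed

lemma peel_correct:
  assumes "regs_ok \<rho>" and B: "binv N m (\<rho> 13) \<alpha>"
    and Q: "\<And>\<rho> \<alpha> k' L rk. regs_ok \<rho> \<Longrightarrow> peeled L rk \<alpha> \<Longrightarrow> k' \<le> k + 3 + 20 * (N + m) \<Longrightarrow> Q \<rho> \<alpha> k'"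
  shows "wp X w sz (peel b) Q \<rho> \<alpha> k"
proof -
  define st0 where "st0 = \<alpha> (Str b)"
  have st0: "\<forall>u<N. 0 < dg u m \<longrightarrow> (\<exists>i<m. rl i \<and> sr i = u \<and> ds i = st0 u)"
    using B by (simp add: binv_def st0_def)
  \<comment> \<open>These are the relevant arcs with head among the first \<open>hp\<close> queue
    entries. Every arc is on the list of one head only, and every head is queued at most once;
    charging 20 to each arc of this set and 12 to each entry amortises the nested loop.\<close>
  define A where "A \<alpha> hp = {i. i < m \<and> rl i \<and> ds i \<in> \<alpha> (Que b) ` {..<hp}}" for \<alpha> :: arrs and hp
  have A: "finite (A \<alpha> hp)" "card (A \<alpha> hp) \<le> m" for \<alpha> hp
    using card_mono[of "{..<m}" "A \<alpha> hp"] by (auto simp: A_def)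
  let ?I = "\<lambda>\<rho> \<alpha> k'. regs_ok \<rho> \<and> pinv st0 (\<rho> 14) (\<rho> 13) (A \<alpha> (\<rho> 14)) \<alpha> \<and>
    k' \<le> k + 1 + 12 * \<rho> 14 + 20 * card (A \<alpha> (\<rho> 14))"
  show ?thesis
    unfolding peel_def wp_Seq wp_Set_0
  proof (rule wp_While[where I = ?I and K = "k + 1 + 12 * N + 20 * m"])
    show "?I (\<rho>(14 := 0)) \<alpha> (k + 1)"
      using assms(1) pinv_init[OF B] by (simp add: regs_ok_def st0_def A_def)
  next
    fix \<rho> \<alpha> k' assume I: "?I \<rho> \<alpha> k'" and "\<not> holds X (Less 14 13) \<rho>"
    then have e: "\<rho> 14 = \<rho> 13" using pinv_facts(1)[of st0 "\<rho> 14" "\<rho> 13"] by fastforce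
    then have "peeled (\<alpha> (Que b) ` {..<\<rho> 13}) (rank (\<alpha> (Que b))) \<alpha>"
      using I pinv_final[OF _ st0] by (simp add: A_def)
    moreover have "\<rho> 14 \<le> N" using I pinv_facts(2) e by metis
    ultimately show "Q \<rho> \<alpha> (k' + 2)"
      using I A(2)[of \<alpha> "\<rho> 14"] by (intro Q) auto
  next
    fix \<rho> \<alpha> k' assume I: "?I \<rho> \<alpha> k'" and "holds X (Less 14 13) \<rho>"
    then have hp: "\<rho> 14 < \<rho> 13" by simp
    have r: "regs_ok \<rho>" and P: "pinv st0 (\<rho> 14) (\<rho> 13) (A \<alpha> (\<rho> 14)) \<alpha>"
      and k: "k' \<le> k + 1 + 12 * \<rho> 14 + 20 * card (A \<alpha> (\<rho> 14))"
      using I by auto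
    note f = pinv_facts[OF P]
    define hp where "hp = \<rho> 14"
    define u where "u = \<alpha> (Que b) hp"
    have u: "u < N" using f(3) hp by (simp add: u_def hp_def)
    \<comment> \<open>Register 8 runs down the list of arcs into \<open>u\<close>, so the relevant
      arcs into \<open>u\<close> below it are exactly those still to be processed.\<close>
    let ?J = "\<lambda>\<rho> \<alpha> k'. regs_ok \<rho> \<and> \<rho> 14 = Suc hp \<and> \<rho> 10 = u \<and> \<alpha> (Que b) hp = u \<and>
      pinv st0 (Suc hp) (\<rho> 13) (A \<alpha> (Suc hp) - {i. i < \<rho> 8 \<and> rl i \<and> ds i = u}) \<alpha> \<and>
      (\<rho> 8 = 0 \<or> \<rho> 8 \<le> m \<and> rl (\<rho> 8 - 1) \<and> ds (\<rho> 8 - 1) = u) \<and>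
      k' \<le> k + 9 + 12 * hp + 20 * card (A \<alpha> (Suc hp) - {i. i < \<rho> 8 \<and> rl i \<and> ds i = u})"
    have "k' \<le> k + 1 + 12 * N + 20 * m"
      using k A(2)[of \<alpha> "\<rho> 14"] f hp by simp
    moreover have "wp X w sz
       (While (Less 4 8)
          (Minus 8 8 5 ;; Get 7 (Src b) 8 ;; Get 11 (Cnt b) 7 ;;
           Cond (Less 4 11)
             (Minus 11 11 5 ;; Put (Cnt b) 7 11 ;;
              Cond (Equal 11 4) (Put (Str b) 7 10 ;; push b) Nop)
             Nop ;;
           Get 8 (Nxt b) 8)) ?I (\<rho>(10 := u, 14 := Suc hp, 8 := pv u m)) \<alpha> (Suc (Suc (Suc (Suc (Suc k')))))"
    proof (rule wp_While[where I = ?J and K = "k + 9 + 12 * N + 20 * m"])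
      have "A \<alpha> (Suc hp) - {i. i < pv u m \<and> rl i \<and> ds i = u} = A \<alpha> hp"
      proof -
        have "u \<notin> \<alpha> (Que b) ` {..<hp}"
        proof
          assume "u \<in> \<alpha> (Que b) ` {..<hp}"
          then obtain x where "x < hp" "\<alpha> (Que b) x = \<alpha> (Que b) hp" by (auto simp: u_def)
          then show False using inj_onD[OF f(4), of x hp] hp by (simp add: hp_def)
        qed
        then show ?thesis using pv_set by (auto simp: A_def less_Suc_eq u_def)
      qed
      moreover have "pv u m = 0 \<or> pv u m \<le> m \<and> rl (pv u m - 1) \<and> ds (pv u m - 1) = u"
        using pv_Suc[of u m] pv_le[of u m] by (cases "pv u m") auto
      ultimately show "?J (\<rho>(10 := u, 14 := Suc hp, 8 := pv u m)) \<alpha> (Suc (Suc (Suc (Suc (Suc k')))))"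
        using r k pinv_hp[OF P hp] by (simp add: regs_ok_def u_def hp_def)
    next
      fix \<rho> \<alpha> k' assume J: "?J \<rho> \<alpha> k'" and "\<not> holds X (Less 4 8) \<rho>"
      then have "\<rho> 8 = 0" by (simp add: regs_ok_def)
      with J show "?I \<rho> \<alpha> (k' + 2)" by simp
    next
      fix \<rho> \<alpha> k' assume J: "?J \<rho> \<alpha> k'" and "holds X (Less 4 8) \<rho>"
      then obtain i where i: "\<rho> 8 = Suc i" "i < m" "rl i" "ds i = u"
        by (cases "\<rho> 8") (auto simp: regs_ok_def)
      define D where "D = A \<alpha> (Suc hp) - {i. i < \<rho> 8 \<and> rl i \<and> ds i = u}"
      have r: "\<rho> 2 = N" "\<rho> 3 = m" "\<rho> 4 = 0" "\<rho> 5 = 1" "\<rho> 6 = 2" "\<rho> 14 = Suc hp" "\<rho> 10 = u"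
        and P: "pinv st0 (Suc hp) (\<rho> 13) D \<alpha>" and k: "k' \<le> k + 9 + 12 * hp + 20 * card D"
        and q: "\<alpha> (Que b) hp = u"
        using J by (auto simp: regs_ok_def D_def)
      note f = pinv_facts[OF P]
      have K: "k' \<le> k + 9 + 12 * N + 20 * m" using k f(1,2,10) by simp
      have iD: "i \<notin> D" "ds i \<in> \<alpha> (Que b) ` {..<Suc hp}"
        using i q by (simp add: D_def, metis imageI lessI lessThan_iff)
      have D': "A \<alpha> (Suc hp) - {j. j < pv u i \<and> rl j \<and> ds j = u} = insert i D"
        using pv_set[of _ i u] pv_le[of u i] i q iD(2)
        by (auto simp: D_def A_def less_Suc_eq)
      have card: "card (insert i D) = Suc (card D)" using iD f(9) by simp
      have nx: "pv u i = 0 \<or> pv u i \<le> m \<and> rl (pv u i - Suc 0) \<and> ds (pv u i - Suc 0) = u"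
        using pv_Suc[of u i] pv_le[of u i] i by (cases "pv u i") auto
      have get: "\<alpha> (Src b) i = sr i" "\<alpha> (Nxt b) i = pv u i" "sr i < N"
        using f(5,6) i sr_less by auto
      \<comment> \<open>The new entry goes to index \<open>\<rho> 13\<close>, behind the first
        \<open>Suc hp\<close> entries.\<close>
      have Que: "A (\<alpha>(Cnt b := x, Str b := y, Lab b := z, Que b := (\<alpha> (Que b))(\<rho> 13 := v))) (Suc hp) =
          A \<alpha> (Suc hp)" for x y z v
      proof -
        have "(\<alpha> (Que b))(\<rho> 13 := v) ` {..<Suc hp} = \<alpha> (Que b) ` {..<Suc hp}"
          using f(1) by (intro image_cong) auto
        then show ?thesis by (simp add: A_def del: fun_upd_apply) (simp add: A_def)
      qed
      note ws = w_ge sz_work[of b]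
      consider "\<alpha> (Cnt b) (sr i) = 0" | "\<alpha> (Cnt b) (sr i) = 1" | "1 < \<alpha> (Cnt b) (sr i)"
        by linarith
      then have "wp X w sz
          (Minus 8 8 5 ;; Get 7 (Src b) 8 ;; Get 11 (Cnt b) 7 ;;
           Cond (Less 4 11)
             (Minus 11 11 5 ;; Put (Cnt b) 7 11 ;;
              Cond (Equal 11 4) (Put (Str b) 7 10 ;; push b) Nop)
             Nop ;;
           Get 8 (Nxt b) 8) ?J \<rho> \<alpha> (k' + 2)"
      proof cases
        case 1
        then show ?thesis
          using pinv_skip[OF P i(2,3) iD refl refl 1] k ws get i f
          by (simp add: wp_Seq wp_Cond wp_simps regs_ok_def r D' nx card q)
      next
        case 2
        note l = pinv_label[OF P i(2,3) iD refl refl 2]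
        have hp: "hp \<noteq> \<rho> 13" "hp < \<rho> 13" using f(1) by auto
        show ?thesis
          using l k ws get i f 2 hp
          by (simp add: wp_Seq wp_Cond wp_simps regs_ok_def r push_def nx q Que D' card)
      next
        case 3
        have "A (\<alpha>(Cnt b := x)) (Suc hp) = A \<alpha> (Suc hp)" for x by (simp add: A_def)
        then show ?thesis
          using pinv_dec[OF P i(2,3) iD refl refl 3] k ws get i f 3
          by (simp add: wp_Seq wp_Cond wp_simps regs_ok_def r D' nx card q)
      qed
      with K show "k' \<le> k + 9 + 12 * N + 20 * m \<and> wp X w sz
          (Minus 8 8 5 ;; Get 7 (Src b) 8 ;; Get 11 (Cnt b) 7 ;;
           Cond (Less 4 11)
             (Minus 11 11 5 ;; Put (Cnt b) 7 11 ;;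
              Cond (Equal 11 4) (Put (Str b) 7 10 ;; push b) Nop)
             Nop ;;
           Get 8 (Nxt b) 8) ?J \<rho> \<alpha> (k' + 2)" by simp
    qed
    ultimately show "k' \<le> k + 1 + 12 * N + 20 * m \<and> wp X w sz
       (Get 10 (Que b) 14 ;; Plus 14 14 5 ;; Get 8 (Hd b) 10 ;;
        While (Less 4 8)
          (Minus 8 8 5 ;; Get 7 (Src b) 8 ;; Get 11 (Cnt b) 7 ;;
           Cond (Less 4 11)
             (Minus 11 11 5 ;; Put (Cnt b) 7 11 ;;
              Cond (Equal 11 4) (Put (Str b) 7 10 ;; push b) Nop)
             Nop ;;
           Get 8 (Nxt b) 8)) ?I \<rho> \<alpha> (k' + 2)"
      using hp f(1,2,7) u r w_ge sz_work[of b]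
      by (simp add: wp_Seq wp_simps regs_ok_def u_def hp_def)
  qed
qed

end

section \<open>Solutions from attractors\<close>

context peeling begin

lemma escape_correct:
  assumes "regs_ok \<rho>" "input_ok \<alpha>" "lists_ok \<alpha>"
    and Lab: "\<forall>u<N. \<alpha> (Lab b) u = (if u \<in> L then 1 else 0)"
    and Q: "\<And>\<rho> s k'. regs_ok \<rho> \<Longrightarrow>
      \<forall>u<N. (if u \<notin> L \<and> (\<exists>i<m. sr i = u \<and> ds i \<notin> L) then \<exists>i<m. sr i = u \<and> ds i = s u \<and> ds i \<notin> L
              else s u = \<alpha> (Str b) u) \<Longrightarrow>
      k' \<le> k + 3 + 20 * m \<Longrightarrow> Q \<rho> (\<alpha>(Str b := s)) k'"
  shows "wp X w sz (escape b) Q \<rho> \<alpha> k"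
proof -
  define J where "J e s \<longleftrightarrow> (\<forall>u<N. (if u \<notin> L \<and> (\<exists>i<e. sr i = u \<and> ds i \<notin> L)
      then \<exists>i<m. sr i = u \<and> ds i = s u \<and> ds i \<notin> L else s u = \<alpha> (Str b) u))" for e s
  let ?I = "\<lambda>\<rho> \<beta> k'. regs_ok \<rho> \<and> \<rho> 8 \<le> m \<and> \<beta> = \<alpha>(Str b := \<beta> (Str b)) \<and> J (\<rho> 8) (\<beta> (Str b)) \<and> k' \<le> k + 1 + 20 * \<rho> 8"
  show ?thesis
    unfolding escape_def wp_Seq wp_Set_0
  proof (rule wp_While[where I = ?I and K = "k + 1 + 20 * m"])
    show "?I (\<rho>(8 := 0)) \<alpha> (k + 1)"
      using assms(1) by (auto simp: regs_ok_def J_def)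
  next
    fix \<rho> \<beta> k' assume I: "?I \<rho> \<beta> k'" "\<not> holds X (Less 8 3) \<rho>"
    then have e: "\<rho> 8 = m" by (simp add: regs_ok_def)
    obtain s where "\<beta> = \<alpha>(Str b := s)" "J m s" using I e by metis
    then show "Q \<rho> \<beta> (k' + 2)" using I e Q[of \<rho> s "k' + 2"] by (simp add: J_def)
  next
    fix \<rho> \<beta> k' assume I: "?I \<rho> \<beta> k'" "holds X (Less 8 3) \<rho>"
    then have e: "\<rho> 8 < m" by (simp add: regs_ok_def)
    have r: "\<rho> 2 = N" "\<rho> 3 = m" "\<rho> 4 = 0" "\<rho> 5 = 1" "\<rho> 6 = 2" and k: "k' \<le> k + 1 + 20 * \<rho> 8"
      using I by (auto simp: regs_ok_def)
    obtain s where s: "\<beta> = \<alpha>(Str b := s)" "J (\<rho> 8) s" using I by metis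
    have get: "\<alpha> (Src b) (\<rho> 8) = sr (\<rho> 8)" "\<alpha> Heads (\<rho> 8) = ds (\<rho> 8)"
        "\<alpha> (Lab b) (sr (\<rho> 8)) = (if sr (\<rho> 8) \<in> L then 1 else 0)"
        "\<alpha> (Lab b) (ds (\<rho> 8)) = (if ds (\<rho> 8) \<in> L then 1 else 0)"
      using assms(2,3) e Lab sr_less[OF e] ds_less[OF e] by (auto simp: input_ok_def lists_ok_def)
    have J1: "J (Suc (\<rho> 8)) (s(sr (\<rho> 8) := ds (\<rho> 8)))" if "sr (\<rho> 8) \<notin> L" "ds (\<rho> 8) \<notin> L"
      unfolding J_def
    proof (intro allI impI)
      fix u assume u: "u < N"
      show "if u \<notin> L \<and> (\<exists>i<Suc (\<rho> 8). sr i = u \<and> ds i \<notin> L)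
        then \<exists>i<m. sr i = u \<and> ds i = (s(sr (\<rho> 8) := ds (\<rho> 8))) u \<and> ds i \<notin> L
        else (s(sr (\<rho> 8) := ds (\<rho> 8))) u = \<alpha> (Str b) u"
      proof (cases "u = sr (\<rho> 8)")
        case True
        then show ?thesis using that e by auto
      next
        case False
        then have "(\<exists>i<Suc (\<rho> 8). sr i = u \<and> ds i \<notin> L) \<longleftrightarrow> (\<exists>i<\<rho> 8. sr i = u \<and> ds i \<notin> L)"
          by (auto simp: less_Suc_eq)
        with False show ?thesis using s(2) u by (simp add: J_def)
      qed
    qed
    have J2: "J (Suc (\<rho> 8)) s" if "sr (\<rho> 8) \<in> L \<or> ds (\<rho> 8) \<in> L"
    proof -
      have "u \<notin> L \<and> (\<exists>i<Suc (\<rho> 8). sr i = u \<and> ds i \<notin> L) \<longleftrightarrow> u \<notin> L \<and> (\<exists>i<\<rho> 8. sr i = u \<and> ds i \<notin> L)" for u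
        using that by (auto simp: less_Suc_eq)
      then show ?thesis using s(2) by (simp add: J_def)
    qed
    show "k' \<le> k + 1 + 20 * m \<and> wp X w sz
       (Get 7 (Src b) 8 ;; Get 10 Heads 8 ;; Get 11 (Lab b) 7 ;;
        Cond (Equal 11 4)
          (Get 11 (Lab b) 10 ;; Cond (Equal 11 4) (Put (Str b) 7 10) Nop)
          Nop ;;
        Plus 8 8 5) ?I \<rho> \<beta> (k' + 2)"
      using e k w_ge sz_in sz_work[of b] sr_less[OF e] ds_less[OF e] J1 J2
      by (auto simp: wp_Seq wp_Cond wp_simps r get s(1) regs_ok_def)
  qed
qed

text \<open>This keeps of \<open>peeled\<close> what concerns the strategy and forgets the other
  arrays, so that it can also be stated after \<open>escape\<close> has changed the choices.\<close>

definition solved :: "nat set \<Rightarrow> (nat \<Rightarrow> nat) \<Rightarrow> (nat \<Rightarrow> nat) \<Rightarrow> bool" where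
  "solved L rk s \<longleftrightarrow> seeds \<subseteq> L \<and> L \<subseteq> {..<N} \<and>
     (\<forall>u \<in> L - seeds. 0 < c0 u \<and> s u \<in> L \<and> rk (s u) < rk u) \<and>
     (\<forall>u \<in> L. c0 u \<le> card {i. i < m \<and> rl i \<and> sr i = u \<and> ds i \<in> L \<and> rk (ds i) < rk u}) \<and>
     (\<forall>u<N. u \<notin> L \<and> 0 < c0 u \<longrightarrow> card {i. i < m \<and> rl i \<and> sr i = u \<and> ds i \<in> L} < c0 u) \<and>
     (\<forall>u<N. 0 < dg u m \<longrightarrow> (\<exists>i<m. rl i \<and> sr i = u \<and> ds i = s u))"

lemma peeled_solved: "peeled L rk \<alpha> \<Longrightarrow> solved L rk (\<alpha> (Str b))"
  by (simp add: peeled_def solved_def)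

text \<open>\<open>escape\<close> goes through all arcs without testing relevance, so it is combined
  only with the relation that makes every arc relevant. Choices inside \<open>L\<close> remain
  untouched.\<close>

lemma escape_solved:
  assumes s0: "solved L rk s0" and R: "\<And>x y. R x y"
    and s: "\<forall>u<N. (if u \<notin> L \<and> (\<exists>i<m. sr i = u \<and> ds i \<notin> L) then \<exists>i<m. sr i = u \<and> ds i = s u \<and> ds i \<notin> L
              else s u = s0 u)"
  shows "solved L rk s" "\<And>i. i < m \<Longrightarrow> sr i \<notin> L \<Longrightarrow> ds i \<notin> L \<Longrightarrow> s (sr i) \<notin> L"
proof -
  have rl: "rl i" for i using R by (simp add: rl_def)
  have eq: "s u = s0 u" if "u \<in> L" for u
    using s s0 that by (auto simp: solved_def)
  have arc: "\<exists>i<m. rl i \<and> sr i = u \<and> ds i = s u" if "u < N" "0 < dg u m" for u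
    using s s0 that rl unfolding solved_def by metis
  show "solved L rk s"
    using s0 eq arc by (simp add: solved_def)
  show "s (sr i) \<notin> L" if "i < m" "sr i \<notin> L" "ds i \<notin> L" for i
    using s sr_less that by metis
qed

text \<open>The counting conditions become quantifiers. If at least as many arcs as there are have a
  property, all have it; fewer than one means none; fewer than all means that some arc leads
  outside.\<close>

lemma solvedD:
  assumes "solved L rk s"
  shows "seeds \<subseteq> L" "L \<subseteq> {..<N}" "\<And>u. u \<in> L \<Longrightarrow> u \<notin> seeds \<Longrightarrow> 0 < c0 u \<and> s u \<in> L \<and> rk (s u) < rk u"
    "\<And>i. i < m \<Longrightarrow> rl i \<Longrightarrow> sr i \<in> L \<Longrightarrow> c0 (sr i) = dg (sr i) m \<Longrightarrow> ds i \<in> L \<and> rk (ds i) < rk (sr i)"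
    "\<And>i. i < m \<Longrightarrow> rl i \<Longrightarrow> sr i \<notin> L \<Longrightarrow> c0 (sr i) = 1 \<Longrightarrow> ds i \<notin> L"
    "\<And>u. u < N \<Longrightarrow> u \<notin> L \<Longrightarrow> 0 < c0 u \<Longrightarrow> c0 u = dg u m \<Longrightarrow> \<exists>i<m. rl i \<and> sr i = u \<and> ds i \<notin> L"
    "\<And>u. u < N \<Longrightarrow> 0 < dg u m \<Longrightarrow> \<exists>i<m. rl i \<and> sr i = u \<and> ds i = s u"
proof -
  show "seeds \<subseteq> L" "L \<subseteq> {..<N}" "\<And>u. u \<in> L \<Longrightarrow> u \<notin> seeds \<Longrightarrow> 0 < c0 u \<and> s u \<in> L \<and> rk (s u) < rk u"
    "\<And>u. u < N \<Longrightarrow> 0 < dg u m \<Longrightarrow> \<exists>i<m. rl i \<and> sr i = u \<and> ds i = s u"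
    using assms by (auto simp: solved_def)
  fix i assume i: "i < m" "rl i"
  let ?A = "{j. j < m \<and> rl j \<and> sr j = sr i}"
  {
    assume "sr i \<in> L" "c0 (sr i) = dg (sr i) m"
    let ?B = "{j. j < m \<and> rl j \<and> sr j = sr i \<and> ds j \<in> L \<and> rk (ds j) < rk (sr i)}"
    have "card ?A \<le> card ?B"
      using assms \<open>sr i \<in> L\<close> \<open>c0 (sr i) = dg (sr i) m\<close> by (auto simp: solved_def dg_def)
    moreover have "?B \<subseteq> ?A" by auto
    ultimately have "?B = ?A" by (intro card_seteq) auto
    then show "ds i \<in> L \<and> rk (ds i) < rk (sr i)" using i by blast
  next
    assume "sr i \<notin> L" "c0 (sr i) = 1"
    then have "card {j. j < m \<and> rl j \<and> sr j = sr i \<and> ds j \<in> L} = 0"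
      using assms sr_less[OF i(1)] by (auto simp: solved_def)
    then show "ds i \<notin> L" using i by auto
  }
next
  fix u assume u: "u < N" "u \<notin> L" "0 < c0 u" "c0 u = dg u m"
  show "\<exists>i<m. rl i \<and> sr i = u \<and> ds i \<notin> L"
  proof (rule ccontr)
    assume "\<not> ?thesis"
    then have "{i. i < m \<and> rl i \<and> sr i = u \<and> ds i \<in> L} = {i. i < m \<and> rl i \<and> sr i = u}" by auto
    then show False using assms u by (auto simp: solved_def dg_def)
  qed
qed

lemma dg_pos: "i < m \<Longrightarrow> rl i \<Longrightarrow> 0 < dg (sr i) m"
  by (auto simp: dg_def card_gt_0_iff)

lemma solved_attracts:
  assumes s: "solved L rk s" and R: "\<And>x y. R x y"
    and esc: "\<And>i. i < m \<Longrightarrow> sr i \<notin> L \<Longrightarrow> ds i \<notin> L \<Longrightarrow> s (sr i) \<notin> L"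
    and arcs: "\<And>v u. (v, u) \<in> arcs G \<longleftrightarrow> (\<exists>i<m. sr i = v \<and> ds i = u)"
    and A: "A = {v. v < N \<and> own v \<noteq> 2 \<and> on v}" and B: "B = {v. v < N \<and> own v \<noteq> 2 \<and> \<not> on v}"
    and ex: "\<And>v. v \<in> A \<union> B \<Longrightarrow> \<exists>u. (v, u) \<in> arcs G"
  shows "attracts G A B seeds L rk s"
proof -
  note d = solvedD[OF s]
  have rl: "rl i" for i using R by (simp add: rl_def)
  have pos: "0 < dg v m" if "v \<in> A \<union> B" for v
    using ex[OF that] dg_pos rl by (auto simp: arcs)
  have cA: "c0 v = 1" if "v \<in> A" for v using that by (simp add: A c0_def)
  have cB: "c0 v = dg v m" if "v \<in> B" for v using that by (simp add: B c0_def)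
  have sAB: "v \<notin> seeds" "v < N" if "v \<in> A \<union> B" for v using that by (auto simp: A B seeds_def)
  show ?thesis
    unfolding attracts_def
  proof (intro conjI)
    show "seeds \<subseteq> L" by (rule d(1))
    show "L \<subseteq> seeds \<union> A \<union> B"
    proof
      fix u assume u: "u \<in> L"
      show "u \<in> seeds \<union> A \<union> B"
      proof (cases "u \<in> seeds")
        case False
        then have "0 < c0 u" "u < N" using d(2,3) u by auto
        then show ?thesis by (auto simp: A B c0_def split: if_splits)
      qed simp
    qed
    show "\<forall>v \<in> A \<union> B. (v, s v) \<in> arcs G"
      using d(7)[OF sAB(2) pos] unfolding arcs by blast
    show "\<forall>v \<in> A \<inter> L. s v \<in> L \<and> rk (s v) < rk v"
      using d(3) sAB by blast
    show "\<forall>v \<in> B \<inter> L. \<forall>u. (v, u) \<in> arcs G \<longrightarrow> u \<in> L \<and> rk u < rk v"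
      using d(4) rl cB unfolding arcs by auto
    show "\<forall>v \<in> A - L. \<forall>u. (v, u) \<in> arcs G \<longrightarrow> u \<notin> L"
      using d(5) rl cA unfolding arcs by auto
    show "\<forall>v \<in> B - L. s v \<notin> L"
    proof
      fix v assume v: "v \<in> B - L"
      then obtain i where "i < m" "sr i = v" "ds i \<notin> L"
        using d(6)[of v] sAB[of v] cB[of v] pos[of v] by auto
      then show "s v \<notin> L" using esc v by blast
    qed
  qed
qed

text \<open>At positive values Max attracts and Min is forced; at negative values it is the reverse,
  which is the same condition in the dual game. At value 0 neither attracts. This is why one run of
  the peeling serves both players.\<close>

lemma solved_level_attracts:
  assumes s: "solved L rk s" and G: "simple_recursive_game G"
    and R: "\<And>x y. x < N \<Longrightarrow> y < N \<Longrightarrow> R x y \<longleftrightarrow> Val G x = Val G y"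
    and arcs: "\<And>v u. (v, u) \<in> arcs G \<longleftrightarrow> (\<exists>i<m. sr i = v \<and> ds i = u)"
    and T: "terminals G \<subseteq> seeds"
    and max: "\<And>v. v \<in> V_max G \<Longrightarrow> v < N \<and> own v \<noteq> 2 \<and> (on v \<longleftrightarrow> 0 < Val G v)"
    and min: "\<And>v. v \<in> V_min G \<Longrightarrow> v < N \<and> own v \<noteq> 2 \<and> (on v \<longleftrightarrow> Val G v < 0)"
  shows "level_attracts G L rk s" "level_attracts (dual G) L rk s"
proof -
  note d = solvedD[OF s]
  have rl: "i < m \<Longrightarrow> rl i \<longleftrightarrow> Val G (sr i) = Val G (ds i)" for i
    using R sr_less ds_less by (simp add: rl_def)
  have nt: "v < N" "own v \<noteq> 2" "v \<notin> seeds" if "v \<in> V_min G \<union> V_max G" for v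
    using that max min by (auto simp: seeds_def)
  \<comment> \<open>By the optimality equations every non-terminal has an arc to a position of equal
    value, so no non-terminal starts with counter 0 and each has a recorded move of equal
    value.\<close>
  have pos: "0 < dg v m" if v: "v \<in> V_min G \<union> V_max G" for v
  proof -
    obtain u where "(v, u) \<in> arcs G" "Val G u = Val G v"
      using v Val_max(2)[OF G, of v] Val_min_eq[OF G, of v] by auto
    then obtain i where "i < m" "sr i = v" "rl i" using arcs rl by force
    then show ?thesis using dg_pos by blast
  qed
  have arc: "(v, s v) \<in> arcs G \<and> Val G (s v) = Val G v" if v: "v \<in> V_min G \<union> V_max G" for v
  proof -
    obtain i where "i < m" "rl i" "sr i = v" "ds i = s v" using d(7) nt(1)[OF v] pos[OF v] by blast
    then show ?thesis using arcs rl by force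
  qed
  have mover: "v \<in> L \<longrightarrow> rk (s v) < rk v"
      "v \<notin> L \<longrightarrow> (\<forall>u. (v, u) \<in> arcs G \<and> Val G u = Val G v \<longrightarrow> u \<notin> L)"
    if v: "v \<in> V_min G \<union> V_max G" "on v" for v
  proof -
    have c: "c0 v = 1" using nt[OF v(1)] v(2) by (simp add: c0_def)
    show "v \<in> L \<longrightarrow> rk (s v) < rk v" using d(3) nt(3)[OF v(1)] by blast
    show "v \<notin> L \<longrightarrow> (\<forall>u. (v, u) \<in> arcs G \<and> Val G u = Val G v \<longrightarrow> u \<notin> L)"
      using d(5) c rl unfolding arcs by auto
  qed
  have other: "v \<in> L \<longrightarrow> (\<forall>u. (v, u) \<in> arcs G \<and> Val G u = Val G v \<longrightarrow> rk u < rk v)"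
      "v \<notin> L \<longrightarrow> (\<exists>u. (v, u) \<in> arcs G \<and> Val G u = Val G v \<and> u \<notin> L)"
    if v: "v \<in> V_min G \<union> V_max G" "\<not> on v" for v
  proof -
    have c: "c0 v = dg v m" using nt[OF v(1)] v(2) by (simp add: c0_def)
    show "v \<in> L \<longrightarrow> (\<forall>u. (v, u) \<in> arcs G \<and> Val G u = Val G v \<longrightarrow> rk u < rk v)"
      using d(4) c rl unfolding arcs by auto
    show "v \<notin> L \<longrightarrow> (\<exists>u. (v, u) \<in> arcs G \<and> Val G u = Val G v \<and> u \<notin> L)"
    proof
      assume "v \<notin> L"
      then obtain i where "i < m" "rl i" "sr i = v" "ds i \<notin> L"
        using d(6)[of v] c pos[OF v(1)] nt(1)[OF v(1)] by auto
      then show "\<exists>u. (v, u) \<in> arcs G \<and> Val G u = Val G v \<and> u \<notin> L"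
        using rl[of i] arcs[of v "ds i"] by auto
    qed
  qed
  have TL: "terminals G \<subseteq> L" using T d(1) by blast
  note M = max[THEN conjunct2, THEN conjunct2] and N = min[THEN conjunct2, THEN conjunct2]
  have on: "v \<in> V_max G \<Longrightarrow> 0 < Val G v \<Longrightarrow> on v" "v \<in> V_min G \<Longrightarrow> Val G v < 0 \<Longrightarrow> on v"
    "v \<in> V_min G \<Longrightarrow> 0 < Val G v \<Longrightarrow> \<not> on v" "v \<in> V_max G \<Longrightarrow> Val G v < 0 \<Longrightarrow> \<not> on v" for v
    using M[of v] N[of v] by auto
  show "level_attracts G L rk s"
    unfolding level_attracts_def
    using TL arc mover[OF UnI2 on(1)] other[OF UnI1 on(3)] by blast
  show "level_attracts (dual G) L rk s"
    unfolding level_attracts_def Val_dual[OF G] dual_simps neg_equal_iff_equal neg_0_less_iff_less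
    using TL arc mover[OF UnI1 on(2)] other[OF UnI2 on(4)] by blast
qed

end

section \<open>Frame property and the two complete algorithms\<close>

fun writes :: "com \<Rightarrow> arr set" where
  "writes (Put A a r) = {A}"
| "writes (c ;; d) = writes c \<union> writes d"
| "writes (Cond b c d) = writes c \<union> writes d"
| "writes (While b c) = writes c"
| "writes _ = {}"

lemma big_frame: "big X w sz c \<rho> \<alpha> t \<rho>' \<alpha>' \<Longrightarrow> A \<notin> writes c \<Longrightarrow> \<alpha>' A = \<alpha> A"
  by (induction rule: big.induct) auto

text \<open>This permits running two attractor computations in sequence: the second finds its arrays
  still cleared, and the result of the first survives it.\<close>

lemma wp_frame:
  assumes "wp X w sz c Q \<rho> \<alpha> k"
    and "\<And>\<rho>' \<alpha>' k'. Q \<rho>' \<alpha>' k' \<Longrightarrow> (\<And>A. A \<notin> writes c \<Longrightarrow> \<alpha>' A = \<alpha> A) \<Longrightarrow> Q' \<rho>' \<alpha>' k'"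
  shows "wp X w sz c Q' \<rho> \<alpha> k"
  using assms big_frame unfolding wp_def by metis

definition half :: "(com \<Rightarrow> com) \<Rightarrow> (com \<Rightarrow> com) \<Rightarrow> bool \<Rightarrow> com" where
  "half seedt onet b = build (\<lambda>c. c) seedt onet b ;; peel b ;; escape b"

text \<open>Register 2 also is the index of the given value in the store of a weak instance. If the value is
  positive, Max has to reach the terminals that pay at least that much; otherwise he has to keep Min
  from reaching those that pay less. The roles are exchanged for Min.\<close>

definition max_seed :: "com \<Rightarrow> com" where
  "max_seed c = Cond (NPos 2) (Cond (NLess 7 2) Nop c) (Cond (NLess 7 2) c Nop)"

definition max_one :: "com \<Rightarrow> com" where
  "max_one c = Cond (NPos 2) (Cond (Equal 15 5) c Nop) (Cond (Equal 15 4) c Nop)"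

definition min_seed :: "com \<Rightarrow> com" where
  "min_seed c = Cond (NNeg 2) (Cond (NLess 2 7) Nop c) (Cond (NLess 2 7) c Nop)"

definition min_one :: "com \<Rightarrow> com" where
  "min_one c = Cond (NNeg 2) (Cond (Equal 15 4) c Nop) (Cond (Equal 15 5) c Nop)"

definition weak_com :: com where
  "weak_com = half max_seed max_one True ;; half min_seed min_one False"

text \<open>Equality of real numbers is no primitive test, so it is decided by two strict
  comparisons.\<close>

definition level_rel :: "com \<Rightarrow> com" where
  "level_rel c = Plus 16 2 7 ;; Plus 17 2 10 ;; Cond (NLess 16 17) Nop (Cond (NLess 17 16) Nop c)"

definition level_one :: "com \<Rightarrow> com" where
  "level_one c = Plus 16 2 7 ;;
     Cond (Equal 15 5) (Cond (NPos 16) c Nop) (Cond (NNeg 16) c Nop)"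

text \<open>No \<open>escape\<close> follows, because \<open>level_attracts\<close> asks of the
  choices outside \<open>L\<close> only that they keep the value. The final loop writes the indices
  \<open>N + v\<close> of the values into \<open>Src False\<close>, an array of the second set,
  which is free as only one attractor is computed.\<close>

definition strong_com :: com where
  "strong_com = build level_rel (\<lambda>c. c) level_one True ;; peel True ;;
     Set 7 0 ;; While (Less 7 2) (Plus 16 2 7 ;; Put (Src False) 7 16 ;; Plus 7 7 5)"

lemma writes_half:
  "A \<in> writes (half max_seed max_one b) \<or> A \<in> writes (half min_seed min_one b) \<Longrightarrow>
     A \<in> {Src b, Nxt b, Hd b, Cnt b, Str b, Lab b, Que b}"
  by (auto simp: half_def build_def peel_def escape_def link_def push_def
      max_seed_def max_one_def min_seed_def min_one_def)

lemma weak_com_regs: "com_regs weak_com \<subseteq> {..<40}"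
  by (simp add: weak_com_def half_def build_def peel_def escape_def link_def push_def
      max_seed_def max_one_def min_seed_def min_one_def)

lemma strong_com_regs: "com_regs strong_com \<subseteq> {..<40}"
  by (simp add: strong_com_def build_def peel_def link_def push_def level_rel_def level_one_def)

lemma (in arena) guards_trivial: "guards pre (\<lambda>_. True) (\<lambda>c. c)"
  by (simp add: guards_def)

lemma (in arena) guards_max_seed:
  "guards pre (\<lambda>\<rho>. if X N > 0 then \<not> X (\<rho> 7) < X N else X (\<rho> 7) < X N) max_seed"
  by (auto simp: guards_def max_seed_def wp_Cond wp_simps regs_ok_def)

lemma (in arena) guards_max_one:
  "guards (\<lambda>\<rho>. \<rho> 7 < N \<and> \<rho> 15 = own (\<rho> 7) \<and> \<rho> 15 \<noteq> 2)
     (\<lambda>\<rho>. own (\<rho> 7) = (if X N > 0 then 1 else 0)) max_one"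
  by (auto simp: guards_def max_one_def wp_Cond wp_simps regs_ok_def)

lemma (in arena) guards_min_seed:
  "guards pre (\<lambda>\<rho>. if X N < 0 then \<not> X N < X (\<rho> 7) else X N < X (\<rho> 7)) min_seed"
  by (auto simp: guards_def min_seed_def wp_Cond wp_simps regs_ok_def)

lemma (in arena) guards_min_one:
  "guards (\<lambda>\<rho>. \<rho> 7 < N \<and> \<rho> 15 = own (\<rho> 7) \<and> \<rho> 15 \<noteq> 2)
     (\<lambda>\<rho>. own (\<rho> 7) = (if X N < 0 then 0 else 1)) min_one"
  by (auto simp: guards_def min_one_def wp_Cond wp_simps regs_ok_def)

lemma (in arena) guards_level_rel:
  "guards (\<lambda>\<rho>. \<rho> 7 < N \<and> \<rho> 10 < N) (\<lambda>\<rho>. X (N + \<rho> 7) = X (N + \<rho> 10)) level_rel"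
  unfolding guards_def level_rel_def using w_ge
  by (auto simp: wp_Seq wp_Cond wp_simps regs_ok_def)

lemma (in arena) guards_level_one:
  "guards (\<lambda>\<rho>. \<rho> 7 < N \<and> \<rho> 15 = own (\<rho> 7) \<and> \<rho> 15 \<noteq> 2)
     (\<lambda>\<rho>. if own (\<rho> 7) = 1 then X (N + \<rho> 7) > 0 else X (N + \<rho> 7) < 0) level_one"
  unfolding guards_def level_one_def using w_ge
  by (auto simp: wp_Seq wp_Cond wp_simps regs_ok_def)

definition (in arena) zeroed :: "bool \<Rightarrow> arrs \<Rightarrow> bool" where
  "zeroed b \<alpha> \<longleftrightarrow> (\<forall>u<N. \<alpha> (Hd b) u = 0 \<and> \<alpha> (Cnt b) u = 0 \<and> \<alpha> (Lab b) u = 0)"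

lemma (in peeling) half_correct:
  assumes R: "R = (\<lambda>_ _. True)"
    and seedt: "guards (\<lambda>\<rho>. \<rho> 7 < N \<and> own (\<rho> 7) = 2) (\<lambda>\<rho>. sd (\<rho> 7)) seedt"
    and onet: "guards (\<lambda>\<rho>. \<rho> 7 < N \<and> \<rho> 15 = own (\<rho> 7) \<and> \<rho> 15 \<noteq> 2) (\<lambda>\<rho>. on (\<rho> 7)) onet"
    and "regs_ok \<rho>" "input_ok \<alpha>" "zeroed b \<alpha>"
    and Q: "\<And>\<rho> \<alpha> k' L rk. regs_ok \<rho> \<Longrightarrow> input_ok \<alpha> \<Longrightarrow> solved L rk (\<alpha> (Str b)) \<Longrightarrow>
      (\<And>i. i < m \<Longrightarrow> sr i \<notin> L \<Longrightarrow> ds i \<notin> L \<Longrightarrow> \<alpha> (Str b) (sr i) \<notin> L) \<Longrightarrow>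
      k' \<le> k + 11 + 80 * (N + m) \<Longrightarrow> Q \<rho> \<alpha> k'"
  shows "wp X w sz (half seedt onet b) Q \<rho> \<alpha> k"
  unfolding half_def wp_Seq
proof (rule build_correct)
  show "guards (\<lambda>\<rho>. \<rho> 7 < N \<and> \<rho> 10 < N) (\<lambda>\<rho>. R (\<rho> 7) (\<rho> 10)) (\<lambda>c. c)"
    using guards_trivial by (simp add: R)
  show "\<forall>u<N. \<alpha> (Hd b) u = 0 \<and> \<alpha> (Cnt b) u = 0 \<and> \<alpha> (Lab b) u = 0"
    using assms(6) by (simp add: zeroed_def)
  fix \<rho> \<alpha> k' assume 1: "regs_ok \<rho>" "binv N m (\<rho> 13) \<alpha>" "k' \<le> k + 5 + 40 * (N + m)"
  show "wp X w sz (peel b) (wp X w sz (escape b) Q) \<rho> \<alpha> k'"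
  proof (rule peel_correct[OF 1(1,2)])
    fix \<rho> \<alpha> k'' L rk assume 2: "regs_ok \<rho>" "peeled L rk \<alpha>" "k'' \<le> k' + 3 + 20 * (N + m)"
    show "wp X w sz (escape b) Q \<rho> \<alpha> k''"
    proof (rule escape_correct[OF 2(1)])
      show "input_ok \<alpha>" "lists_ok \<alpha>" "\<forall>u<N. \<alpha> (Lab b) u = (if u \<in> L then 1 else 0)"
        using 2(2) by (simp_all add: peeled_def)
      fix \<rho> s k3
      assume 3: "regs_ok \<rho>" "\<forall>u<N. (if u \<notin> L \<and> (\<exists>i<m. sr i = u \<and> ds i \<notin> L)
          then \<exists>i<m. sr i = u \<and> ds i = s u \<and> ds i \<notin> L else s u = \<alpha> (Str b) u)" "k3 \<le> k'' + 3 + 20 * m"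
      note e = escape_solved[OF peeled_solved[OF 2(2)] _ 3(2)]
      show "Q \<rho> (\<alpha>(Str b := s)) k3"
      proof (rule Q[OF 3(1)])
        show "input_ok (\<alpha>(Str b := s))" using 2(2) by (simp add: peeled_def input_ok_def)
        show "solved L rk ((\<alpha>(Str b := s)) (Str b))" using e(1) R by simp
        show "(\<alpha>(Str b := s)) (Str b) (sr i) \<notin> L" if "i < m" "sr i \<notin> L" "ds i \<notin> L" for i
          using e(2) R that by simp
        show "k3 \<le> k + 11 + 80 * (N + m)" using 1(3) 2(3) 3(3) by simp
      qed
    qed
  qed
qed (use assms in auto)

section \<open>Correctness of the algorithms on encoded games\<close>

locale encoded_game = arena +
  fixes G :: "nat srg"
  assumes G: "simple_recursive_game G" and pos: "positions G = {..<N}"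
    and arcs: "(v, u) \<in> arcs G \<longleftrightarrow> (\<exists>i<m. sr i = v \<and> ds i = u)"
    and own: "own v = (if v \<in> V_min G then 0 else if v \<in> V_max G then 1 else 2)"
begin

lemma own_cases:
  "{v. v < N \<and> own v \<noteq> 2 \<and> own v = 1} = V_max G" "{v. v < N \<and> own v \<noteq> 2 \<and> own v \<noteq> 1} = V_min G"
  "{v. v < N \<and> own v \<noteq> 2 \<and> own v = 0} = V_min G" "{v. v < N \<and> own v \<noteq> 2 \<and> own v \<noteq> 0} = V_max G"
  "v < N \<Longrightarrow> own v = 2 \<longleftrightarrow> v \<in> terminals G"
proof -
  have "v < N \<longleftrightarrow> v \<in> V_min G \<or> v \<in> V_max G \<or> v \<in> terminals G" for v
    using pos by (auto simp: positions_def set_eq_iff)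
  then show "{v. v < N \<and> own v \<noteq> 2 \<and> own v = 1} = V_max G"
    "{v. v < N \<and> own v \<noteq> 2 \<and> own v \<noteq> 1} = V_min G"
    "{v. v < N \<and> own v \<noteq> 2 \<and> own v = 0} = V_min G"
    "{v. v < N \<and> own v \<noteq> 2 \<and> own v \<noteq> 0} = V_max G"
    "v < N \<Longrightarrow> own v = 2 \<longleftrightarrow> v \<in> terminals G"
    using game_facts(4-7)[OF G] by (auto simp: own)
qed

lemma terminals_less: "v \<in> terminals G \<Longrightarrow> v < N"
  using pos by (auto simp: positions_def)

lemma weak_com_correct:
  assumes X: "\<And>t. t \<in> terminals G \<Longrightarrow> X t = payoff G t" "X N = Val G v\<^sub>0"
    and "regs_ok \<rho>" "input_ok \<alpha>" "zeroed True \<alpha>" "zeroed False \<alpha>"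
  shows "wp X w sz weak_com (\<lambda>\<rho>' \<alpha>' k'. \<rho>' 2 = N \<and> k' \<le> k + 22 + 160 * (N + m) \<and>
    weak_solution G v\<^sub>0 (X N) (\<alpha>' (Str True)) (\<alpha>' (Str False))) \<rho> \<alpha> k"
proof -
  define sdM where "sdM v \<longleftrightarrow> (if X N > 0 then \<not> X v < X N else X v < X N)" for v
  define onM where "onM v \<longleftrightarrow> own v = (if X N > 0 then 1 else 0)" for v
  define sdm where "sdm v \<longleftrightarrow> (if X N < 0 then \<not> X N < X v else X N < X v)" for v
  define onm where "onm v \<longleftrightarrow> own v = (if X N < 0 then 0 else 1)" for v
  interpret M: peeling X w sz N m off sr ds own "\<lambda>_ _. True" sdM onM True ..
  interpret m: peeling X w sz N m off sr ds own "\<lambda>_ _. True" sdm onm False ..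
  have ex: "\<exists>u. (v, u) \<in> arcs G" if "v \<in> V_min G \<union> V_max G" for v
    using game_facts(8)[OF G] that by blast
  have seedsM: "M.seeds = {t \<in> terminals G. if X N > 0 then \<not> payoff G t < X N else payoff G t < X N}"
    using own_cases(5) terminals_less X(1) by (auto simp: M.seeds_def sdM_def)
  have seedsm: "m.seeds = {t \<in> terminals G. if X N < 0 then \<not> X N < payoff G t else X N < payoff G t}"
    using own_cases(5) terminals_less X(1) by (auto simp: m.seeds_def sdm_def)
  have "guards (\<lambda>\<rho>. \<rho> 7 < N \<and> own (\<rho> 7) = 2) (\<lambda>\<rho>. sdM (\<rho> 7)) max_seed"
    "guards (\<lambda>\<rho>. \<rho> 7 < N \<and> \<rho> 15 = own (\<rho> 7) \<and> \<rho> 15 \<noteq> 2) (\<lambda>\<rho>. onM (\<rho> 7)) max_one"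
    unfolding sdM_def onM_def by (rule guards_max_seed guards_max_one)+
  note M = M.half_correct[OF refl this]
  have "guards (\<lambda>\<rho>. \<rho> 7 < N \<and> own (\<rho> 7) = 2) (\<lambda>\<rho>. sdm (\<rho> 7)) min_seed"
    "guards (\<lambda>\<rho>. \<rho> 7 < N \<and> \<rho> 15 = own (\<rho> 7) \<and> \<rho> 15 \<noteq> 2) (\<lambda>\<rho>. onm (\<rho> 7)) min_one"
    unfolding sdm_def onm_def by (rule guards_min_seed guards_min_one)+
  note m = m.half_correct[OF refl this]
  have max: "positional_strategy G (V_max G) s \<and> max_ensures G s v\<^sub>0 (Val G v\<^sub>0)"
    if s: "M.solved L rk s" "\<And>i. i < m \<Longrightarrow> sr i \<notin> L \<Longrightarrow> ds i \<notin> L \<Longrightarrow> s (sr i) \<notin> L" for L rk s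
  proof -
    \<comment> \<open>The sets \<open>A\<close> and \<open>B\<close> stay open because the sign of
      the value decides which player attracts.\<close>
    have att: "attracts G A B M.seeds L rk s"
      if "A = {v. v < N \<and> own v \<noteq> 2 \<and> onM v}" "B = {v. v < N \<and> own v \<noteq> 2 \<and> \<not> onM v}"
        "A \<union> B = V_min G \<union> V_max G" for A B
      by (rule M.solved_attracts[OF s(1) TrueI s(2) arcs that(1,2)]) (use that(3) ex in auto)
    have "if Val G v\<^sub>0 > 0
       then attracts G (V_max G) (V_min G) {t \<in> terminals G. \<not> payoff G t < Val G v\<^sub>0} L rk s
       else attracts G (V_min G) (V_max G) {t \<in> terminals G. payoff G t < Val G v\<^sub>0} L rk s"
    proof (cases "X N > 0")
      case True
      then show ?thesis
        using att[of "V_max G" "V_min G"] own_cases(1,2) X(2) by (auto simp: onM_def seedsM)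
    next
      case False
      then show ?thesis
        using att[of "V_min G" "V_max G"] own_cases(3,4) X(2) by (auto simp: onM_def seedsM)
    qed
    from weak_max[OF G this] show ?thesis by blast
  qed
  have min: "positional_strategy G (V_min G) s \<and> min_ensures G s v\<^sub>0 (Val G v\<^sub>0)"
    if s: "m.solved L rk s" "\<And>i. i < m \<Longrightarrow> sr i \<notin> L \<Longrightarrow> ds i \<notin> L \<Longrightarrow> s (sr i) \<notin> L" for L rk s
  proof -
    have att: "attracts G A B m.seeds L rk s"
      if "A = {v. v < N \<and> own v \<noteq> 2 \<and> onm v}" "B = {v. v < N \<and> own v \<noteq> 2 \<and> \<not> onm v}"
        "A \<union> B = V_min G \<union> V_max G" for A B
      by (rule m.solved_attracts[OF s(1) TrueI s(2) arcs that(1,2)]) (use that(3) ex in auto)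
    have "if Val G v\<^sub>0 < 0
       then attracts G (V_min G) (V_max G) {t \<in> terminals G. \<not> Val G v\<^sub>0 < payoff G t} L rk s
       else attracts G (V_max G) (V_min G) {t \<in> terminals G. Val G v\<^sub>0 < payoff G t} L rk s"
    proof (cases "X N < 0")
      case True
      then show ?thesis
        using att[of "V_min G" "V_max G"] own_cases(3,4) X(2) by (auto simp: onm_def seedsm)
    next
      case False
      then show ?thesis
        using att[of "V_max G" "V_min G"] own_cases(1,2) X(2) by (auto simp: onm_def seedsm)
    qed
    from weak_min[OF G this] show ?thesis by blast
  qed
  let ?Q1 = "\<lambda>\<rho>' \<alpha>' k'. regs_ok \<rho>' \<and> input_ok \<alpha>' \<and> k' \<le> k + 11 + 80 * (N + m) \<and>
      positional_strategy G (V_max G) (\<alpha>' (Str True)) \<and> max_ensures G (\<alpha>' (Str True)) v\<^sub>0 (Val G v\<^sub>0)"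
  have 1: "wp X w sz (half max_seed max_one True) ?Q1 \<rho> \<alpha> k"
    by (rule M[OF assms(3,4,5)]) (use max in blast)
  show ?thesis
    unfolding weak_com_def wp_Seq
  proof (rule wp_frame[OF 1])
    fix \<rho>' \<alpha>' k'
    assume Q1: "?Q1 \<rho>' \<alpha>' k'" and fr: "\<And>A. A \<notin> writes (half max_seed max_one True) \<Longrightarrow> \<alpha>' A = \<alpha> A"
    have "\<alpha>' (Hd False) = \<alpha> (Hd False)" "\<alpha>' (Cnt False) = \<alpha> (Cnt False)" "\<alpha>' (Lab False) = \<alpha> (Lab False)"
      using writes_half[of _ True] by (intro fr; blast)+
    then have "zeroed False \<alpha>'" using assms(6) by (simp add: zeroed_def)
    then have 2: "wp X w sz (half min_seed min_one False)
      (\<lambda>\<rho>'' \<alpha>'' k''. regs_ok \<rho>'' \<and> k'' \<le> k' + 11 + 80 * (N + m) \<and>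
      positional_strategy G (V_min G) (\<alpha>'' (Str False)) \<and> min_ensures G (\<alpha>'' (Str False)) v\<^sub>0 (Val G v\<^sub>0)) \<rho>' \<alpha>' k'"
      by (intro m) (use Q1 min in blast)+
    show "wp X w sz (half min_seed min_one False) (\<lambda>\<rho>' \<alpha>' k'. \<rho>' 2 = N \<and> k' \<le> k + 22 + 160 * (N + m) \<and>
      weak_solution G v\<^sub>0 (X N) (\<alpha>' (Str True)) (\<alpha>' (Str False))) \<rho>' \<alpha>' k'"
    proof (rule wp_frame[OF 2])
      fix \<rho>'' \<alpha>'' k''
      assume Q2: "regs_ok \<rho>'' \<and> k'' \<le> k' + 11 + 80 * (N + m) \<and>
        positional_strategy G (V_min G) (\<alpha>'' (Str False)) \<and> min_ensures G (\<alpha>'' (Str False)) v\<^sub>0 (Val G v\<^sub>0)"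
        and fr2: "\<And>A. A \<notin> writes (half min_seed min_one False) \<Longrightarrow> \<alpha>'' A = \<alpha>' A"
      have "\<alpha>'' (Str True) = \<alpha>' (Str True)"
        using writes_half[of _ False] by (intro fr2; blast)
      then show "\<rho>'' 2 = N \<and> k'' \<le> k + 22 + 160 * (N + m) \<and>
          weak_solution G v\<^sub>0 (X N) (\<alpha>'' (Str True)) (\<alpha>'' (Str False))"
        using Q1 Q2 X(2) by (simp add: weak_solution_def regs_ok_def)
    qed
  qed
qed

text \<open>One array can hold the strategies of both players, who own disjoint sets of positions;
  its optimality follows from \<open>level_attracts\<close> for the game and for its dual.\<close>

lemma strong_com_correct:
  assumes X: "\<And>v. v < N \<Longrightarrow> X (N + v) = Val G v"
    and "regs_ok \<rho>" "input_ok \<alpha>" "zeroed True \<alpha>"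
  shows "wp X w sz strong_com (\<lambda>\<rho>' \<alpha>' k'. \<rho>' 2 = N \<and> k' \<le> k + 22 + 160 * (N + m) \<and>
    strong_solution G (\<lambda>v. X (\<alpha>' (Src False) v)) (\<alpha>' (Str True)) (\<alpha>' (Str True))) \<rho> \<alpha> k"
proof -
  define on where "on v \<longleftrightarrow> (if own v = 1 then X (N + v) > 0 else X (N + v) < 0)" for v
  interpret S: peeling X w sz N m off sr ds own "\<lambda>x y. X (N + x) = X (N + y)" "\<lambda>_. True" on True ..
  have sol: "strong_solution G (\<lambda>v. X (i v)) s s"
    if s: "S.solved L rk s" and i: "\<And>v. v < N \<Longrightarrow> i v = N + v" for L rk s i
  proof -
    have T: "terminals G \<subseteq> S.seeds"
      using own_cases(5) terminals_less by (auto simp: S.seeds_def)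
    have Vmax: "v < N \<and> own v \<noteq> 2 \<and> (on v \<longleftrightarrow> 0 < Val G v)" if v: "v \<in> V_max G" for v
    proof -
      have "v \<in> {v. v < N \<and> own v \<noteq> 2 \<and> own v = 1}" using v by (simp only: own_cases)
      then show ?thesis by (auto simp: on_def X)
    qed
    have Vmin: "v < N \<and> own v \<noteq> 2 \<and> (on v \<longleftrightarrow> Val G v < 0)" if v: "v \<in> V_min G" for v
    proof -
      have "v \<in> {v. v < N \<and> own v \<noteq> 2 \<and> own v \<noteq> 1}" using v by (simp only: own_cases)
      then show ?thesis by (auto simp: on_def X)
    qed
    have lev: "level_attracts G L rk s" "level_attracts (dual G) L rk s"
      by (rule S.solved_level_attracts[OF s G _ arcs T Vmax Vmin]; simp add: X)+
    show ?thesis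
      unfolding strong_solution_def positional_strategy_def
      using level_attractsD(2)[OF lev(1)] strong_max[OF G lev(1)] strong_min[OF G lev(2)] i X
      by (auto simp: pos)
  qed
  have lvl1: "guards (\<lambda>\<rho>. \<rho> 7 < N \<and> \<rho> 15 = own (\<rho> 7) \<and> \<rho> 15 \<noteq> 2) (\<lambda>\<rho>. on (\<rho> 7)) level_one"
    unfolding on_def by (rule guards_level_one)
  show ?thesis
    unfolding strong_com_def wp_Seq
  proof (rule S.build_correct[OF guards_level_rel guards_trivial lvl1 assms(2,3)])
    show "\<forall>u<N. \<alpha> (Hd True) u = 0 \<and> \<alpha> (Cnt True) u = 0 \<and> \<alpha> (Lab True) u = 0"
      using assms(4) by (simp add: zeroed_def)
    fix \<rho> \<alpha> k' assume 1: "regs_ok \<rho>" "S.binv N m (\<rho> 13) \<alpha>" "k' \<le> k + 5 + 40 * (N + m)"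
    let ?Q = "\<lambda>\<rho>' \<alpha>' k'. \<rho>' 2 = N \<and> k' \<le> k + 22 + 160 * (N + m) \<and>
       strong_solution G (\<lambda>v. X (\<alpha>' (Src False) v)) (\<alpha>' (Str True)) (\<alpha>' (Str True))"
    show "wp X w sz (peel True) (wp X w sz (Set 7 0) (wp X w sz
       (While (Less 7 2) (Plus 16 2 7 ;; Put (Src False) 7 16 ;; Plus 7 7 5)) ?Q)) \<rho> \<alpha> k'"
      unfolding wp_Set_0
    proof (rule S.peel_correct[OF 1(1,2)])
      fix \<rho> \<alpha> k'' L rk assume 2: "regs_ok \<rho>" "S.peeled L rk \<alpha>" "k'' \<le> k' + 3 + 20 * (N + m)"
      let ?I = "\<lambda>\<rho> \<beta> k3. regs_ok \<rho> \<and> \<rho> 7 \<le> N \<and> \<beta> (Str True) = \<alpha> (Str True) \<and>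
        (\<forall>v<\<rho> 7. \<beta> (Src False) v = N + v) \<and> k3 \<le> k'' + 1 + 10 * \<rho> 7"
      show "wp X w sz (While (Less 7 2) (Plus 16 2 7 ;; Put (Src False) 7 16 ;; Plus 7 7 5)) ?Q
          (\<rho>(7 := 0)) \<alpha> (k'' + 1)"
      proof (rule wp_While[where I = ?I and K = "k'' + 1 + 10 * N"])
        show "?I (\<rho>(7 := 0)) \<alpha> (k'' + 1)" using 2(1) by (simp add: regs_ok_def)
      next
        fix \<rho> \<beta> k3 assume I: "?I \<rho> \<beta> k3" "holds X (Less 7 2) \<rho>"
        then show "k3 \<le> k'' + 1 + 10 * N \<and>
            wp X w sz (Plus 16 2 7 ;; Put (Src False) 7 16 ;; Plus 7 7 5) ?I \<rho> \<beta> (k3 + 2)"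
          using w_ge sz_work[of False] by (auto simp: wp_Seq wp_simps regs_ok_def less_Suc_eq)
      next
        fix \<rho> \<beta> k3 assume I: "?I \<rho> \<beta> k3" "\<not> holds X (Less 7 2) \<rho>"
        then have "\<rho> 7 = N" by (simp add: regs_ok_def)
        with I sol[OF S.peeled_solved[OF 2(2)], of "\<beta> (Src False)"] 1(3) 2(3)
        show "?Q \<rho> \<beta> (k3 + 2)" by (simp add: regs_ok_def)
      qed
    qed
  qed
qed

end

section \<open>Memory layout and input\<close>

fun slot :: "arr \<Rightarrow> nat" where
  "slot (Src b) = (if b then 0 else 7)"
| "slot (Nxt b) = (if b then 1 else 8)"
| "slot (Hd b) = (if b then 2 else 9)"
| "slot (Cnt b) = (if b then 3 else 10)"
| "slot (Str b) = (if b then 4 else 11)"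
| "slot (Lab b) = (if b then 5 else 12)"
| "slot (Que b) = (if b then 6 else 13)"
| "slot Own = 14"
| "slot Off = 15"
| "slot Heads = 16"
| "slot Mem = 17"

definition base_reg :: "arr \<Rightarrow> nat" where
  "base_reg A = 40 + slot A"

text \<open>The graph occupies 3 + 2 * N + m cells, and one more is reserved for the starting
  position of a weak instance. The work arrays follow as blocks of equal size, so their cells are 0
  at the start.\<close>

definition base :: "nat \<Rightarrow> nat \<Rightarrow> arr \<Rightarrow> nat" where
  "base N m A = (case A of Mem \<Rightarrow> 0 | Own \<Rightarrow> 2 | Off \<Rightarrow> 2 + N | Heads \<Rightarrow> 3 + 2 * N
     | _ \<Rightarrow> 4 + 2 * N + m + slot A * (N + m + 1))"

definition size_of :: "nat \<Rightarrow> nat \<Rightarrow> arr \<Rightarrow> nat" where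
  "size_of N m A = (case A of Mem \<Rightarrow> 0 | Own \<Rightarrow> N | Off \<Rightarrow> N + 1 | Heads \<Rightarrow> m | _ \<Rightarrow> N + m + 1)"

lemma base_bound: "i < size_of N m A \<Longrightarrow> base N m A + i < 4 + 2 * N + m + 14 * (N + m + 1)"
  by (cases A) (auto simp: base_def size_of_def)

lemma base_work: "slot A < 14 \<Longrightarrow> base N m A = 4 + 2 * N + m + slot A * (N + m + 1) \<and> size_of N m A = N + m + 1"
  by (cases A) (auto simp: base_def size_of_def)

lemma base_input: "\<not> slot A < 14 \<Longrightarrow> i < size_of N m A \<Longrightarrow> base N m A + i < 4 + 2 * N + m"
  by (cases A) (auto simp: base_def size_of_def split: if_splits)

lemma slot_inj: "slot A = slot B \<Longrightarrow> A = B"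
  by (cases A; cases B) (auto split: if_splits)

lemma slots_disjoint:
  fixes n :: nat
  assumes "x * n + i = y * n + j" "i < n" "j < n"
  shows "x = y"
proof -
  have "(x * n + i) div n = x" using assms(2) by simp
  moreover have "(y * n + j) div n = y" using assms(3) by simp
  ultimately show ?thesis using assms(1) by simp
qed

lemma base_disjoint:
  assumes "A \<noteq> B" "i < size_of N m A" "j < size_of N m B"
  shows "base N m A + i \<noteq> base N m B + j"
proof (cases "slot A < 14"; cases "slot B < 14")
  assume s: "slot A < 14" "slot B < 14"
  show ?thesis
  proof
    assume "base N m A + i = base N m B + j"
    then have "slot A * (N + m + 1) + i = slot B * (N + m + 1) + j"
      using base_work[OF s(1), of N m] base_work[OF s(2), of N m] by linarith
    then have "slot A = slot B"
      by (rule slots_disjoint) (use s assms base_work in auto)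
    with slot_inj assms(1) show False by blast
  qed
next
  assume s: "slot A < 14" "\<not> slot B < 14"
  then show ?thesis
    using base_work[OF s(1), of N m] base_input[OF s(2) assms(3)] by simp
next
  assume s: "\<not> slot A < 14" "slot B < 14"
  then show ?thesis
    using base_work[OF s(2), of N m] base_input[OF s(1) assms(2)] by simp
next
  assume "\<not> slot A < 14" "\<not> slot B < 14"
  then show ?thesis
    using assms by (cases A; cases B) (auto simp: base_def size_of_def split: if_splits)
qed

lemma layout_main: "layout base_reg (base N m) (size_of N m) 40"
  by unfold_locales (use base_disjoint in \<open>auto simp: base_reg_def\<close>)

text \<open>For the code before and after the main program the whole memory is one array; its base
  address 0 is found in a register that never changes.\<close>

definition flat_size :: "nat \<Rightarrow> arr \<Rightarrow> nat" where
  "flat_size w A = (if A = Mem then w else 0)"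

lemma layout_flat: "layout (\<lambda>_. 57) (\<lambda>_. 0) (flat_size w) 57"
  by unfold_locales (auto simp: flat_size_def split: if_splits)

text \<open>Register 20 receives the block size N + m + 1, and registers 40 to 56 the base addresses
  in the order given by \<open>slot\<close>.\<close>

definition prologue :: com where
  "prologue =
     Set 4 0 ;; Get 2 Mem 4 ;; Set 5 1 ;; Get 3 Mem 5 ;; Set 6 2 ;;
     Set 54 2 ;; Plus 55 54 2 ;; Plus 56 55 2 ;; Plus 56 56 5 ;;
     Plus 40 56 3 ;; Plus 40 40 5 ;; Plus 20 2 3 ;; Plus 20 20 5 ;;
     Plus 41 40 20 ;; Plus 42 41 20 ;; Plus 43 42 20 ;; Plus 44 43 20 ;; Plus 45 44 20 ;;
     Plus 46 45 20 ;; Plus 47 46 20 ;; Plus 48 47 20 ;; Plus 49 48 20 ;; Plus 50 49 20 ;;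
     Plus 51 50 20 ;; Plus 52 51 20 ;; Plus 53 52 20"

definition epilogue :: "arr \<Rightarrow> arr \<Rightarrow> nat \<Rightarrow> com" where
  "epilogue A B r = Copy 0 (base_reg A) ;; Copy 1 (base_reg B) ;; Copy 2 r"

text \<open>The register \<open>r\<close> is copied to register 2 as the answer about values: for a
  weak solution it holds N, the index of the given value; for a strong one it is the base register
  of the array of indices.\<close>

definition program :: "com \<Rightarrow> arr \<Rightarrow> arr \<Rightarrow> nat \<Rightarrow> instr list" where
  "program c A B r =
     (let P = compile (\<lambda>_. 57) 0 prologue; P' = P @ compile base_reg (length P) c
      in P' @ compile (\<lambda>_. 57) (length P') (epilogue A B r))"

lemma prologue_correct:
  assumes "60 * (N + m + 1) \<le> w" "\<alpha> Mem 0 = N" "\<alpha> Mem 1 = m" "\<rho> 57 = 0"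
  shows "wp X w (flat_size w) prologue (\<lambda>\<rho>' \<alpha>' k'. \<alpha>' = \<alpha> \<and> k' \<le> k + 30 \<and>
     \<rho>' 2 = N \<and> \<rho>' 3 = m \<and> \<rho>' 4 = 0 \<and> \<rho>' 5 = 1 \<and> \<rho>' 6 = 2 \<and> \<rho>' 57 = 0 \<and>
     (\<forall>A. A \<noteq> Mem \<longrightarrow> \<rho>' (base_reg A) = base N m A)) \<rho> \<alpha> k"
proof -
  \<comment> \<open>Listing the seventeen arrays lets symbolic execution check the registers one by
    one.\<close>
  have "(\<forall>A. A \<noteq> Mem \<longrightarrow> \<rho>' (base_reg A) = base N m A) \<longleftrightarrow>
     \<rho>' 40 = 4 + 2 * N + m \<and> \<rho>' 41 = 4 + 2 * N + m + (N + m + 1) \<and>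
     \<rho>' 42 = 4 + 2 * N + m + 2 * (N + m + 1) \<and> \<rho>' 43 = 4 + 2 * N + m + 3 * (N + m + 1) \<and>
     \<rho>' 44 = 4 + 2 * N + m + 4 * (N + m + 1) \<and> \<rho>' 45 = 4 + 2 * N + m + 5 * (N + m + 1) \<and>
     \<rho>' 46 = 4 + 2 * N + m + 6 * (N + m + 1) \<and> \<rho>' 47 = 4 + 2 * N + m + 7 * (N + m + 1) \<and>
     \<rho>' 48 = 4 + 2 * N + m + 8 * (N + m + 1) \<and> \<rho>' 49 = 4 + 2 * N + m + 9 * (N + m + 1) \<and>
     \<rho>' 50 = 4 + 2 * N + m + 10 * (N + m + 1) \<and> \<rho>' 51 = 4 + 2 * N + m + 11 * (N + m + 1) \<and>
     \<rho>' 52 = 4 + 2 * N + m + 12 * (N + m + 1) \<and> \<rho>' 53 = 4 + 2 * N + m + 13 * (N + m + 1) \<and>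
     \<rho>' 54 = 2 \<and> \<rho>' 55 = 2 + N \<and> \<rho>' 56 = 3 + 2 * N" (is "?l \<longleftrightarrow> ?r") for \<rho>'
  proof
    assume l: ?l
    show ?r
      using l[rule_format, of "Src True"] l[rule_format, of "Nxt True"] l[rule_format, of "Hd True"]
        l[rule_format, of "Cnt True"] l[rule_format, of "Str True"] l[rule_format, of "Lab True"]
        l[rule_format, of "Que True"] l[rule_format, of "Src False"] l[rule_format, of "Nxt False"]
        l[rule_format, of "Hd False"] l[rule_format, of "Cnt False"] l[rule_format, of "Str False"]
        l[rule_format, of "Lab False"] l[rule_format, of "Que False"] l[rule_format, of Own]
        l[rule_format, of Off] l[rule_format, of Heads]
      by (simp add: base_reg_def base_def)
  next
    assume ?r
    then have "A \<noteq> Mem \<longrightarrow> \<rho>' (base_reg A) = base N m A" for A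
      by (cases A) (auto simp: base_reg_def base_def)
    then show ?l by blast
  qed
  then show ?thesis
    using assms by (simp add: prologue_def wp_Seq wp_simps flat_size_def)
qed

text \<open>The memory is one flat array for the prologue and the epilogue and a family of named
  arrays in between; at each boundary the contents are read off from the machine state. The factor
  60 generously covers the input and fourteen work blocks, and the extra 40 steps pay for at most 30
  of the prologue and 3 of the epilogue.\<close>

lemma program_runs:
  assumes w: "60 * (N + m + 1) \<le> w"
    and xs: "\<And>i. cells xs i \<le> w" "cells xs 0 = N" "cells xs 1 = m"
    and c: "com_regs c \<subseteq> {..<40}" and r: "r < 57" "r \<noteq> 0" "r \<noteq> 1" and AB: "A \<noteq> Mem" "B \<noteq> Mem"
    and wp: "\<And>\<rho> \<alpha>. \<rho> 2 = N \<Longrightarrow> \<rho> 3 = m \<Longrightarrow> \<rho> 4 = 0 \<Longrightarrow> \<rho> 5 = 1 \<Longrightarrow> \<rho> 6 = 2 \<Longrightarrow>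
      (\<And>A i. i < size_of N m A \<Longrightarrow> \<alpha> A i = cells xs (base N m A + i)) \<Longrightarrow>
      wp X w (size_of N m) c (\<lambda>\<rho>' \<alpha>' k'. \<rho>' 2 = N \<and> k' \<le> T \<and> Post \<alpha>') \<rho> \<alpha> 0"
  shows "\<exists>s \<alpha>. runs (program c A B r) X (T + 40) w (initial_state xs) s \<and> Post \<alpha> \<and>
    (\<forall>i < size_of N m A. array_at s 0 i = \<alpha> A i) \<and> (\<forall>i < size_of N m B. array_at s 1 i = \<alpha> B i) \<and>
    (r = 2 \<longrightarrow> reg s 2 = N) \<and>
    (\<forall>C. r = base_reg C \<longrightarrow> (\<forall>i < size_of N m C. array_at s 2 i = \<alpha> C i))"
proof -
  interpret F: layout "\<lambda>_. 57" "\<lambda>_. 0" "flat_size w" 57 w by (rule layout_flat)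
  interpret L: layout base_reg "base N m" "size_of N m" 40 w by (rule layout_main)
  let ?P = "program c A B r"
  let ?P1 = "compile (\<lambda>_. 57) 0 prologue"
  let ?P2 = "compile base_reg (length ?P1) c"
  let ?P3 = "compile (\<lambda>_. 57) (length (?P1 @ ?P2)) (epilogue A B r)"
  have P: "?P = ?P1 @ ?P2 @ ?P3" by (simp add: program_def Let_def)
  have code: "code_at ?P 0 ?P1" "code_at ?P (length ?P1) ?P2" "code_at ?P (length (?P1 @ ?P2)) ?P3"
    unfolding code_at_def P
    by (intro exI[of _ "[]"] exI[of _ ?P1] exI[of _ "?P1 @ ?P2"] exI[of _ "?P2 @ ?P3"] exI[of _ ?P3], simp)+
  define s0 where "s0 = initial_state xs"
  have rep0: "F.rep 0 (\<lambda>_. 0) (\<lambda>_. cells xs) s0"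
    using xs(1) by (auto simp: F.rep_def s0_def initial_state_def bounded_state_def flat_size_def)
  have "wp X w (flat_size w) prologue (\<lambda>\<rho>' \<alpha>' k'. \<alpha>' = (\<lambda>_. cells xs) \<and> k' \<le> 0 + 30 \<and>
     \<rho>' 2 = N \<and> \<rho>' 3 = m \<and> \<rho>' 4 = 0 \<and> \<rho>' 5 = 1 \<and> \<rho>' 6 = 2 \<and> \<rho>' 57 = 0 \<and>
     (\<forall>A. A \<noteq> Mem \<longrightarrow> \<rho>' (base_reg A) = base N m A)) (\<lambda>_. 0) (\<lambda>_. cells xs) 0"
    by (rule prologue_correct) (use w xs in auto)
  then obtain t1 \<rho>1 where 1: "big X w (flat_size w) prologue (\<lambda>_. 0) (\<lambda>_. cells xs) t1 \<rho>1 (\<lambda>_. cells xs)"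
    "t1 \<le> 30" "\<rho>1 2 = N" "\<rho>1 3 = m" "\<rho>1 4 = 0" "\<rho>1 5 = 1" "\<rho>1 6 = 2"
    "\<forall>A. A \<noteq> Mem \<longrightarrow> \<rho>1 (base_reg A) = base N m A"
    by (auto simp: wp_def)
  have "com_regs prologue \<subseteq> {..<57}" by (simp add: prologue_def)
  from F.compile_correct[OF 1(1) this code(1) rep0] obtain s1 where
    s1: "reach ?P X w t1 s0 s1" "F.rep (length ?P1) \<rho>1 (\<lambda>_. cells xs) s1"
    by auto
  define \<alpha>1 where "\<alpha>1 A i = mem s1 (base N m A + i)" for A i
  have mem1: "mem s1 j = cells xs j" if "j < w" for j
    using s1(2) that by (auto simp: F.rep_def flat_size_def dest!: spec[of _ Mem])
  have \<alpha>1: "\<alpha>1 A i = cells xs (base N m A + i)" if "i < size_of N m A" for A i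
    using base_bound[OF that] w mem1 by (simp add: \<alpha>1_def)
  have b57: "reg s1 57 = 0" and r1: "\<forall>r<57. reg s1 r = \<rho>1 r" "bounded_state w s1" "pc s1 = length ?P1"
    using s1(2) by (auto simp: F.rep_def)
  have "reg s1 (base_reg A) = base N m A" for A
  proof (cases "A = Mem")
    case False
    then have "base_reg A < 57" by (cases A) (auto simp: base_reg_def)
    with False r1 1(8) show ?thesis by simp
  qed (simp add: base_reg_def base_def b57)
  then have rep1: "L.rep (length ?P1) \<rho>1 \<alpha>1 s1"
    using r1 by (auto simp: L.rep_def \<alpha>1_def)
  obtain t2 \<rho>2 \<alpha>2 where 2: "big X w (size_of N m) c \<rho>1 \<alpha>1 t2 \<rho>2 \<alpha>2" "t2 \<le> T" "\<rho>2 2 = N" "Post \<alpha>2"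
    using wp[OF 1(3-7) \<alpha>1] by (auto simp: wp_def)
  from L.compile_correct[OF 2(1) c code(2) rep1] obtain s2 where
    s2: "reach ?P X w t2 s1 s2" "L.rep (length (?P1 @ ?P2)) \<rho>2 \<alpha>2 s2"
    by auto
  have r2: "reg s2 2 = N" "\<And>A. reg s2 (base_reg A) = base N m A"
    "\<And>A i. i < size_of N m A \<Longrightarrow> mem s2 (base N m A + i) = \<alpha>2 A i"
    "bounded_state w s2" "pc s2 = length (?P1 @ ?P2)"
    using s2(2) 2(3) by (auto simp: L.rep_def)
  have rep2: "F.rep (length (?P1 @ ?P2)) (reg s2) (\<lambda>_. mem s2) s2"
    using r2(2)[of Mem] r2(4,5) by (auto simp: F.rep_def base_reg_def base_def)
  have br: "C \<noteq> Mem \<Longrightarrow> base_reg C < 57" "base_reg C \<noteq> 0" "base_reg C \<noteq> 1" "base_reg C \<noteq> Suc 0"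
      "base_reg C \<noteq> 2" for C
    by (cases C; auto simp: base_reg_def)+
  have "wp X w (flat_size w) (epilogue A B r) (\<lambda>\<rho>' \<alpha>' k'. \<alpha>' = (\<lambda>_. mem s2) \<and> k' \<le> 3 \<and>
      \<rho>' 0 = base N m A \<and> \<rho>' 1 = base N m B \<and> \<rho>' 2 = reg s2 r) (reg s2) (\<lambda>_. mem s2) 0"
    using r AB by (simp add: epilogue_def wp_Seq wp_simps r2 br)
  then obtain t3 \<rho>3 where 3: "big X w (flat_size w) (epilogue A B r) (reg s2) (\<lambda>_. mem s2) t3 \<rho>3 (\<lambda>_. mem s2)"
    "t3 \<le> 3" "\<rho>3 0 = base N m A" "\<rho>3 1 = base N m B" "\<rho>3 2 = reg s2 r"
    by (auto simp: wp_def)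
  have "com_regs (epilogue A B r) \<subseteq> {..<57}"
    using br AB r by (simp add: epilogue_def)
  from F.compile_correct[OF 3(1) this code(3) rep2] obtain s3 where
    s3: "reach ?P X w t3 s2 s3" "F.rep (length ?P) \<rho>3 (\<lambda>_. mem s2) s3"
    unfolding P by (auto simp: add.assoc)
  have "reach ?P X w (t1 + t2 + t3) s0 s3"
    using s1(1) s2(1) s3(1) reach_trans by blast
  then have "reach ?P X w (T + 40) s0 s3"
    by (rule reach_mono) (use 1(2) 2(2) 3(2) in simp)
  then have runs: "runs ?P X (T + 40) w s0 s3"
    using s3(2) unfolding runs_def reach_def halted_def F.rep_def by auto
  have r3: "reg s3 0 = base N m A" "reg s3 1 = base N m B" "reg s3 2 = reg s2 r"
    "\<And>j. j < w \<Longrightarrow> mem s3 j = mem s2 j"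
    using s3(2) 3 by (auto simp: F.rep_def flat_size_def dest!: spec[of _ Mem])
  have arr: "mem s3 (base N m C + i) = \<alpha>2 C i" if "i < size_of N m C" for C i
    using base_bound[OF that] w r3(4) r2(3)[OF that] by simp
  show ?thesis
    using runs 2(4) r3 arr r2(1,2) unfolding s0_def array_at_def
    by (intro exI[of _ s3] exI[of _ \<alpha>2]) auto
qed

section \<open>The input graph in memory\<close>

text \<open>The arcs appear in the order in which the memory lists their heads. Their sources are
  not part of the input and have to be recovered by \<open>build\<close> from the offsets.\<close>

definition flat_arcs :: "nat \<Rightarrow> (nat \<Rightarrow> nat list) \<Rightarrow> (nat \<times> nat) list" where
  "flat_arcs N adj = concat (map (\<lambda>v. map (Pair v) (adj v)) [0..<N])"

lemma length_flat_arcs: "length (flat_arcs N adj) = (\<Sum>u<N. length (adj u))"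
  by (induction N) (simp_all add: flat_arcs_def)

lemma flat_arcs_nth:
  "v < N \<Longrightarrow> j < length (adj v) \<Longrightarrow> flat_arcs N adj ! ((\<Sum>u<v. length (adj u)) + j) = (v, adj v ! j)"
proof (induction N)
  case (Suc N)
  have eq: "flat_arcs (Suc N) adj = flat_arcs N adj @ map (Pair N) (adj N)" by (simp add: flat_arcs_def)
  show ?case
  proof (cases "v = N")
    case True
    then show ?thesis using Suc.prems(2) by (simp add: eq nth_append flip: length_flat_arcs)
  next
    case False
    then have "v < N" using Suc.prems by simp
    have "(\<Sum>u<v. length (adj u)) + length (adj v) \<le> (\<Sum>u<N. length (adj u))"
      using sum_mono2[of "{..<N}" "{..<Suc v}" "\<lambda>u. length (adj u)"] \<open>v < N\<close> by auto
    then show ?thesis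
      using Suc \<open>v < N\<close> by (simp add: eq nth_append length_flat_arcs)
  qed
qed simp

lemma set_flat_arcs: "set (flat_arcs N adj) = (SIGMA v:{..<N}. set (adj v))"
  by (auto simp: flat_arcs_def)

lemma heads_flat_arcs: "concat (map adj [0..<N]) = map snd (flat_arcs N adj)"
  by (simp add: flat_arcs_def map_concat o_def)

context
  fixes G :: "nat srg" and adj :: "nat \<Rightarrow> nat list"
  assumes I: "input_game G adj"
begin

private abbreviation (input) "N \<equiv> card (positions G)"
private abbreviation (input) "m \<equiv> card (arcs G)"
private abbreviation (input) "off \<equiv> \<lambda>v. \<Sum>u<v. length (adj u)"
private abbreviation (input) "sr \<equiv> \<lambda>e. fst (flat_arcs N adj ! e)"
private abbreviation (input) "ds \<equiv> \<lambda>e. snd (flat_arcs N adj ! e)"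
private abbreviation (input) "own \<equiv> \<lambda>v. if v \<in> V_min G then 0 else if v \<in> V_max G then 1 else (2::nat)"

lemma input_facts:
  "simple_recursive_game G" "positions G = {..<N}"
  "\<And>v. v < N \<Longrightarrow> distinct (adj v) \<and> set (adj v) = {w. (v, w) \<in> arcs G}"
  using I by (auto simp: input_game_def adjacency_lists_def)

lemma less_N: "v \<in> positions G \<Longrightarrow> v < N"
  using input_facts(2) by blast

lemma arcs_eq: "arcs G = (SIGMA v:{..<N}. set (adj v))"
proof (rule set_eqI, clarify)
  fix v u
  have "(v, u) \<in> arcs G \<Longrightarrow> v < N"
    using game_facts(9)[OF input_facts(1)] input_facts(2) by blast
  then show "(v, u) \<in> arcs G \<longleftrightarrow> (v, u) \<in> (SIGMA v:{..<N}. set (adj v))"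
    using input_facts(3)[of v] by auto
qed

lemma length_arcs: "length (flat_arcs N adj) = m" "off N = m"
proof -
  have "m = (\<Sum>v<N. card (set (adj v)))" by (subst arcs_eq, subst card_SigmaI) auto
  also have "\<dots> = off N" using input_facts(3) by (intro sum.cong) (simp, metis distinct_card lessThan_iff)
  finally show "off N = m" by simp
  then show "length (flat_arcs N adj) = m" by (simp add: length_flat_arcs)
qed

text \<open>Each non-terminal is the source of an arc, and the terminals are at most as many as the
  arcs by assumption. This turns bounds in positions and arcs into bounds in arcs alone.\<close>

lemma positions_le: "N \<le> 2 * m"
proof -
  note g = game_facts[OF input_facts(1)]
  have "V_min G \<union> V_max G \<subseteq> fst ` arcs G" using g(8) by force
  then have "card (V_min G \<union> V_max G) \<le> m"
    using g(3) by (meson card_image_le card_mono finite_imageI le_trans)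
  moreover have "card (terminals G) \<le> m"
    using input_facts(1) by (simp add: simple_recursive_game_def)
  moreover have "N \<le> card (V_min G \<union> V_max G) + card (terminals G)"
    unfolding positions_def by (rule card_Un_le)
  ultimately show ?thesis by simp
qed

lemma encoded:
  assumes "60 * (N + m + 1) \<le> w"
  shows "encoded_game w (size_of N m) N m off sr ds own G"
proof (unfold_locales)
  show "off 0 = 0" "off N = m" "2 * N + m + 2 \<le> w"
    using length_arcs(2) assms by simp_all
  show "off v \<le> off (Suc v)" for v by simp
  show "sr e = v" if "v < N" "off v \<le> e" "e < off (Suc v)" for v e
    using flat_arcs_nth[OF that(1), of "e - off v" adj] that by simp
  have mem: "flat_arcs N adj ! e \<in> arcs G" if "e < m" for e
    using nth_mem[of e "flat_arcs N adj"] that length_arcs(1) by (simp add: set_flat_arcs arcs_eq)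
  show "sr e < N" "ds e < N" if "e < m" for e
    using mem[OF that] game_facts(9)[OF input_facts(1), of "sr e" "ds e"] input_facts(2) by auto
  show "simple_recursive_game G" "positions G = {..<N}" by (rule input_facts)+
  show "(v, u) \<in> arcs G \<longleftrightarrow> (\<exists>i<m. sr i = v \<and> ds i = u)" for v u
  proof -
    have "(v, u) \<in> arcs G \<longleftrightarrow> (v, u) \<in> set (flat_arcs N adj)" by (simp add: set_flat_arcs arcs_eq)
    then show ?thesis by (auto simp: in_set_conv_nth length_arcs(1) prod_eq_iff)
  qed
qed (simp_all add: size_of_def)

lemma memory:
  fixes ys
  defines "xs \<equiv> graph_code G adj @ ys"
  shows "cells xs 0 = N" "cells xs 1 = m" "\<And>v. v < N \<Longrightarrow> cells xs (2 + v) = own v"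
    "\<And>v. v \<le> N \<Longrightarrow> cells xs (2 + N + v) = off v" "\<And>e. e < m \<Longrightarrow> cells xs (3 + 2 * N + e) = ds e"
    "\<And>i. cells ys i = cells xs (3 + 2 * N + m + i)"
proof -
  define as where "as = map own [0..<N]"
  define bs where "bs = map off [0..<Suc N]"
  define cs where "cs = map snd (flat_arcs N adj)"
  have len: "length as = N" "length bs = Suc N" "length cs = m"
    by (simp_all add: as_def bs_def cs_def length_arcs)
  have xs: "xs = [N, m] @ as @ bs @ cs @ ys"
    by (simp only: xs_def graph_code_def Let_def heads_flat_arcs append_assoc as_def bs_def cs_def)
  have app: "cells (us @ vs) (length us + i) = cells vs i" for us vs :: "nat list" and i
    by (simp add: cells_def)
  have app1: "i < length us \<Longrightarrow> cells (us @ vs) i = us ! i" for us vs :: "nat list" and i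
    by (simp add: cells_def nth_append)
  show "cells xs 0 = N" "cells xs 1 = m" by (simp_all add: xs cells_def)
  show "cells xs (2 + v) = own v" if "v < N" for v
    using app[of "[N, m]" "as @ bs @ cs @ ys" v] app1[of v as "bs @ cs @ ys"] that
    by (simp add: xs len) (simp add: as_def)
  show "cells xs (2 + N + v) = off v" if "v \<le> N" for v
    using app[of "[N, m] @ as" "bs @ cs @ ys" v] app1[of v bs "cs @ ys"] that
    by (simp add: xs len del: upt_Suc) (simp add: bs_def del: upt_Suc)
  show "cells xs (3 + 2 * N + e) = ds e" if "e < m" for e
    using app[of "[N, m] @ as @ bs" "cs @ ys" e] app1[of e cs ys] that
    by (simp add: xs len mult_2 numeral_3_eq_3) (simp add: cs_def length_arcs)
  show "cells ys i = cells xs (3 + 2 * N + m + i)" for i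
    using app[of "[N, m] @ as @ bs @ cs" ys i] by (simp add: xs len mult_2 numeral_3_eq_3 add.assoc)
qed

lemma memory_bounded:
  assumes "60 * (N + m + 1) \<le> w" "\<And>i. cells ys i \<le> w"
  shows "cells (graph_code G adj @ ys) i \<le> w"
proof -
  interpret encoded_game X w "size_of N m" N m off sr ds own G by (rule encoded[OF assms(1)])
  consider "i = 0" | "i = 1" | v where "v < N" "i = 2 + v" | v where "v \<le> N" "i = 2 + N + v"
    | e where "e < m" "i = 3 + 2 * N + e" | j where "i = 3 + 2 * N + m + j"
  proof -
    assume *: "i = 0 \<Longrightarrow> thesis" "i = 1 \<Longrightarrow> thesis" "\<And>v. v < N \<Longrightarrow> i = 2 + v \<Longrightarrow> thesis"
      "\<And>v. v \<le> N \<Longrightarrow> i = 2 + N + v \<Longrightarrow> thesis" "\<And>e. e < m \<Longrightarrow> i = 3 + 2 * N + e \<Longrightarrow> thesis"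
      "\<And>j. i = 3 + 2 * N + m + j \<Longrightarrow> thesis"
    show thesis
      using *(1,2) *(3)[of "i - 2"] *(4)[of "i - (2 + N)"] *(5)[of "i - (3 + 2 * N)"]
        *(6)[of "i - (3 + 2 * N + m)"] by linarith
  qed
  then show ?thesis
  proof cases
    case (4 v)
    then show ?thesis using memory(4)[where v = v and ys = ys] off_le_m[of v] assms(1) by simp
  next
    case (5 e)
    then show ?thesis using memory(5)[where e = e and ys = ys] ds_less[of e] assms(1) by simp
  next
    case (6 j)
    then show ?thesis using memory(6)[of ys j] assms(2)[of j] by simp
  qed (use memory(1-3)[where ys = ys] assms(1) in simp_all)
qed

lemma memory_arrays:
  assumes w: "60 * (N + m + 1) \<le> w" and ys: "length ys \<le> 1"
    and \<alpha>: "\<And>A i. i < size_of N m A \<Longrightarrow> \<alpha> A i = cells (graph_code G adj @ ys) (base N m A + i)"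
  shows "arena.input_ok N m off ds own \<alpha>" "arena.zeroed N b \<alpha>"
proof -
  interpret encoded_game X w "size_of N m" N m off sr ds own G by (rule encoded[OF w])
  show "input_ok \<alpha>"
    unfolding input_ok_def
    using \<alpha>[of _ Own] \<alpha>[of _ Off] \<alpha>[of _ Heads] memory(3-5)[where ys = ys]
    by (auto simp: size_of_def base_def)
  have "\<alpha> A i = 0" if "slot A < 14" "i < N" for A i
  proof -
    \<comment> \<open>At most one cell follows the graph, and the work arrays begin behind
      it.\<close>
    have "cells ys (Suc j) = 0" for j using ys by (simp add: cells_def)
    then have z: "cells (graph_code G adj @ ys) (3 + 2 * N + m + Suc j) = 0" for j
      using memory(6)[of ys "Suc j"] by metis
    have "base N m A + i = 3 + 2 * N + m + Suc (slot A * (N + m + 1) + i)"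
      using base_work[OF that(1), of N m] by simp
    moreover have "i < size_of N m A" using base_work[OF that(1), of N m] that(2) by simp
    ultimately show ?thesis using z \<alpha> by metis
  qed
  then show "zeroed b \<alpha>" unfolding zeroed_def by simp
qed

lemma weak_run:
  assumes v0: "v\<^sub>0 \<in> positions G" and w: "60 * (N + m + 1) \<le> w"
  shows "\<exists>s. runs (program weak_com (Str True) (Str False) 2) (weak_numbers G v\<^sub>0) (22 + 160 * (N + m) + 40) w
     (weak_start G adj v\<^sub>0) s \<and> outputs_weak_solution G v\<^sub>0 s"
proof -
  define X where "X = weak_numbers G v\<^sub>0"
  define xs where "xs = graph_code G adj @ [v\<^sub>0]"
  interpret encoded_game X w "size_of N m" N m off sr ds own G by (rule encoded[OF w])
  have v0N: "v\<^sub>0 < N" using v0 input_facts(2) by blast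
  have X: "X t = payoff G t" if "t \<in> terminals G" for t
    using terminals_less[OF that] that by (simp add: X_def weak_numbers_def payoff_list_def cells_def nth_append)
  have XN: "X N = Val G v\<^sub>0"
    by (simp add: X_def weak_numbers_def payoff_list_def cells_def nth_append)
  have "cells [v\<^sub>0] i \<le> w" for i using v0N w by (simp add: cells_def)
  then have b: "cells xs i \<le> w" for i unfolding xs_def by (rule memory_bounded[OF w])
  have h: "cells xs 0 = N" "cells xs 1 = m" unfolding xs_def by (rule memory)+
  define Post where "Post \<alpha> \<longleftrightarrow> weak_solution G v\<^sub>0 (X N) (\<alpha> (Str True)) (\<alpha> (Str False))" for \<alpha> :: arrs
  have "\<exists>s \<alpha>. runs (program weak_com (Str True) (Str False) 2) X (22 + 160 * (N + m) + 40) w (initial_state xs) s \<and> Post \<alpha> \<and>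
    (\<forall>i < size_of N m (Str True). array_at s 0 i = \<alpha> (Str True) i) \<and>
    (\<forall>i < size_of N m (Str False). array_at s 1 i = \<alpha> (Str False) i) \<and>
    (2 = (2::nat) \<longrightarrow> reg s 2 = N) \<and>
    (\<forall>C. 2 = base_reg C \<longrightarrow> (\<forall>i < size_of N m C. array_at s 2 i = \<alpha> C i))"
  proof (rule program_runs[OF w b h weak_com_regs])
    fix \<rho> :: regs and \<alpha> :: arrs
    assume r: "\<rho> 2 = N" "\<rho> 3 = m" "\<rho> 4 = 0" "\<rho> 5 = 1" "\<rho> 6 = 2"
      and \<alpha>: "\<And>A i. i < size_of N m A \<Longrightarrow> \<alpha> A i = cells xs (base N m A + i)"
    have "regs_ok \<rho>" using r by (simp add: regs_ok_def)
    moreover have "input_ok \<alpha>" "zeroed True \<alpha>" "zeroed False \<alpha>"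
      using memory_arrays[OF w _ \<alpha>[unfolded xs_def]] by simp_all
    ultimately have "wp X w (size_of N m) weak_com (\<lambda>\<rho>' \<alpha>' k'. \<rho>' 2 = N \<and> k' \<le> 0 + 22 + 160 * (N + m) \<and> Post \<alpha>') \<rho> \<alpha> 0"
      unfolding Post_def by (intro weak_com_correct X XN)
    then show "wp X w (size_of N m) weak_com (\<lambda>\<rho>' \<alpha>' k'. \<rho>' 2 = N \<and> k' \<le> 22 + 160 * (N + m) \<and> Post \<alpha>') \<rho> \<alpha> 0"
      by simp
  qed simp_all
  then obtain s \<alpha> where s: "runs (program weak_com (Str True) (Str False) 2) X (22 + 160 * (N + m) + 40) w (initial_state xs) s"
    "Post \<alpha>" "\<And>i. i < N \<Longrightarrow> array_at s 0 i = \<alpha> (Str True) i"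
    "\<And>i. i < N \<Longrightarrow> array_at s 1 i = \<alpha> (Str False) i" "reg s 2 = N"
    by (auto simp: size_of_def)
  have "outputs_weak_solution G v\<^sub>0 s"
    unfolding outputs_weak_solution_def X_def[symmetric] s(5)
    by (rule weak_solution_cong[OF s(2)[unfolded Post_def]]) (use s(3,4) less_N in auto)
  with s(1) show ?thesis unfolding X_def xs_def weak_start_def by blast
qed

lemma strong_run:
  assumes w: "60 * (N + m + 1) \<le> w"
  shows "\<exists>s. runs (program strong_com (Str True) (Str True) (base_reg (Src False))) (strong_numbers G)
     (22 + 160 * (N + m) + 40) w (strong_start G adj) s \<and> outputs_strong_solution G s"
proof -
  define X where "X = strong_numbers G"
  define xs where "xs = graph_code G adj @ []"
  let ?P = "program strong_com (Str True) (Str True) (base_reg (Src False))"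
  interpret encoded_game X w "size_of N m" N m off sr ds own G by (rule encoded[OF w])
  have X: "X (N + v) = Val G v" if "v < N" for v
    using that by (simp add: X_def strong_numbers_def payoff_list_def cells_def nth_append)
  have "cells [] i \<le> w" for i by (simp add: cells_def)
  then have b: "cells xs i \<le> w" for i unfolding xs_def by (rule memory_bounded[OF w])
  have h: "cells xs 0 = N" "cells xs 1 = m" unfolding xs_def by (rule memory)+
  define Post where "Post \<alpha> \<longleftrightarrow> strong_solution G (\<lambda>v. X (\<alpha> (Src False) v)) (\<alpha> (Str True)) (\<alpha> (Str True))"
    for \<alpha> :: arrs
  have "\<exists>s \<alpha>. runs ?P X (22 + 160 * (N + m) + 40) w (initial_state xs) s \<and> Post \<alpha> \<and>
    (\<forall>i < size_of N m (Str True). array_at s 0 i = \<alpha> (Str True) i) \<and>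
    (\<forall>i < size_of N m (Str True). array_at s 1 i = \<alpha> (Str True) i) \<and>
    (base_reg (Src False) = 2 \<longrightarrow> reg s 2 = N) \<and>
    (\<forall>C. base_reg (Src False) = base_reg C \<longrightarrow> (\<forall>i < size_of N m C. array_at s 2 i = \<alpha> C i))"
  proof (rule program_runs[OF w b h strong_com_regs])
    fix \<rho> :: regs and \<alpha> :: arrs
    assume r: "\<rho> 2 = N" "\<rho> 3 = m" "\<rho> 4 = 0" "\<rho> 5 = 1" "\<rho> 6 = 2"
      and \<alpha>: "\<And>A i. i < size_of N m A \<Longrightarrow> \<alpha> A i = cells xs (base N m A + i)"
    have "regs_ok \<rho>" using r by (simp add: regs_ok_def)
    moreover have "input_ok \<alpha>" "zeroed True \<alpha>"
      using memory_arrays[OF w _ \<alpha>[unfolded xs_def]] by simp_all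
    ultimately have "wp X w (size_of N m) strong_com (\<lambda>\<rho>' \<alpha>' k'. \<rho>' 2 = N \<and> k' \<le> 0 + 22 + 160 * (N + m) \<and> Post \<alpha>') \<rho> \<alpha> 0"
      unfolding Post_def by (intro strong_com_correct X)
    then show "wp X w (size_of N m) strong_com (\<lambda>\<rho>' \<alpha>' k'. \<rho>' 2 = N \<and> k' \<le> 22 + 160 * (N + m) \<and> Post \<alpha>') \<rho> \<alpha> 0"
      by simp
  qed (simp_all add: base_reg_def)
  then obtain s \<alpha> where s: "runs ?P X (22 + 160 * (N + m) + 40) w (initial_state xs) s"
    "Post \<alpha>" "\<And>i. i < N \<Longrightarrow> array_at s 0 i = \<alpha> (Str True) i"
    "\<And>i. i < N \<Longrightarrow> array_at s 1 i = \<alpha> (Str True) i"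
    "\<And>i. i < N \<Longrightarrow> array_at s 2 i = \<alpha> (Src False) i"
    by (auto simp: size_of_def)
  have "outputs_strong_solution G s"
    unfolding outputs_strong_solution_def X_def[symmetric]
    by (rule strong_solution_cong[OF s(2)[unfolded Post_def]]) (use s(3-5) less_N in auto)
  with s(1) show ?thesis unfolding X_def xs_def strong_start_def by auto
qed

end

section \<open>Resource bounds and conclusion\<close>

lemma runs_mono: "runs P X t w s s' \<Longrightarrow> t \<le> t' \<Longrightarrow> runs P X t' w s s'"
proof -
  assume "runs P X t w s s'" "t \<le> t'"
  then obtain k where "k \<le> t'" "s' = (step P X ^^ k) s" "halted P s'"
      "\<forall>j\<le>k. bounded_state w ((step P X ^^ j) s)"
    unfolding runs_def using le_trans by blast
  then show ?thesis unfolding runs_def by blast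
qed

lemma linear_bounds: "resource_bounds (\<lambda>m. 1000 * (m + 1)) (\<lambda>m. 200 * (m + 1))"
proof -
  have O: "(\<lambda>m. real (c * (m + 1))) \<in> O(\<lambda>m. real m)" for c :: nat
  proof (rule bigoI)
    show "eventually (\<lambda>m. norm (real (c * (m + 1))) \<le> (2 * c) * norm (real m)) at_top"
    proof (rule eventually_sequentiallyI)
      fix m :: nat assume "1 \<le> m"
      then have "c * (m + 1) \<le> (2 * c) * m" by (simp add: algebra_simps)
      then have "real (c * (m + 1)) \<le> real ((2 * c) * m)" by (rule of_nat_mono)
      then show "norm (real (c * (m + 1))) \<le> (2 * c) * norm (real m)" by simp
    qed
  qed
  show ?thesis
    unfolding resource_bounds_def using O[of 1000] O[of 200] by (auto intro!: exI[of _ 1] simp del: of_nat_mult)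
qed

theorem proposition2:
  shows "(\<exists>P T W. resource_bounds T W \<and>
            (\<forall>G adj v\<^sub>0. input_game G adj \<and> v\<^sub>0 \<in> positions G \<longrightarrow>
               (\<exists>s. runs P (weak_numbers G v\<^sub>0) (T (card (arcs G))) (W (card (arcs G)))
                      (weak_start G adj v\<^sub>0) s \<and>
                    outputs_weak_solution G v\<^sub>0 s)))
       \<and> (\<exists>P T W. resource_bounds T W \<and>
            (\<forall>G adj. input_game G adj \<longrightarrow>
               (\<exists>s. runs P (strong_numbers G) (T (card (arcs G))) (W (card (arcs G)))
                      (strong_start G adj) s \<and>
                    outputs_strong_solution G s)))"
proof -
  \<comment> \<open>With at most 2 * m positions the left-hand sides are at most 180 * m + 60 and
    480 * m + 62.\<close>
  have bounds: "60 * (card (positions G) + card (arcs G) + 1) \<le> 200 * (card (arcs G) + 1)"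
    "22 + 160 * (card (positions G) + card (arcs G)) + 40 \<le> 1000 * (card (arcs G) + 1)"
    if "input_game G adj" for G adj
    using positions_le[OF that] by simp_all
  have weak: "\<forall>G adj v\<^sub>0. input_game G adj \<and> v\<^sub>0 \<in> positions G \<longrightarrow>
      (\<exists>s. runs (program weak_com (Str True) (Str False) 2) (weak_numbers G v\<^sub>0)
        (1000 * (card (arcs G) + 1)) (200 * (card (arcs G) + 1)) (weak_start G adj v\<^sub>0) s \<and>
      outputs_weak_solution G v\<^sub>0 s)"
    using weak_run bounds runs_mono by blast
  have strong: "\<forall>G adj. input_game G adj \<longrightarrow>
      (\<exists>s. runs (program strong_com (Str True) (Str True) (base_reg (Src False))) (strong_numbers G)
        (1000 * (card (arcs G) + 1)) (200 * (card (arcs G) + 1)) (strong_start G adj) s \<and>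
      outputs_strong_solution G s)"
    using strong_run bounds runs_mono by blast
  show ?thesis
    by (rule conjI; rule exI, rule exI, rule exI, rule conjI[OF linear_bounds]; rule weak strong)
qed

end
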